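(* Let $\mathcal M\subset\mathbb R^d$ be a smooth compact submanifold with reach $\tau>0$, let $r\ge2$ be an integer, and let $f\in C^r(\mathbb T,\mathcal M)$ be an $r$ times (continuously) differentiable function on the torus with values in $\mathcal M$. Let $0<\varepsilon<\tau$ and let the bandwidth $n\in\mathbb N$, $n\geq 1$, of the Fourier partial sum $S_nf$ be at least such that $\|f(x)-S_nf(x)\|_2\le\varepsilon$ for all $x\in\mathbb T$, i.e. $$n^{r-\frac12}\ge\frac{C_1\|f^{(r)}\|_{L^2(\mathbb T),2}}{\varepsilon}\quad\text{with}\quad C_1=\frac{\sqrt{2d}}{(2\pi)^r}.$$ Then the projection $P_{\mathcal M}\circ S_nf$ of the Fourier partial sum satisfies for all $x\in\mathbb T$ $$\|P_{\mathcal M}\circ S_nf(x)-f(x)\|_2\le2\,C_1\,n^{\frac12-r}\,\|f^{(r)}\|_{L^2(\mathbb T),2},$$ and its differential satisfies for all $x\in\mathbb T$ $$\|\mathrm d(P_{\mathcal M}\circ S_nf)(x)-\mathrm df(x)\|_2\le2\pi\,C_1\,n^{\frac32-r}\,\|f^{(r)}\|_{L^2(\mathbb T),2}+C_2\,n^{\frac12-r}\,\|f^{(r)}\|_{L^2(\mathbb T),2}^2,$$ with the constant $$C_2=C_1\left(\frac2\tau+\frac1{\tau-\varepsilon}\right)\left(1+2\pi\,C_1\,n^{\frac32-r}\right).$$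
   Context: $\mathbb T=\mathbb R/\mathbb Z$ is the one-dimensional torus. For $f\in C(\mathbb T,\mathbb R^d)$ the Fourier partial sum is $S_nf(t)=\sum_{k=-n}^nc_k(f)e^{2\pi ikt}$ with vector-valued Fourier coefficients $c_k(f)=\int_0^1f(x)e^{-2\pi ikx}\,\mathrm dx$. The norm is $\|g\|_{L^2(\mathbb T),2}^2=\int_{\mathbb T}\|g(x)\|_2^2\,\mathrm dx$, $f^{(r)}$ is the $r$-th derivative, and $f$ is regarded as $\mathbb R^d$-valued through $\mathcal M\subset\mathbb R^d$. The reach $\tau>0$ of a smooth compact submanifold $\mathcal M\subset\mathbb R^d$ is the maximal constant such that $E(\mathbf m,\mathbf v)=\mathbf m+\mathbf v$ is injective on $\{(\mathbf m,\mathbf v):\mathbf m\in\mathcal M,\ \mathbf v\in N_{\mathbf m}\mathcal M,\ \|\mathbf v\|_2<\tau\}$, where $N_{\mathbf m}\mathcal M$ is the normal space at $\mathbf m$. On $U=\{\mathbf y\in\mathbb R^d:\min_{\mathbf m\in\mathcal M}\|\mathbf y-\mathbf m\|_2<\tau\}$ the projection operator $P_{\mathcal M}(\mathbf x)=\operatorname{argmin}_{\mathbf m\in\mathcal M}\|\mathbf x-\mathbf m\|_2$ is well defined and smooth. *)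

theory Defs
  imports "HOL-Analysis.Analysis"
begin

section \<open>Differentiability of higher order\<close>

text \<open>Intended for open \<open>U\<close>. On finite-dimensional domains, asking for all iterated directional
  derivatives up to order \<open>k\<close> to be differentiable (continuous, for order \<open>k\<close>) is the usual notion of
  class \<open>C^k\<close>.\<close>

primrec Ck_on :: "nat \<Rightarrow> ('a::real_normed_vector \<Rightarrow> 'b::real_normed_vector) \<Rightarrow> 'a set \<Rightarrow> bool" where
  "Ck_on 0 f U \<longleftrightarrow> continuous_on U f"
| "Ck_on (Suc k) f U \<longleftrightarrow>
     f differentiable_on U \<and> (\<forall>v. Ck_on k (\<lambda>x. frechet_derivative f (at x) v) U)"

definition smooth_on :: "('a::real_normed_vector \<Rightarrow> 'b::real_normed_vector) \<Rightarrow> 'a set \<Rightarrow> bool" where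
  "smooth_on f U \<longleftrightarrow> (\<forall>k. Ck_on k f U)"

definition iterated_deriv :: "nat \<Rightarrow> (real \<Rightarrow> 'a::real_normed_vector) \<Rightarrow> real \<Rightarrow> 'a" where
  "iterated_deriv r f = ((\<lambda>g x. vector_derivative g (at x)) ^^ r) f"


section \<open>Submanifolds of Euclidean space, normal spaces, reach\<close>

text \<open>Embedded submanifolds without boundary, by flattening charts of the ambient space.\<close>

definition smooth_submanifold :: "nat \<Rightarrow> 'a::euclidean_space set \<Rightarrow> bool" where
  "smooth_submanifold k M \<longleftrightarrow>
     (\<forall>p\<in>M. \<exists>U V S (\<phi> :: 'a \<Rightarrow> 'a) (\<psi> :: 'a \<Rightarrow> 'a).
        open U \<and> p \<in> U \<and> open V \<and> homeomorphism U V \<phi> \<psi> \<and> smooth_on \<phi> U \<and> smooth_on \<psi> V \<and>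
        subspace S \<and> dim S = k \<and> \<phi> ` (U \<inter> M) = V \<inter> S)"

text \<open>The tangent space consists of the velocities of smooth curves in \<open>M\<close> through \<open>m\<close>.\<close>

definition tangent_space :: "'a::euclidean_space set \<Rightarrow> 'a \<Rightarrow> 'a set" where
  "tangent_space M m =
     {v. \<exists>\<gamma> e. 0 < e \<and> smooth_on \<gamma> {-e<..<e} \<and> \<gamma> ` {-e<..<e} \<subseteq> M \<and> \<gamma> (0::real) = m \<and>
           (\<gamma> has_vector_derivative v) (at 0)}"

definition normal_space :: "'a::euclidean_space set \<Rightarrow> 'a \<Rightarrow> 'a set" where
  "normal_space M m = (tangent_space M m)\<^sup>\<bottom>"

definition normal_tube :: "'a::euclidean_space set \<Rightarrow> ereal \<Rightarrow> ('a \<times> 'a) set" where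
  "normal_tube M t = {(m, v). m \<in> M \<and> v \<in> normal_space M m \<and> ereal (norm v) < t}"

text \<open>The reach takes values in the extended reals because it is infinite when \<open>M\<close> is a single
  point. The lemma \<open>inj_on_normal_tube_iff_le_reach\<close> shows that the maximum always exists.\<close>

definition reach :: "'a::euclidean_space set \<Rightarrow> ereal" where
  "reach M = (GREATEST t. inj_on (\<lambda>(m, v). m + v) (normal_tube M t))"

lemma inj_on_normal_tube_iff_le_reach:
  "inj_on (\<lambda>(m, v). m + v) (normal_tube M t) \<longleftrightarrow> t \<le> reach M"
proof -
  let ?I = "\<lambda>t. inj_on (\<lambda>(m, v). m + v) (normal_tube M t)"
  have mono: "?I s" if "?I t" "s \<le> t" for s t
  proof (rule inj_on_subset[OF that(1)])
    show "normal_tube M s \<subseteq> normal_tube M t"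
      using that(2) by (auto simp: normal_tube_def intro: less_le_trans)
  qed
  define R where "R = Sup {t. ?I t}"
  have R: "?I R"
  proof (rule inj_onI)
    fix p q
    assume p: "p \<in> normal_tube M R" and q: "q \<in> normal_tube M R"
      and eq: "(\<lambda>(m, v). m + v) p = (\<lambda>(m, v). m + v) q"
    have "max (ereal (norm (snd p))) (ereal (norm (snd q))) < R"
      using p q by (auto simp: normal_tube_def max_def)
    then obtain t where t: "?I t" "max (ereal (norm (snd p))) (ereal (norm (snd q))) < t"
      unfolding R_def less_Sup_iff by blast
    then have "p \<in> normal_tube M t" "q \<in> normal_tube M t"
      using p q by (auto simp: normal_tube_def)
    then show "p = q" using inj_onD[OF t(1) eq] by blast
  qed
  have upper: "t \<le> R" if "?I t" for t
    unfolding R_def using that by (intro Sup_upper) simp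
  have "reach M = R"
    unfolding reach_def by (rule Greatest_equality) (use R upper in auto)
  then show ?thesis using mono R upper by blast
qed


section \<open>Fourier partial sums on the torus\<close>

text \<open>Functions on the torus are functions on the reals with period 1.\<close>

definition complex_vec :: "real ^ 'd \<Rightarrow> complex ^ 'd" where
  "complex_vec v = (\<chi> j. complex_of_real (v $ j))"

definition fourier_coeff :: "(real \<Rightarrow> real ^ 'd) \<Rightarrow> int \<Rightarrow> complex ^ 'd" where
  "fourier_coeff f k =
     integral {0..1} (\<lambda>x. exp (- 2 * pi * \<i> * of_int k * of_real x) *s complex_vec (f x))"

definition complex_fourier_sum :: "nat \<Rightarrow> (real \<Rightarrow> real ^ 'd) \<Rightarrow> real \<Rightarrow> complex ^ 'd" where
  "complex_fourier_sum n f t =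
     (\<Sum>k = - int n..int n. exp (2 * pi * \<i> * of_int k * of_real t) *s fourier_coeff f k)"

text \<open>The Fourier partial sum of a function with values in \<open>\<real>^d\<close> has real entries (lemma
  \<open>complex_vec_fourier_sum\<close>), so taking real parts merely changes the type.\<close>

definition fourier_sum :: "nat \<Rightarrow> (real \<Rightarrow> real ^ 'd) \<Rightarrow> real \<Rightarrow> real ^ 'd" where
  "fourier_sum n f t = (\<chi> j. Re (complex_fourier_sum n f t $ j))"

lemma fourier_coeff_nth:
  assumes "continuous_on UNIV f"
  shows "fourier_coeff f k $ j =
    integral {0..1} (\<lambda>x. exp (- 2 * pi * \<i> * of_int k * of_real x) * of_real (f x $ j))"
proof -
  have f: "continuous_on {0..1} f" using assms continuous_on_subset by blast
  have "continuous_on {0..1}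
    (\<lambda>x. exp (- 2 * pi * \<i> * of_int k * of_real x) *s complex_vec (f x))"
    unfolding vector_scalar_mult_def complex_vec_def
    by (intro continuous_intros continuous_on_vec_lambda f)
  then have int: "(\<lambda>x. exp (- 2 * pi * \<i> * of_int k * of_real x) *s complex_vec (f x))
      integrable_on {0..1}"
    by (rule integrable_continuous_interval)
  show ?thesis
    using integral_linear[OF int bounded_linear_vec_nth[of j]]
    by (simp add: fourier_coeff_def o_def complex_vec_def)
qed

lemma complex_vec_fourier_sum:
  assumes "continuous_on UNIV f"
  shows "complex_vec (fourier_sum n f t) = complex_fourier_sum n f t"
proof -
  have c: "cnj (fourier_coeff f k $ j) = fourier_coeff f (- k) $ j" for k j
    unfolding fourier_coeff_nth[OF assms] integral_cnj by (simp add: exp_cnj)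
  have "cnj (complex_fourier_sum n f t $ j) = complex_fourier_sum n f t $ j" for j
  proof -
    have "cnj (complex_fourier_sum n f t $ j) =
      (\<Sum>k = - int n..int n. exp (2 * pi * \<i> * of_int (- k) * of_real t) * fourier_coeff f (- k) $ j)"
      by (simp add: complex_fourier_sum_def c exp_cnj)
    also have "\<dots> = (\<Sum>k = - int n..int n. exp (2 * pi * \<i> * of_int k * of_real t) * fourier_coeff f k $ j)"
      by (rule sum.reindex_bij_witness[where i = uminus and j = uminus]) auto
    finally show ?thesis by (simp add: complex_fourier_sum_def)
  qed
  then have "complex_of_real (Re (complex_fourier_sum n f t $ j)) = complex_fourier_sum n f t $ j" for j
    by (metis Reals_cnj_iff of_real_Re)
  then show ?thesis
    by (simp add: vec_eq_iff complex_vec_def fourier_sum_def)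
qed

text \<open>The norm in \<open>L^2\<close> of the torus of a vector-valued function.\<close>

definition L2_torus_norm :: "(real \<Rightarrow> 'a::real_normed_vector) \<Rightarrow> real" where
  "L2_torus_norm g = sqrt (integral {0..1} (\<lambda>x. (norm (g x))\<^sup>2))"

end

theory Submission
  imports Defs
begin

text \<open>Let \<open>h = S\<^sub>n f\<close>, \<open>p = P\<^sub>M \<circ> h\<close> and let \<open>\<Pi>\<^sub>m\<close> be the orthogonal projection onto the tangent space at
  \<open>m\<close>. The sup norms of \<open>f - h\<close> and \<open>f' - h'\<close> are bounded by the tails of the Fourier series, using Bessel's
  inequality for \<open>f\<^sup>(\<^sup>r\<^sup>)\<close>, and \<open>norm (p - h) \<le> norm (f - h)\<close> gives the first estimate. For the derivative write
    \<open>p' - f' = (p' - \<Pi>\<^sub>p h') + (\<Pi>\<^sub>p - \<Pi>\<^sub>f) h' + \<Pi>\<^sub>f (h' - f')\<close>.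
  For \<open>t\<close> below the reach, \<open>M\<close> stays outside all balls of radius \<open>t\<close> tangent to \<open>M\<close>. Hence nearest points
  depend on the point in a Lipschitz way and tangent spaces turn with speed at most \<open>1 / t\<close>, so that the
  first two terms are at most \<open>norm (f - h) * norm h'\<close> times \<open>1 / (t - \<epsilon>)\<close> and \<open>2 / t\<close>, respectively. Finally,
  let \<open>t\<close> tend to the reach.\<close>

section \<open>Smooth functions and charts\<close>

text \<open>The reach only speaks of injectivity, while the claim is about derivatives. The turning
  speed of the tangent spaces is second order information; it is read off from the ball condition by
  comparing chords in a flattening chart, at the cost of an arbitrarily small part of the radius.
  This is why two radii below the reach occur and the reach itself is approached only at the end,
  which also covers an infinite reach. The curve \<open>p\<close> is at first known to be Lipschitz
  only; its derivative is found by linearizing the condition that \<open>h x - p x\<close> is normal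
  to \<open>M\<close> at \<open>p x\<close>. The 2 in \<open>2 / t\<close> is a bound for the
  Lipschitz constant of the nearest points along the segment from \<open>f x\<close> to
  \<open>h x\<close>; the 2 under the root in \<open>C1\<close> counts the two tails of the Fourier
  series. Since \<open>f'\<close> has mean zero, \<open>norm (h' x)\<close> is bounded by the norm
  of the top derivative, uniformly in \<open>n\<close>; this makes the last term of the claim
  quadratic in that norm.\<close>

lemma smooth_on_directional_derivative:
  "smooth_on f U \<Longrightarrow> smooth_on (\<lambda>x. frechet_derivative f (at x) v) U"
  unfolding smooth_on_def by (metis Ck_on.simps(2))

lemma smooth_on_has_derivative:
  assumes "smooth_on f U" "open U" "x \<in> U"
  shows "(f has_derivative frechet_derivative f (at x)) (at x)"
proof -
  have "f differentiable_on U"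
    using assms(1) unfolding smooth_on_def by (metis Ck_on.simps(2))
  then have "f differentiable (at x)"
    using assms(2,3) by (metis at_within_open differentiable_on_def)
  then show ?thesis by (simp add: frechet_derivative_works)
qed

lemma Ck_on_cong:
  assumes "open U" "\<And>x. x \<in> U \<Longrightarrow> f x = g x"
  shows "Ck_on k f U \<longleftrightarrow> Ck_on k g U"
  using assms(2)
proof (induction k arbitrary: f g)
  case 0
  then show ?case by (auto cong: continuous_on_cong)
next
  case (Suc k)
  have deriv: "(f has_derivative D) (at x) \<longleftrightarrow> (g has_derivative D) (at x)" if "x \<in> U" for x D
    by (metis Suc.prems assms(1) has_derivative_transform_within_open that)
  have "f differentiable_on U \<longleftrightarrow> g differentiable_on U"
    using deriv unfolding differentiable_on_def differentiable_def
    by (metis assms(1) at_within_open)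
  moreover have "frechet_derivative f (at x) = frechet_derivative g (at x)" if "x \<in> U" for x
    unfolding frechet_derivative_def using deriv[OF that] by simp
  ultimately show ?case
    using Suc.IH[of "\<lambda>x. frechet_derivative f (at x) v" "\<lambda>x. frechet_derivative g (at x) v" for v]
    by simp
qed

text \<open>The derivative of the curve in direction \<open>v\<close> is again such a curve, for a
  directional derivative of \<open>g\<close> and multiplied by \<open>v\<close>. The scalar
  \<open>c\<close> collects these factors so that the induction closes.\<close>

lemma Ck_on_line:
  fixes g :: "'a::real_normed_vector \<Rightarrow> 'b::real_normed_vector"
  assumes "smooth_on g V" "open V" "open I" "\<And>t. t \<in> I \<Longrightarrow> s + t *\<^sub>R \<sigma> \<in> V"
  shows "Ck_on k (\<lambda>t::real. c *\<^sub>R g (s + t *\<^sub>R \<sigma>)) I"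
  using assms(1)
proof (induction k arbitrary: g c)
  case 0
  then have "continuous_on V g" unfolding smooth_on_def by (metis Ck_on.simps(1))
  then show ?case
    by (auto intro!: continuous_intros continuous_on_compose2[of V g] simp: assms(4))
next
  case (Suc k)
  let ?f = "\<lambda>t::real. c *\<^sub>R g (s + t *\<^sub>R \<sigma>)"
  have deriv: "(?f has_derivative (\<lambda>v. (c * v) *\<^sub>R frechet_derivative g (at (s + t *\<^sub>R \<sigma>)) \<sigma>)) (at t)"
    if "t \<in> I" for t
  proof -
    let ?D = "frechet_derivative g (at (s + t *\<^sub>R \<sigma>))"
    have g: "(g has_derivative ?D) (at (s + t *\<^sub>R \<sigma>))"
      using smooth_on_has_derivative[OF Suc.prems assms(2)] assms(4)[OF that] by blast
    have "((\<lambda>t. g (s + t *\<^sub>R \<sigma>)) has_derivative (\<lambda>v. ?D (v *\<^sub>R \<sigma>))) (at t)"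
      by (rule has_derivative_compose[where f="\<lambda>t. s + t *\<^sub>R \<sigma>"]) (auto intro!: derivative_eq_intros g)
    then have "(?f has_derivative (\<lambda>v. c *\<^sub>R ?D (v *\<^sub>R \<sigma>))) (at t)"
      by (rule has_derivative_scaleR_right)
    moreover have "linear ?D" using g by (rule has_derivative_linear)
    ultimately show ?thesis by (simp add: linear_cmul)
  qed
  have "Ck_on k (\<lambda>x. frechet_derivative ?f (at x) v) I" for v
  proof -
    have "Ck_on k (\<lambda>t. (c * v) *\<^sub>R frechet_derivative g (at (s + t *\<^sub>R \<sigma>)) \<sigma>) I"
      using Suc.IH[OF smooth_on_directional_derivative[OF Suc.prems]] .
    moreover have "frechet_derivative ?f (at t) v = (c * v) *\<^sub>R frechet_derivative g (at (s + t *\<^sub>R \<sigma>)) \<sigma>"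
      if "t \<in> I" for t
      by (simp flip: frechet_derivative_at[OF deriv[OF that]])
    ultimately show ?thesis by (subst Ck_on_cong[OF assms(3)])
  qed
  moreover have "?f differentiable_on I"
    using deriv by (meson differentiableI differentiable_at_imp_differentiable_on)
  ultimately show ?case by simp
qed

text \<open>\<open>Ck_on\<close> speaks about one direction at a time. Linear maps on a
  finite-dimensional space that tend to 0 on the basis tend to 0 in operator norm, and so continuity
  and differentiability of the Jacobians become uniform in the direction. Linearity is asked only
  eventually because the Jacobians are known to be linear only inside the chart domain.\<close>

lemma linear_tendsto_uniform:
  fixes A :: "'c \<Rightarrow> 'a::euclidean_space \<Rightarrow> 'b::real_normed_vector"
  assumes "\<forall>\<^sub>F s in F. linear (A s)" "\<And>b. b \<in> Basis \<Longrightarrow> ((\<lambda>s. A s b) \<longlongrightarrow> 0) F" "0 < e"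
  shows "\<forall>\<^sub>F s in F. \<forall>w. norm (A s w) \<le> e * norm w"
proof -
  have "((\<lambda>s. \<Sum>b\<in>Basis. norm (A s b)) \<longlongrightarrow> (\<Sum>b\<in>(Basis::'a set). 0)) F"
    by (intro tendsto_sum tendsto_norm_zero assms(2))
  then have "\<forall>\<^sub>F s in F. (\<Sum>b\<in>Basis. norm (A s b)) < e"
    using assms(3) by (simp add: order_tendstoD(2))
  with assms(1) show ?thesis
  proof eventually_elim
    case (elim s)
    show ?case
    proof
      fix w :: 'a
      have "A s w = A s (\<Sum>b\<in>Basis. (w \<bullet> b) *\<^sub>R b)" by (simp add: euclidean_representation)
      also have "\<dots> = (\<Sum>b\<in>Basis. (w \<bullet> b) *\<^sub>R A s b)"
        using elim(1) by (simp add: linear_sum linear_cmul)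
      also have "norm \<dots> \<le> (\<Sum>b\<in>Basis. norm w * norm (A s b))"
        by (rule sum_norm_le) (auto intro!: mult_right_mono Basis_le_norm)
      also have "\<dots> = norm w * (\<Sum>b\<in>Basis. norm (A s b))" by (simp add: sum_distrib_left)
      also have "\<dots> \<le> e * norm w" using mult_left_mono[OF less_imp_le[OF elim(2)], of "norm w"] by (simp add: mult.commute)
      finally show "norm (A s w) \<le> e * norm w" .
    qed
  qed
qed

lemma has_vector_derivative_at_iff_tendsto:
  "(f has_vector_derivative D) (at x) \<longleftrightarrow> ((\<lambda>y. (f y - f x) /\<^sub>R (y - x)) \<longlongrightarrow> D) (at x)"
proof -
  have "((\<lambda>y. (f y - f x) /\<^sub>R (y - x)) \<longlongrightarrow> D) (at x) \<longleftrightarrow>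
    ((\<lambda>y. norm ((f y - f x) /\<^sub>R (y - x) - D)) \<longlongrightarrow> 0) (at x)"
    by (simp only: tendsto_norm_zero_iff LIM_zero_iff)
  also have "\<dots> \<longleftrightarrow> ((\<lambda>y. norm (f y - f x - (y - x) *\<^sub>R D) / norm (y - x)) \<longlongrightarrow> 0) (at x)"
  proof (rule filterlim_cong)
    show "\<forall>\<^sub>F y in at x. norm ((f y - f x) /\<^sub>R (y - x) - D) = norm (f y - f x - (y - x) *\<^sub>R D) / norm (y - x)"
      unfolding eventually_at_filter
    proof (rule always_eventually, intro allI impI)
      fix y assume "y \<noteq> x"
      then have "(f y - f x) /\<^sub>R (y - x) - D = (f y - f x - (y - x) *\<^sub>R D) /\<^sub>R (y - x)"
        by (simp add: scaleR_diff_right)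
      then show "norm ((f y - f x) /\<^sub>R (y - x) - D) = norm (f y - f x - (y - x) *\<^sub>R D) / norm (y - x)"
        by (simp add: divide_inverse_commute)
    qed
  qed auto
  also have "\<dots> \<longleftrightarrow> (f has_vector_derivative D) (at x)"
    by (simp add: has_vector_derivative_def has_derivative_iff_norm bounded_linear_scaleR_left)
  finally show ?thesis by blast
qed

locale submanifold_chart =
  fixes M U V S :: "'a::euclidean_space set" and \<phi> \<psi> :: "'a \<Rightarrow> 'a"
  assumes open_U: "open U" and open_V: "open V" and homeo: "homeomorphism U V \<phi> \<psi>"
    and smooth_phi: "smooth_on \<phi> U" and smooth_psi: "smooth_on \<psi> V"
    and subspace_S: "subspace S" and image_M: "\<phi> ` (U \<inter> M) = V \<inter> S"
begin

abbreviation "J s \<equiv> frechet_derivative \<psi> (at s)"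
abbreviation "J' q \<equiv> frechet_derivative \<phi> (at q)"

lemmas has_derivative_psi = smooth_on_has_derivative[OF smooth_psi open_V]
lemmas has_derivative_phi = smooth_on_has_derivative[OF smooth_phi open_U]

lemma linear_J: "s \<in> V \<Longrightarrow> linear (J s)" and linear_J': "q \<in> U \<Longrightarrow> linear (J' q)"
  using has_derivative_psi has_derivative_phi has_derivative_linear by blast+

lemma phi_in_V: "q \<in> U \<Longrightarrow> \<phi> q \<in> V" and psi_in_U: "s \<in> V \<Longrightarrow> \<psi> s \<in> U"
  and psi_phi: "q \<in> U \<Longrightarrow> \<psi> (\<phi> q) = q" and phi_psi: "s \<in> V \<Longrightarrow> \<phi> (\<psi> s) = s"
  using homeomorphism_image1[OF homeo] homeomorphism_image2[OF homeo]
    homeomorphism_apply1[OF homeo] homeomorphism_apply2[OF homeo] by simp_all blast+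

lemma psi_in_M: "s \<in> V \<Longrightarrow> s \<in> S \<Longrightarrow> \<psi> s \<in> M"
proof -
  assume "s \<in> V" "s \<in> S"
  then have "s \<in> \<phi> ` (U \<inter> M)" using image_M by blast
  then show ?thesis using psi_phi by auto
qed

lemma phi_in_S: "q \<in> U \<Longrightarrow> q \<in> M \<Longrightarrow> \<phi> q \<in> S"
  using image_M by auto

lemma J_J': 
  assumes "q \<in> U" shows "J (\<phi> q) (J' q w) = w"
proof -
  have "((\<lambda>x. \<psi> (\<phi> x)) has_derivative (\<lambda>w. J (\<phi> q) (J' q w))) (at q)"
    by (rule has_derivative_compose[OF has_derivative_phi[OF assms] has_derivative_psi[OF phi_in_V[OF assms]]])
  then have "((\<lambda>x. x) has_derivative (\<lambda>w. J (\<phi> q) (J' q w))) (at q)"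
    using has_derivative_transform_within_open[OF _ open_U assms] psi_phi by fastforce
  then have "(\<lambda>w. J (\<phi> q) (J' q w)) = (\<lambda>w. w)"
    using has_derivative_ident has_derivative_unique by blast
  then show ?thesis by metis
qed

lemma J'_J:
  assumes "s \<in> V" shows "J' (\<psi> s) (J s w) = w"
proof -
  have "((\<lambda>x. \<phi> (\<psi> x)) has_derivative (\<lambda>w. J' (\<psi> s) (J s w))) (at s)"
    by (rule has_derivative_compose[OF has_derivative_psi[OF assms] has_derivative_phi[OF psi_in_U[OF assms]]])
  then have "((\<lambda>x. x) has_derivative (\<lambda>w. J' (\<psi> s) (J s w))) (at s)"
    using has_derivative_transform_within_open[OF _ open_V assms] phi_psi by fastforce
  then have "(\<lambda>w. J' (\<psi> s) (J s w)) = (\<lambda>w. w)"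
    using has_derivative_ident has_derivative_unique by blast
  then show ?thesis by metis
qed

lemma J_in_tangent_space:
  assumes "s \<in> V" "s \<in> S" "\<sigma> \<in> S"
  shows "J s \<sigma> \<in> tangent_space M (\<psi> s)"
proof -
  let ?\<gamma> = "\<lambda>t::real. \<psi> (s + t *\<^sub>R \<sigma>)"
  obtain e where e: "e > 0" "ball s e \<subseteq> V" using open_V assms(1) openE by blast
  \<comment> \<open>The summand 1 keeps the denominator positive when \<open>\<sigma>\<close> is
    0.\<close>
  define d where "d = e / (norm \<sigma> + 1)"
  have d: "d > 0" unfolding d_def using e(1) by (intro divide_pos_pos) (auto intro: add_nonneg_pos)
  have V: "s + t *\<^sub>R \<sigma> \<in> V" if "t \<in> {-d<..<d}" for t
  proof -
    have "\<bar>t\<bar> * norm \<sigma> \<le> \<bar>t\<bar> * (norm \<sigma> + 1)" by (intro mult_left_mono) auto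
    also have "\<dots> < d * (norm \<sigma> + 1)" using that by (intro mult_strict_right_mono) (auto simp: add_nonneg_pos)
    also have "\<dots> = e" unfolding d_def by (simp add: add_nonneg_eq_0_iff)
    finally have "s + t *\<^sub>R \<sigma> \<in> ball s e" by (simp add: dist_norm)
    then show ?thesis using e(2) by blast
  qed
  have "smooth_on ?\<gamma> {-d<..<d}"
    using Ck_on_line[OF smooth_psi open_V, of "{-d<..<d}" s \<sigma> _ 1] V by (simp add: smooth_on_def)
  moreover have "?\<gamma> ` {-d<..<d} \<subseteq> M"
    using V psi_in_M assms(2,3) subspace_S by (auto simp: subspace_add subspace_mul)
  moreover have "(?\<gamma> has_vector_derivative J s \<sigma>) (at 0)"
  proof -
    have "(\<psi> has_derivative J s) (at (s + 0 *\<^sub>R \<sigma>))" using has_derivative_psi[OF assms(1)] by simp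
    then have "(?\<gamma> has_derivative (\<lambda>v. J s (v *\<^sub>R \<sigma>))) (at 0)"
      by (rule has_derivative_compose[rotated]) (auto intro!: derivative_eq_intros)
    then show ?thesis
      by (simp add: has_vector_derivative_def linear_cmul[OF linear_J[OF assms(1)]])
  qed
  ultimately show ?thesis unfolding tangent_space_def using d by (auto intro!: exI[of _ ?\<gamma>])
qed

text \<open>The difference quotients of \<open>\<phi> \<circ> c\<close> lie in the closed subspace
  \<open>S\<close>. Differentiability at the single point \<open>x\<close> suffices, so the argument
  serves both the smooth curves in \<open>tangent_space\<close> and the curve \<open>f\<close>,
  which is only of class \<open>C^r\<close>.\<close>

lemma velocity_in_image:
  assumes c: "(c has_vector_derivative v) (at x)" and "\<forall>\<^sub>F t in at x. c t \<in> M" "c x \<in> M" "c x \<in> U"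
  shows "J' (c x) v \<in> S"
proof -
  have "((\<lambda>t. \<phi> (c t)) has_derivative (\<lambda>\<xi>. J' (c x) (\<xi> *\<^sub>R v))) (at x)"
    using has_derivative_compose[OF c[unfolded has_vector_derivative_def] has_derivative_phi[OF assms(4)]] .
  then have "((\<lambda>t. \<phi> (c t)) has_vector_derivative J' (c x) v) (at x)"
    by (simp add: has_vector_derivative_def linear_cmul[OF linear_J'[OF assms(4)]])
  then have lim: "((\<lambda>t. (\<phi> (c t) - \<phi> (c x)) /\<^sub>R (t - x)) \<longlongrightarrow> J' (c x) v) (at x)"
    by (simp add: has_vector_derivative_at_iff_tendsto)
  have "(c \<longlongrightarrow> c x) (at x)"
    using c has_vector_derivative_continuous isCont_def by blast
  then have "\<forall>\<^sub>F t in at x. c t \<in> U" using open_U assms(4) topological_tendstoD by blast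
  with assms(2) have "\<forall>\<^sub>F t in at x. (\<phi> (c t) - \<phi> (c x)) /\<^sub>R (t - x) \<in> S"
    by eventually_elim (use phi_in_S assms(3,4) subspace_S in \<open>auto intro!: subspace_mul subspace_diff\<close>)
  then show ?thesis
    using Lim_in_closed_set[OF closed_subspace[OF subspace_S] _ _ lim] by simp
qed

lemma tangent_space_eq:
  assumes "m \<in> M" "m \<in> U"
  shows "tangent_space M m = J (\<phi> m) ` S"
proof (intro equalityI subsetI)
  fix v assume "v \<in> tangent_space M m"
  then obtain \<gamma> e where \<gamma>: "0 < e" "\<gamma> ` {-e<..<e} \<subseteq> M" "\<gamma> (0::real) = m" "(\<gamma> has_vector_derivative v) (at 0)"
    unfolding tangent_space_def by blast
  have "\<forall>\<^sub>F t in at 0. t \<in> {-e<..<e}"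
    using \<gamma>(1) eventually_at_in_open'[of "{-e<..<e}" 0] by simp
  then have "\<forall>\<^sub>F t in at 0. \<gamma> t \<in> M" by eventually_elim (use \<gamma>(2) in auto)
  then have "J' m v \<in> S" using velocity_in_image[OF \<gamma>(4)] \<gamma>(3) assms by auto
  then show "v \<in> J (\<phi> m) ` S" using J_J'[OF assms(2), of v] by (metis image_eqI)
next
  fix v assume "v \<in> J (\<phi> m) ` S"
  then show "v \<in> tangent_space M m"
    using J_in_tangent_space[of "\<phi> m"] phi_in_V phi_in_S psi_phi assms by auto
qed

end

lemma smooth_submanifold_chart:
  assumes "smooth_submanifold k M" "p \<in> M"
  obtains U V S \<phi> \<psi> where "submanifold_chart M U V S \<phi> \<psi>" "p \<in> U"
  using assms unfolding smooth_submanifold_def submanifold_chart_def by metis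

lemma subspace_tangent_space:
  assumes "smooth_submanifold k M" "m \<in> M"
  shows "subspace (tangent_space M m)"
proof -
  obtain U V S \<phi> \<psi> where c: "submanifold_chart M U V S \<phi> \<psi>" "m \<in> U"
    using smooth_submanifold_chart[OF assms] .
  interpret submanifold_chart M U V S \<phi> \<psi> by fact
  show ?thesis
    using tangent_space_eq[OF assms(2) c(2)] linear_J phi_in_V c(2) subspace_S
    by (simp add: linear_subspace_image)
qed

lemma velocity_in_tangent_space:
  assumes "smooth_submanifold k M" "(c has_vector_derivative v) (at x)" "\<And>t. c t \<in> M"
  shows "v \<in> tangent_space M (c x)"
proof -
  obtain U V S \<phi> \<psi> where c: "submanifold_chart M U V S \<phi> \<psi>" "c x \<in> U"
    using smooth_submanifold_chart[OF assms(1) assms(3)] .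
  interpret submanifold_chart M U V S \<phi> \<psi> by fact
  have "J' (c x) v \<in> S" using velocity_in_image[OF assms(2)] assms(3) c(2) by simp
  then show ?thesis using tangent_space_eq[OF assms(3) c(2)] J_J'[OF c(2)] by (metis image_eqI)
qed

section \<open>Tangent balls and nearest points\<close>

text \<open>First order condition: along any curve in \<open>M\<close> through \<open>q\<close>, the
  squared distance to \<open>y\<close> has a local minimum at \<open>q\<close>, so its derivative
  \<open>-2 * (w \<bullet> (y - q))\<close> vanishes.\<close>

lemma nearest_point_normal:
  assumes "\<And>q'. q' \<in> M \<Longrightarrow> dist y q \<le> dist y q'"
  shows "y - q \<in> normal_space M q"
proof -
  have "w \<bullet> (y - q) = 0" if w: "w \<in> tangent_space M q" for w
  proof -
    obtain \<gamma> e where \<gamma>: "0 < e" "\<gamma> ` {-e<..<e} \<subseteq> M" "\<gamma> (0::real) = q" "(\<gamma> has_vector_derivative w) (at 0)"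
      using w unfolding tangent_space_def by blast
    let ?d = "\<lambda>t. (y - \<gamma> t) \<bullet> (y - \<gamma> t)"
    have "((\<lambda>t. y - \<gamma> t) has_derivative (\<lambda>t. - (t *\<^sub>R w))) (at 0)"
      using \<gamma>(4) unfolding has_vector_derivative_def by (auto intro!: derivative_eq_intros)
    from has_derivative_inner[OF this this]
    have "(?d has_derivative (*) (-2 * (w \<bullet> (y - q)))) (at 0)"
      by (rule has_derivative_eq_rhs) (simp add: \<gamma>(3) inner_commute algebra_simps fun_eq_iff)
    then have "DERIV ?d 0 :> -2 * (w \<bullet> (y - q))"
      unfolding has_field_derivative_def .
    moreover have "?d 0 \<le> ?d t" if "\<bar>0 - t\<bar> < e" for t
    proof -
      have "\<gamma> t \<in> M" using \<gamma>(2) that by (auto simp: abs_if split: if_splits)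
      then have "norm (y - q) \<le> norm (y - \<gamma> t)" using assms by (auto simp: dist_norm)
      then show ?thesis using \<gamma>(3) by (simp add: power_mono flip: power2_norm_eq_inner)
    qed
    ultimately have "-2 * (w \<bullet> (y - q)) = 0" using DERIV_local_min[OF _ \<gamma>(1)] by blast
    then show ?thesis by simp
  qed
  then show ?thesis by (simp add: normal_space_def orthogonal_comp_def orthogonal_def)
qed

lemma inner_normal_tangent:
  "u \<in> normal_space M m \<Longrightarrow> w \<in> tangent_space M m \<Longrightarrow> u \<bullet> w = 0"
  by (auto simp: normal_space_def orthogonal_comp_def orthogonal_def inner_commute)

lemma subspace_normal_space: "subspace (normal_space M m)"
  by (simp add: normal_space_def subspace_orthogonal_comp)

text \<open>For a unit normal \<open>u\<close> this is
  \<open>norm (q - (m + t *\<^sub>R u)) \<ge> t\<close>, squared and expanded: no point of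
  \<open>M\<close> lies inside the ball of radius \<open>t\<close> that touches \<open>M\<close> at
  \<open>m\<close> from the side of \<open>u\<close>. The expanded form is homogeneous in
  \<open>u\<close>. It is Federer's inequality for sets of positive reach.\<close>

definition outside_tangent_balls :: "'a::euclidean_space set \<Rightarrow> real \<Rightarrow> bool" where
  "outside_tangent_balls M t \<longleftrightarrow>
     (\<forall>m\<in>M. \<forall>u\<in>normal_space M m. \<forall>q\<in>M. 2 * t * (u \<bullet> (q - m)) \<le> norm u * (norm (q - m))\<^sup>2)"

lemma outside_tangent_ballsD:
  assumes "outside_tangent_balls M t" "m \<in> M" "u \<in> normal_space M m" "q \<in> M"
  shows "2 * t * (u \<bullet> (q - m)) \<le> norm u * (norm (q - m))\<^sup>2"
  using assms unfolding outside_tangent_balls_def by blast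

text \<open>Let \<open>p\<close> be a point of \<open>M\<close> nearest to the centre
  \<open>m + v\<close>. The pairs \<open>(p, m + v - p)\<close> and \<open>(m, v)\<close> are both
  normal, of length at most \<open>t\<close> and hence below the reach, and have the same sum.
  Injectivity forces \<open>p = m\<close>, so no point of \<open>M\<close> is closer to the centre
  than \<open>m\<close>.\<close>

lemma outside_tangent_balls_reach:
  fixes M :: "'a::euclidean_space set"
  assumes "compact M" "0 < t" "ereal t < reach M"
  shows "outside_tangent_balls M t"
  unfolding outside_tangent_balls_def
proof (intro ballI)
  fix m u q assume m: "m \<in> M" and u: "u \<in> normal_space M m" and q: "q \<in> M"
  show "2 * t * (u \<bullet> (q - m)) \<le> norm u * (norm (q - m))\<^sup>2"
  proof (cases "u = 0")
    case False
    define v where "v = (t / norm u) *\<^sub>R u"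
    have v: "v \<in> normal_space M m" "norm v = t"
      using u False assms(2) by (simp_all add: v_def subspace_normal_space subspace_mul)
    obtain p where p: "p \<in> M" "\<And>p'. p' \<in> M \<Longrightarrow> dist (m + v) p \<le> dist (m + v) p'"
      using distance_attains_inf[of M "m + v"] assms(1) m compact_imp_closed by blast
    have "m + v - p \<in> normal_space M p" by (rule nearest_point_normal[OF p(2)])
    moreover have "norm (m + v - p) \<le> t" using p(2)[OF m] v(2) by (simp add: dist_norm)
    ultimately have "(p, m + v - p) \<in> normal_tube M (reach M)" "(m, v) \<in> normal_tube M (reach M)"
      using p(1) m v assms(3) by (auto simp: normal_tube_def intro: le_less_trans[of _ "ereal t"])
    moreover have "inj_on (\<lambda>(m, v). m + v) (normal_tube M (reach M))"
      by (simp add: inj_on_normal_tube_iff_le_reach)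
    moreover have "(\<lambda>(m, v). m + v) (p, m + v - p) = (\<lambda>(m, v). m + v) (m, v)" by simp
    ultimately have "(p, m + v - p) = (m, v)" by (metis inj_onD)
    then have "p = m" by (rule Pair_inject)
    then have "norm v \<le> norm (m + v - q)" using p(2)[OF q] by (simp add: dist_norm)
    also have "m + v - q = v - (q - m)" by simp
    finally have "norm v \<le> norm (v - (q - m))" .
    then have "v \<bullet> v \<le> (v - (q - m)) \<bullet> (v - (q - m))"
      by (simp add: norm_le)
    then have "2 * (v \<bullet> (q - m)) \<le> (norm (q - m))\<^sup>2"
      by (simp add: inner_diff_left inner_diff_right inner_commute power2_norm_eq_inner)
    then have "norm u * (2 * (v \<bullet> (q - m))) \<le> norm u * (norm (q - m))\<^sup>2"
      by (intro mult_left_mono) auto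
    then show ?thesis using False by (simp add: v_def)
  qed simp
qed

text \<open>The ball inequality is used at \<open>a\<close> towards \<open>b\<close> and at
  \<open>b\<close> towards \<open>a\<close>. In the sum of the two,
  \<open>(norm (a - b))\<^sup>2\<close> splits off, and Cauchy-Schwarz yields Federer's Lipschitz
  constant \<open>t / (t - s)\<close> when \<open>s < t\<close>.\<close>

lemma nearest_points_lipschitz:
  assumes M: "outside_tangent_balls M t" "0 \<le> t" and "a \<in> M" "b \<in> M"
    and "x - a \<in> normal_space M a" "y - b \<in> normal_space M b"
    and "norm (x - a) \<le> s" "norm (y - b) \<le> s"
  shows "(t - s) * norm (a - b) \<le> t * norm (x - y)"
proof (cases "a = b")
  case True
  then show ?thesis using M(2) by simp
next
  case False
  let ?D = "norm (a - b)"
  have "2 * t * ((x - a) \<bullet> (b - a)) \<le> s * ?D\<^sup>2"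
    using outside_tangent_ballsD[OF M(1) assms(3,5,4)] mult_right_mono[OF assms(7), of "?D\<^sup>2"]
    by (simp add: norm_minus_commute)
  moreover have "2 * t * ((y - b) \<bullet> (a - b)) \<le> s * ?D\<^sup>2"
    using outside_tangent_ballsD[OF M(1) assms(4,6,3)] mult_right_mono[OF assms(8), of "?D\<^sup>2"]
    by (simp add: norm_minus_commute)
  ultimately have "t * ((x - a) \<bullet> (b - a) + (y - b) \<bullet> (a - b)) \<le> s * ?D\<^sup>2"
    by (simp add: algebra_simps)
  moreover have "(x - a) \<bullet> (b - a) + (y - b) \<bullet> (a - b) = ?D\<^sup>2 - (x - y) \<bullet> (a - b)"
    by (simp add: power2_norm_eq_inner algebra_simps inner_commute)
  ultimately have "t * (?D\<^sup>2 - (x - y) \<bullet> (a - b)) \<le> s * ?D\<^sup>2" by simp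
  then have "(t - s) * ?D\<^sup>2 \<le> t * ((x - y) \<bullet> (a - b))"
    by (simp add: right_diff_distrib left_diff_distrib)
  also have "\<dots> \<le> t * (norm (x - y) * ?D)"
    by (intro mult_left_mono norm_cauchy_schwarz M(2))
  finally have "((t - s) * ?D) * ?D \<le> (t * norm (x - y)) * ?D" by (simp add: power2_eq_square algebra_simps)
  moreover have "0 < ?D" using False by simp
  ultimately show ?thesis by (rule mult_right_le_imp_le)
qed

lemma has_derivative_local_lipschitz:
  assumes "(f has_derivative f') (at x)"
  obtains C where "0 < C" "\<forall>\<^sub>F y in nhds x. norm (f y - f x) \<le> C * norm (y - x)"
proof -
  have f': "bounded_linear f'" using assms has_derivative_bounded_linear by blast
  then obtain K where K: "K > 0" "\<And>z. norm (f' z) \<le> norm z * K"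
    using bounded_linear.pos_bounded by blast
  obtain d where d: "d > 0" "\<And>y. norm (y - x) < d \<Longrightarrow> norm (f y - f x - f' (y - x)) \<le> 1 * norm (y - x)"
    using assms unfolding has_derivative_at_alt by (meson zero_less_one)
  have "norm (f y - f x) \<le> (K + 1) * norm (y - x)" if "norm (y - x) < d" for y
    using d(2)[OF that] K(2)[of "y - x"] norm_triangle_sub[of "f y - f x" "f' (y - x)"]
    by (simp add: algebra_simps)
  then have "\<forall>\<^sub>F y in nhds x. norm (f y - f x) \<le> (K + 1) * norm (y - x)"
    unfolding eventually_nhds_metric using d(1) by (auto simp: dist_norm)
  then show ?thesis using that[of "K + 1"] K(1) by simp
qed

lemma norm_increment_le:
  fixes g :: "real \<Rightarrow> 'a::real_inner"
  assumes "\<And>\<tau>. 0 \<le> \<tau> \<Longrightarrow> \<tau> \<le> 1 \<Longrightarrow> (g has_vector_derivative g' \<tau>) (at \<tau>)"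
    and "\<And>\<tau>. 0 \<le> \<tau> \<Longrightarrow> \<tau> \<le> 1 \<Longrightarrow> norm (g' \<tau>) \<le> B"
  shows "norm (g 1 - g 0) \<le> B"
proof -
  have "continuous_on {0..1} g"
    using assms(1) has_vector_derivative_continuous continuous_at_imp_continuous_on by (metis atLeastAtMost_iff)
  then obtain x where "x \<in> {0<..<1}" "norm (g 1 - g 0) \<le> norm ((1 - 0) *\<^sub>R g' x)"
    using mvt_general[of 0 1 g "\<lambda>\<tau> h. h *\<^sub>R g' \<tau>"] assms(1)
    unfolding has_vector_derivative_def by (metis less_imp_le zero_less_one)
  then show ?thesis using assms(2)[of x] by simp
qed

section \<open>Variation of the tangent spaces\<close>

context submanifold_chart
begin

text \<open>Second derivative of \<open>\<psi>\<close> at \<open>s\<close>: \<open>z\<close> is the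
  direction in which the base point moves, \<open>w\<close> the argument of the Jacobian. For
  \<open>z\<close> and \<open>w\<close> in \<open>S\<close>, its inner products with normal vectors
  give the second fundamental form of \<open>M\<close> in the chart.\<close>

abbreviation "H s z w \<equiv> frechet_derivative (\<lambda>x. J x w) (at s) z"

lemmas has_derivative_J = smooth_on_has_derivative[OF smooth_on_directional_derivative[OF smooth_psi] open_V]
lemmas has_derivative_J' = smooth_on_has_derivative[OF smooth_on_directional_derivative[OF smooth_phi] open_U]

lemma linear_H1: "s \<in> V \<Longrightarrow> linear (\<lambda>z. H s z w)"
  using has_derivative_J has_derivative_linear by blast

text \<open>Linearity in \<open>z\<close> comes with being a derivative. Linearity in
  \<open>w\<close> comes from uniqueness of derivatives, because \<open>J x\<close> is linear for
  every \<open>x \<in> V\<close>.\<close>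

lemma linear_H2:
  assumes "s \<in> V" shows "linear (\<lambda>w. H s z w)"
proof (rule linearI)
  fix w w'
  have "((\<lambda>x. J x w + J x w') has_derivative (\<lambda>z. H s z w + H s z w')) (at s)"
    by (intro has_derivative_add has_derivative_J assms)
  then have "((\<lambda>x. J x (w + w')) has_derivative (\<lambda>z. H s z w + H s z w')) (at s)"
    by (rule has_derivative_transform_within_open[OF _ open_V assms]) (simp add: linear_J linear_add)
  then show "H s z (w + w') = H s z w + H s z w'"
    by (rule has_derivative_unique[OF has_derivative_J[OF assms], THEN fun_cong])
next
  fix c w
  have "((\<lambda>x. c *\<^sub>R J x w) has_derivative (\<lambda>z. c *\<^sub>R H s z w)) (at s)"
    by (intro has_derivative_scaleR_right has_derivative_J assms)
  then have "((\<lambda>x. J x (c *\<^sub>R w)) has_derivative (\<lambda>z. c *\<^sub>R H s z w)) (at s)"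
    by (rule has_derivative_transform_within_open[OF _ open_V assms]) (simp add: linear_J linear_cmul)
  then show "H s z (c *\<^sub>R w) = c *\<^sub>R H s z w"
    by (rule has_derivative_unique[OF has_derivative_J[OF assms], THEN fun_cong])
qed

lemma eventually_in_V: "s \<in> V \<Longrightarrow> \<forall>\<^sub>F x in nhds s. x \<in> V"
  using open_V by (rule eventually_nhds_in_open)

lemma J_continuous:
  assumes s: "s \<in> V" and "0 < e"
  shows "\<forall>\<^sub>F x in nhds s. \<forall>w. norm (J x w - J s w) \<le> e * norm w"
proof (rule linear_tendsto_uniform[OF _ _ \<open>0 < e\<close>])
  show "\<forall>\<^sub>F x in nhds s. linear (\<lambda>w. J x w - J s w)"
    using eventually_in_V[OF s] by eventually_elim (intro linear_compose_sub linear_J s)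
  show "((\<lambda>x. J x b - J s b) \<longlongrightarrow> 0) (nhds s)" for b
    using has_derivative_continuous[OF has_derivative_J[OF s, of b]]
    by (simp add: LIM_zero_iff continuous_within tendsto_nhds_iff)
qed

text \<open>Differentiability of \<open>\<lambda>x. J x w\<close> for each fixed \<open>w\<close>,
  made uniform in \<open>w\<close>. The quotient \<open>?A\<close> only makes sense for
  \<open>x \<noteq> s\<close>; at \<open>x = s\<close> both sides are 0.\<close>

lemma J_second_order:
  assumes s: "s \<in> V" and "0 < e"
  shows "\<forall>\<^sub>F x in nhds s. \<forall>w. norm (J x w - J s w - H s (x - s) w) \<le> e * norm (x - s) * norm w"
proof -
  let ?A = "\<lambda>x w. (1 / norm (x - s)) *\<^sub>R (J x w - (J s w + H s (x - s) w))"
  have ev: "\<forall>\<^sub>F x in at s. x \<in> V"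
    using eventually_in_V[OF s] by (simp add: eventually_at_filter eventually_mono)
  have "\<forall>\<^sub>F x in at s. \<forall>w. norm (?A x w) \<le> e * norm w"
  proof (rule linear_tendsto_uniform[OF _ _ \<open>0 < e\<close>])
    show "\<forall>\<^sub>F x in at s. linear (?A x)"
      using ev by eventually_elim
        (intro linear_compose_scale_right linear_compose_sub linear_compose_add linear_J linear_H2 s)
    show "((\<lambda>x. ?A x b) \<longlongrightarrow> 0) (at s)" for b
      using has_derivative_J[OF s, of b] unfolding has_derivative_within by blast
  qed
  then have "\<forall>\<^sub>F x in nhds s. x \<noteq> s \<longrightarrow> (\<forall>w. norm (?A x w) \<le> e * norm w)"
    by (simp add: eventually_at_filter)
  then show ?thesis
  proof eventually_elim
    case (elim x)
    show ?case
    proof (cases "x = s")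
      case True
      then show ?thesis by (simp add: linear_0[OF linear_H1[OF s]])
    next
      case False
      then have "norm (J x w - (J s w + H s (x - s) w)) / norm (x - s) \<le> e * norm w" for w
        using elim by (simp add: divide_inverse_commute)
      then show ?thesis using False by (simp add: pos_divide_le_eq algebra_simps)
    qed
  qed
qed

text \<open>The constant is valid on a whole neighbourhood of \<open>m\<close>, so it can be fixed
  before the accuracy \<open>e\<close> is chosen in the comparison of tangent spaces.\<close>

lemma chart_bounds:
  assumes m: "m \<in> U"
  obtains C where "1 \<le> C" "\<forall>\<^sub>F q in nhds m. q \<in> U \<and> norm (\<phi> q - \<phi> m) \<le> C * dist q m \<and>
    (\<forall>w. norm (J' q w) \<le> C * norm w)"
proof -
  obtain C1 where C1: "0 < C1" "\<forall>\<^sub>F q in nhds m. norm (\<phi> q - \<phi> m) \<le> C1 * norm (q - m)"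
    using has_derivative_local_lipschitz[OF has_derivative_phi[OF m]] .
  obtain K where K: "K > 0" "\<And>w. norm (J' m w) \<le> norm w * K"
    using bounded_linear.pos_bounded[of "J' m"] has_derivative_phi[OF m] has_derivative_bounded_linear by blast
  have U: "\<forall>\<^sub>F q in nhds m. q \<in> U" using eventually_nhds_in_open[OF open_U m] .
  have *: "\<forall>\<^sub>F q in nhds m. \<forall>w. norm (J' q w - J' m w) \<le> 1 * norm w"
  proof (rule linear_tendsto_uniform)
    show "\<forall>\<^sub>F x in nhds m. linear (\<lambda>w. J' x w - J' m w)"
      using U by eventually_elim (intro linear_compose_sub linear_J' m)
    show "((\<lambda>x. J' x b - J' m b) \<longlongrightarrow> 0) (nhds m)" for b
      using has_derivative_continuous[OF has_derivative_J'[OF m, of b]]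
      by (simp add: LIM_zero_iff continuous_within tendsto_nhds_iff)
  qed simp
  let ?C = "C1 + K + 1"
  have "\<forall>\<^sub>F q in nhds m. q \<in> U \<and> norm (\<phi> q - \<phi> m) \<le> ?C * dist q m \<and> (\<forall>w. norm (J' q w) \<le> ?C * norm w)"
    using U C1(2) *
  proof eventually_elim
    case (elim q)
    have "norm (\<phi> q - \<phi> m) \<le> ?C * dist q m"
      using elim(2) K(1) mult_right_mono[of C1 ?C "dist q m"] by (simp add: dist_norm)
    moreover have "norm (J' q w) \<le> ?C * norm w" for w
    proof -
      have "norm (J' q w) \<le> norm (J' q w - J' m w) + norm (J' m w)" by norm
      also have "\<dots> \<le> (K + 1) * norm w" using elim(3)[rule_format, of w] K(2)[of w] by (simp add: algebra_simps)
      also have "\<dots> \<le> ?C * norm w" using C1(1) by (intro mult_right_mono) auto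
      finally show ?thesis .
    qed
    ultimately show ?case using elim(1) by blast
  qed
  then show ?thesis using that[of ?C] C1(1) K(1) by simp
qed

text \<open>Compare \<open>\<psi>\<close> at the points \<open>s \<plusminus> \<zeta>\<close>: the parallelogram law for the two chords turns the
  quadratic estimate \<^const>\<open>outside_tangent_balls\<close> into a bilinear one, with a loss from \<open>t2\<close> to \<open>t1\<close>. The
  second order terms at \<open>s \<plusminus> \<zeta>\<close> cancel because \<open>J\<close> is differentiable at \<open>\<phi> m\<close>.\<close>

lemma tangent_variation_step:
  assumes t: "0 < t1" "t1 < t2" "outside_tangent_balls M t2" and m: "m \<in> M" "m \<in> U"
  obtains \<eta> where "0 < \<eta>" "\<And>a b. a \<in> M \<Longrightarrow> b \<in> M \<Longrightarrow> dist a m < \<eta> \<Longrightarrow> dist b m < \<eta> \<Longrightarrow> dist b m \<le> dist a b \<Longrightarrow>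
      \<forall>u\<in>normal_space M a. \<forall>w\<in>tangent_space M b. t1 * \<bar>u \<bullet> w\<bar> \<le> dist a b * norm u * norm w"
proof -
  let ?o = "\<phi> m"
  have s0: "?o \<in> V" using m(2) by (rule phi_in_V)
  obtain C where C: "1 \<le> C" "\<forall>\<^sub>F q in nhds m. q \<in> U \<and> norm (\<phi> q - \<phi> m) \<le> C * dist q m \<and>
    (\<forall>w. norm (J' q w) \<le> C * norm w)"
    using chart_bounds[OF m(2)] .
  \<comment> \<open>Collects the main term \<open>t1 / t2\<close> and all errors of the estimate
    below, as the factor of \<open>(dist a b)\<^sup>2 * norm u\<close>. At \<open>e = 0\<close> only
    \<open>t1 / t2 < 1\<close> remains, so the gap between the radii pays for the errors once
    \<open>e\<close> is small.\<close>
  define X where "X e = t1 * ((1 + 4 * (e * C) + 2 * (e * C)\<^sup>2) / t2 + 4 * e * C\<^sup>2)" for e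
  have "(X \<longlongrightarrow> X 0) (at_right 0)"
    unfolding X_def using t by (intro tendsto_intros) auto
  moreover have "X 0 < 1" using t by (simp add: X_def)
  ultimately have "\<forall>\<^sub>F e in at_right 0. X e < 1" by (rule order_tendstoD(2))
  moreover have "\<forall>\<^sub>F e in at_right (0::real). 0 < e" by (simp add: eventually_at_right_less)
  ultimately have "\<forall>\<^sub>F e in at_right 0. X e < 1 \<and> 0 < e" by (rule eventually_conj)
  then obtain e where e: "X e < 1" "0 < e"
    using eventually_happens[of _ "at_right (0::real)"] by auto
  have "\<forall>\<^sub>F x in nhds ?o. x \<in> V \<and> (\<forall>w. norm (J x w - J ?o w) \<le> e * norm w) \<and>
      (\<forall>w. norm (J x w - J ?o w - H ?o (x - ?o) w) \<le> e * norm (x - ?o) * norm w)"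
    by (intro eventually_conj eventually_in_V J_continuous J_second_order s0 e(2))
  then obtain d where d: "0 < d" and "\<And>x. dist x ?o < d \<Longrightarrow> x \<in> V \<and>
      (\<forall>w. norm (J x w - J ?o w) \<le> e * norm w) \<and>
      (\<forall>w. norm (J x w - J ?o w - H ?o (x - ?o) w) \<le> e * norm (x - ?o) * norm w)"
    unfolding eventually_nhds_metric by blast
  then have dV: "\<And>x. norm (x - ?o) < d \<Longrightarrow> x \<in> V"
    and dJ: "\<And>x w. norm (x - ?o) < d \<Longrightarrow> norm (J x w - J ?o w) \<le> e * norm w"
    and dH: "\<And>x w. norm (x - ?o) < d \<Longrightarrow>
        norm (J x w - J ?o w - H ?o (x - ?o) w) \<le> e * norm (x - ?o) * norm w"
    by (auto simp: dist_norm)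
  obtain \<eta>0 where \<eta>0: "0 < \<eta>0" "\<And>q. dist q m < \<eta>0 \<Longrightarrow> q \<in> U"
      "\<And>q. dist q m < \<eta>0 \<Longrightarrow> norm (\<phi> q - \<phi> m) \<le> C * dist q m"
      "\<And>q w. dist q m < \<eta>0 \<Longrightarrow> norm (J' q w) \<le> C * norm w"
    using C(2) unfolding eventually_nhds_metric by blast
  \<comment> \<open>Two points within \<open>\<eta>\<close> of \<open>m\<close> are less than
    \<open>2 * \<eta>\<close> apart, and the chart points used below have distance at most
    \<open>2 * (C * dist a b)\<close> from \<open>\<phi> m\<close>. The bound
    \<open>d / (4 * C)\<close> keeps them within distance \<open>d\<close>.\<close>
  define \<eta> where "\<eta> = min \<eta>0 (d / (4 * C))"
  have \<eta>: "0 < \<eta>" using \<eta>0(1) d C(1) by (simp add: \<eta>_def)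
  \<comment> \<open>With \<open>w\<close> scaled to the length of the chord, every error is a small
    multiple of the squared chord. The condition \<open>dist b m \<le> dist a b\<close> allows the
    distance of \<open>\<phi> b\<close> from the centre \<open>\<phi> m\<close> to be measured by
    the chord as well.\<close>
  have core: "t1 * (u \<bullet> w) \<le> (dist a b)\<^sup>2 * norm u"
    if a: "a \<in> M" "dist a m < \<eta>" and b: "b \<in> M" "dist b m < \<eta>" "dist b m \<le> dist a b"
      and u: "u \<in> normal_space M a" and w: "w \<in> tangent_space M b" "norm w = dist a b" for a b u w
  proof -
    let ?D = "dist a b" and ?s = "\<phi> b"
    define \<zeta> where "\<zeta> = J' b w"
    have bU: "b \<in> U" using \<eta>0(2) b(2) by (simp add: \<eta>_def)
    have s: "?s \<in> V" "?s \<in> S" using bU b(1) phi_in_V phi_in_S by auto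
    obtain \<sigma> where \<sigma>: "\<sigma> \<in> S" "w = J ?s \<sigma>" using w(1) tangent_space_eq[OF b(1) bU] by blast
    have "\<zeta> = \<sigma>" using J'_J[OF s(1), of \<sigma>] \<sigma>(2) psi_phi[OF bU] by (simp add: \<zeta>_def)
    then have \<zeta>: "\<zeta> \<in> S" "J ?s \<zeta> = w" using \<sigma> by auto
    have n\<zeta>: "norm \<zeta> \<le> C * ?D" using \<eta>0(4)[of b w] b(2) w(2) by (simp add: \<zeta>_def \<eta>_def)
    have ns: "norm (?s - ?o) \<le> C * ?D"
      using order_trans[OF \<eta>0(3)[of b] mult_left_mono[OF b(3), of C]] b(2) C(1) by (simp add: \<eta>_def)
    have near: "norm (?s + \<tau> *\<^sub>R \<zeta> - ?o) \<le> 2 * (C * ?D)" "norm (?s + \<tau> *\<^sub>R \<zeta> - ?o) < d" if "\<bar>\<tau>\<bar> \<le> 1" for \<tau>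
    proof -
      have "norm (?s + \<tau> *\<^sub>R \<zeta> - ?o) \<le> norm (?s - ?o) + \<bar>\<tau>\<bar> * norm \<zeta>"
        using norm_triangle_ineq[of "?s - ?o" "\<tau> *\<^sub>R \<zeta>"] by (simp add: algebra_simps)
      also have "\<bar>\<tau>\<bar> * norm \<zeta> \<le> 1 * norm \<zeta>" using that by (intro mult_right_mono) auto
      finally show 1: "norm (?s + \<tau> *\<^sub>R \<zeta> - ?o) \<le> 2 * (C * ?D)" using n\<zeta> ns by simp
      have "?D < 2 * \<eta>" using a(2) b(2) dist_triangle2[of a b m] by linarith
      also have "2 * \<eta> \<le> 2 * (d / (4 * C))" by (simp add: \<eta>_def)
      finally have "2 * (C * ?D) < d" using C(1) by (simp add: field_simps)
      then show "norm (?s + \<tau> *\<^sub>R \<zeta> - ?o) < d" using 1 by simp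
    qed
    have near0: "norm (?s - ?o) < d" using near(2)[of 0] by simp
    have deriv: "((\<lambda>\<tau>. \<psi> (?s + (c * \<tau>) *\<^sub>R \<zeta>)) has_vector_derivative c *\<^sub>R J (?s + (c * \<tau>) *\<^sub>R \<zeta>) \<zeta>) (at \<tau>)"
      if "\<bar>c * \<tau>\<bar> \<le> 1" for c \<tau>
    proof -
      let ?J = "J (?s + (c * \<tau>) *\<^sub>R \<zeta>)"
      have V: "?s + (c * \<tau>) *\<^sub>R \<zeta> \<in> V" using dV near(2)[OF that] by blast
      have "((\<lambda>\<tau>. \<psi> (?s + (c * \<tau>) *\<^sub>R \<zeta>)) has_derivative (\<lambda>h. ?J ((c * h) *\<^sub>R \<zeta>))) (at \<tau>)"
        by (rule has_derivative_compose[where f="\<lambda>\<tau>. ?s + (c * \<tau>) *\<^sub>R \<zeta>"])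
          (auto intro!: derivative_eq_intros has_derivative_psi V)
      then show ?thesis unfolding has_vector_derivative_def
        by (rule has_derivative_eq_rhs) (simp add: fun_eq_iff linear_cmul[OF linear_J[OF V]])
    qed
    have J_diff: "norm (J (?s + \<tau> *\<^sub>R \<zeta>) \<zeta> - w) \<le> 2 * e * norm \<zeta>" if "\<bar>\<tau>\<bar> \<le> 1" for \<tau>
    proof -
      have "norm (J (?s + \<tau> *\<^sub>R \<zeta>) \<zeta> - w) \<le> norm (J (?s + \<tau> *\<^sub>R \<zeta>) \<zeta> - J ?o \<zeta>) + norm (J ?s \<zeta> - J ?o \<zeta>)"
        unfolding \<zeta>(2)[symmetric] by norm
      also have "\<dots> \<le> 2 * e * norm \<zeta>" using dJ[OF near(2)[OF that], of \<zeta>] dJ[OF near0, of \<zeta>] by simp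
      finally show ?thesis .
    qed
    \<comment> \<open>To be used for the values of \<open>J\<close> at two points symmetric about
      \<open>?s\<close> and at \<open>?s\<close> itself, expanded about the centre
      \<open>?o\<close>: the values at the centre and the linear terms cancel, and only the
      remainders are left.\<close>
    have second_difference: "1 *\<^sub>R x - (-1) *\<^sub>R y - 2 *\<^sub>R z = (x - x0 - h) + (y - x0 - h') - 2 *\<^sub>R (z - x0 - h'')"
      if "h + h' = 2 *\<^sub>R h''" for x y z x0 h h' h'' :: 'a
    proof -
      have "h = 2 *\<^sub>R h'' - h'" using that by (simp add: algebra_simps)
      then show ?thesis by (simp add: algebra_simps scaleR_2)
    qed
    have norm_second_difference: "norm (x + y - 2 *\<^sub>R z) \<le> norm x + norm y + 2 * norm z" for x y z :: 'a
      using norm_triangle_ineq4[of "x + y" "2 *\<^sub>R z"] norm_triangle_ineq[of x y] by simp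
    \<comment> \<open>First order error of \<open>\<psi>\<close> at
      \<open>?s \<plusminus> \<zeta>\<close>. Its order \<open>e * ?D\<close> is good enough for the
      squared chords, where it is multiplied by a length of order \<open>?D\<close>.\<close>
    define k where "k = 2 * e * (C * ?D)"
    have k: "0 \<le> k" using e(2) C(1) by (simp add: k_def)
    have e\<zeta>: "2 * e * norm \<zeta> \<le> k" unfolding k_def using n\<zeta> e(2) by (intro mult_left_mono) auto
    have r: "norm (\<psi> (?s + c *\<^sub>R \<zeta>) - b - c *\<^sub>R w) \<le> k" if c: "\<bar>c\<bar> = 1" for c
    proof -
      let ?g = "\<lambda>\<tau>. \<psi> (?s + (c * \<tau>) *\<^sub>R \<zeta>) - \<tau> *\<^sub>R (c *\<^sub>R w)"
      have "norm (?g 1 - ?g 0) \<le> k"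
      proof (rule norm_increment_le)
        fix \<tau> :: real assume \<tau>: "0 \<le> \<tau>" "\<tau> \<le> 1"
        then have c\<tau>: "\<bar>c * \<tau>\<bar> \<le> 1" using c by (simp add: abs_mult)
        show "(?g has_vector_derivative c *\<^sub>R J (?s + (c * \<tau>) *\<^sub>R \<zeta>) \<zeta> - c *\<^sub>R w) (at \<tau>)"
          by (intro has_vector_derivative_diff deriv[OF c\<tau>]) (auto intro!: derivative_eq_intros)
        have "norm (c *\<^sub>R J (?s + (c * \<tau>) *\<^sub>R \<zeta>) \<zeta> - c *\<^sub>R w) = norm (J (?s + (c * \<tau>) *\<^sub>R \<zeta>) \<zeta> - w)"
          using c by (simp flip: scaleR_diff_right)
        then show "norm (c *\<^sub>R J (?s + (c * \<tau>) *\<^sub>R \<zeta>) \<zeta> - c *\<^sub>R w) \<le> k" using J_diff[OF c\<tau>] e\<zeta> by simp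
      qed
      then show ?thesis using psi_phi[OF bU] by (simp add: algebra_simps)
    qed
    \<comment> \<open>In an inner product with \<open>u\<close> alone, an error of order
      \<open>e * ?D\<close> would be too large. The difference of the two opposite points gains a
      further factor \<open>?D\<close>, because the second derivatives cancel.\<close>
    define R where "R = \<psi> (?s + \<zeta>) - \<psi> (?s - \<zeta>) - 2 *\<^sub>R w"
    have R: "norm R \<le> 8 * e * (C * ?D)\<^sup>2"
    proof -
      let ?g = "\<lambda>\<tau>. \<psi> (?s + (1 * \<tau>) *\<^sub>R \<zeta>) - \<psi> (?s + (-1 * \<tau>) *\<^sub>R \<zeta>) - \<tau> *\<^sub>R (2 *\<^sub>R w)"
      let ?g' = "\<lambda>\<tau>. 1 *\<^sub>R J (?s + (1 * \<tau>) *\<^sub>R \<zeta>) \<zeta> - (-1) *\<^sub>R J (?s + (-1 * \<tau>) *\<^sub>R \<zeta>) \<zeta> - 2 *\<^sub>R w"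
      have "norm (?g 1 - ?g 0) \<le> 8 * e * (C * ?D)\<^sup>2"
      proof (rule norm_increment_le)
        fix \<tau> :: real assume \<tau>: "0 \<le> \<tau>" "\<tau> \<le> 1"
        then have \<tau>1: "\<bar>1 * \<tau>\<bar> \<le> 1" "\<bar>-1 * \<tau>\<bar> \<le> 1" by auto
        show "(?g has_vector_derivative ?g' \<tau>) (at \<tau>)"
          by (intro has_vector_derivative_diff deriv[OF \<tau>1(1)] deriv[OF \<tau>1(2)]) (auto intro!: derivative_eq_intros)
        let ?E = "\<lambda>x. J x \<zeta> - J ?o \<zeta> - H ?o (x - ?o) \<zeta>"
        let ?x = "?s + (1 * \<tau>) *\<^sub>R \<zeta>" and ?y = "?s + (-1 * \<tau>) *\<^sub>R \<zeta>"
        have E: "norm (?E (?s + \<tau> *\<^sub>R \<zeta>)) \<le> 2 * e * (C * ?D)\<^sup>2" if "\<bar>\<tau>\<bar> \<le> 1" for \<tau>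
        proof -
          have "norm (?E (?s + \<tau> *\<^sub>R \<zeta>)) \<le> e * norm (?s + \<tau> *\<^sub>R \<zeta> - ?o) * norm \<zeta>"
            by (rule dH[OF near(2)[OF that]])
          also have "\<dots> \<le> e * (2 * (C * ?D)) * (C * ?D)"
            using near(1)[OF that] n\<zeta> e(2) C(1) by (intro mult_mono) auto
          finally show ?thesis by (simp add: power2_eq_square algebra_simps)
        qed
        interpret H: linear "\<lambda>z. H ?o z \<zeta>" by (rule linear_H1[OF s0])
        have sum: "(?x - ?o) + (?y - ?o) = 2 *\<^sub>R (?s - ?o)" by (simp add: algebra_simps scaleR_2)
        have "H ?o (?x - ?o) \<zeta> + H ?o (?y - ?o) \<zeta> = H ?o ((?x - ?o) + (?y - ?o)) \<zeta>" by (rule H.add[symmetric])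
        also have "\<dots> = 2 *\<^sub>R H ?o (?s - ?o) \<zeta>" unfolding sum by (rule H.scale)
        finally have Hsum: "H ?o (?x - ?o) \<zeta> + H ?o (?y - ?o) \<zeta> = 2 *\<^sub>R H ?o (?s - ?o) \<zeta>" .
        have Es: "norm (?E ?s) \<le> 2 * e * (C * ?D)\<^sup>2" using E[of 0] by simp
        have g': "?g' \<tau> = ?E ?x + ?E ?y - 2 *\<^sub>R ?E ?s"
          unfolding \<zeta>(2)[symmetric] by (rule second_difference[OF Hsum])
        have "norm (?g' \<tau>) \<le> norm (?E ?x) + norm (?E ?y) + 2 * norm (?E ?s)"
          unfolding g' by (rule norm_second_difference)
        also have "\<dots> \<le> 2 * e * (C * ?D)\<^sup>2 + 2 * e * (C * ?D)\<^sup>2 + 2 * (2 * e * (C * ?D)\<^sup>2)"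
          by (intro add_mono mult_left_mono E[OF \<tau>1(1)] E[OF \<tau>1(2)] Es) simp
        finally show "norm (?g' \<tau>) \<le> 8 * e * (C * ?D)\<^sup>2" by simp
      qed
      then show ?thesis by (simp add: R_def algebra_simps)
    qed
    let ?qp = "\<psi> (?s + \<zeta>)" and ?qm = "\<psi> (?s - \<zeta>)"
    let ?xp = "norm (b - a + w)" and ?xm = "norm (b - a - w)"
    have q: "?qp \<in> M" "?qm \<in> M"
      using psi_in_M[of "?s + \<zeta>"] psi_in_M[of "?s - \<zeta>"] dV[of "?s + \<zeta>"] dV[of "?s - \<zeta>"]
        near(2)[of 1] near(2)[of "-1"] s(2) \<zeta>(1) subspace_S
      by (auto simp: subspace_add subspace_diff)
    have D: "norm (b - a) = ?D" by (simp add: dist_norm norm_minus_commute)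
    have chord: "(norm (q - a))\<^sup>2 \<le> x\<^sup>2 + 4 * ?D * k + k\<^sup>2" if "norm (q - a) \<le> x + k" "0 \<le> x" "x \<le> 2 * ?D" for q x
    proof -
      have "(norm (q - a))\<^sup>2 \<le> (x + k)\<^sup>2" using that by (intro power_mono) auto
      also have "\<dots> = x\<^sup>2 + 2 * (x * k) + k\<^sup>2" by (simp add: power2_eq_square algebra_simps)
      also have "x * k \<le> (2 * ?D) * k" using that k by (intro mult_right_mono) auto
      finally show ?thesis by simp
    qed
    have "norm (?qp - a) \<le> ?xp + norm (?qp - b - 1 *\<^sub>R w)" by norm
    then have P: "(norm (?qp - a))\<^sup>2 \<le> ?xp\<^sup>2 + 4 * ?D * k + k\<^sup>2"
      using r[of 1] norm_triangle_ineq[of "b - a" w] D w(2) by (intro chord) auto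
    have "norm (?qm - a) \<le> ?xm + norm (?qm - b - (-1) *\<^sub>R w)" by norm
    then have Q: "(norm (?qm - a))\<^sup>2 \<le> ?xm\<^sup>2 + 4 * ?D * k + k\<^sup>2"
      using r[of "-1"] norm_triangle_ineq4[of "b - a" w] D w(2) by (intro chord) auto
    have "?xp\<^sup>2 + ?xm\<^sup>2 = 2 * (norm (b - a))\<^sup>2 + 2 * (norm w)\<^sup>2"
      by (simp add: power2_norm_eq_inner inner_add inner_diff algebra_simps inner_commute)
    then have PQ: "(norm (?qp - a))\<^sup>2 + (norm (?qm - a))\<^sup>2 \<le> 4 * ?D\<^sup>2 + 8 * ?D * k + 2 * k\<^sup>2"
      using P Q D w(2) by simp
    \<comment> \<open>Both tangent balls at \<open>a\<close> are used: the one on the side of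
      \<open>u\<close> for \<open>?qp\<close> and the one on the side of \<open>- u\<close> for
      \<open>?qm\<close>.\<close>
    have "2 * t2 * (u \<bullet> (?qp - a)) \<le> norm u * (norm (?qp - a))\<^sup>2"
      by (rule outside_tangent_ballsD[OF t(3) a(1) u q(1)])
    moreover have "2 * t2 * (- u \<bullet> (?qm - a)) \<le> norm (- u) * (norm (?qm - a))\<^sup>2"
      by (rule outside_tangent_ballsD[OF t(3) a(1) _ q(2)]) (simp add: u subspace_normal_space subspace_neg)
    ultimately have "2 * t2 * (u \<bullet> (?qp - ?qm)) \<le> norm u * ((norm (?qp - a))\<^sup>2 + (norm (?qm - a))\<^sup>2)"
      by (simp add: inner_diff_right algebra_simps)
    also have "\<dots> \<le> norm u * (4 * ?D\<^sup>2 + 8 * ?D * k + 2 * k\<^sup>2)" using PQ by (intro mult_left_mono) auto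
    finally have 1: "u \<bullet> (?qp - ?qm) \<le> norm u * (4 * ?D\<^sup>2 + 8 * ?D * k + 2 * k\<^sup>2) / (2 * t2)"
      using t(1,2) by (simp add: pos_le_divide_eq mult.commute)
    have 2: "- (u \<bullet> R) \<le> norm u * (8 * e * (C * ?D)\<^sup>2)"
      using norm_cauchy_schwarz[of "- u" R] mult_left_mono[OF R, of "norm u"] by simp
    have "2 * (u \<bullet> w) = u \<bullet> (?qp - ?qm) - u \<bullet> R" by (simp add: R_def inner_diff_right)
    with 1 2 have "2 * (u \<bullet> w) \<le> norm u * (4 * ?D\<^sup>2 + 8 * ?D * k + 2 * k\<^sup>2) / (2 * t2) + norm u * (8 * e * (C * ?D)\<^sup>2)"
      by linarith
    then have "t1 * (2 * (u \<bullet> w)) \<le> t1 * (norm u * (4 * ?D\<^sup>2 + 8 * ?D * k + 2 * k\<^sup>2) / (2 * t2) + norm u * (8 * e * (C * ?D)\<^sup>2))"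
      using t(1) by (intro mult_left_mono) auto
    also have "\<dots> = 2 * (X e * (?D\<^sup>2 * norm u))"
      unfolding X_def k_def using t(1,2) by (simp add: field_simps power2_eq_square)
    also have "\<dots> \<le> 2 * (1 * (?D\<^sup>2 * norm u))"
      using e(1) by (intro mult_left_mono mult_right_mono) auto
    finally show ?thesis by simp
  qed
  show ?thesis
  proof (rule that[OF \<eta>], intro ballI)
    fix a b assume ab: "a \<in> M" "b \<in> M" "dist a m < \<eta>" "dist b m < \<eta>" "dist b m \<le> dist a b"
    fix u w assume u: "u \<in> normal_space M a" and w: "w \<in> tangent_space M b"
    show "t1 * \<bar>u \<bullet> w\<bar> \<le> dist a b * norm u * norm w"
    proof (cases "a = b \<or> w = 0")
      case True
      then show ?thesis using inner_normal_tangent u w by force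
    next
      case False
      define w' where "w' = (dist a b / norm w) *\<^sub>R w"
      have "b \<in> U" using \<eta>0(2) ab(4) by (simp add: \<eta>_def)
      then have "subspace (tangent_space M b)"
        using tangent_space_eq[OF ab(2)] linear_J phi_in_V subspace_S by (simp add: linear_subspace_image)
      then have w': "w' \<in> tangent_space M b" "norm w' = dist a b"
        using w False by (auto simp: w'_def subspace_mul)
      have "- u \<in> normal_space M a" using u subspace_normal_space subspace_neg by blast
      then have "t1 * \<bar>u \<bullet> w'\<bar> \<le> (dist a b)\<^sup>2 * norm u"
        using core[OF ab(1,3,2,4,5) u w'] core[OF ab(1,3,2,4,5) _ w', of "- u"] by (auto simp: abs_if)
      moreover have "u \<bullet> w' = (dist a b / norm w) * (u \<bullet> w)" by (simp add: w'_def)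
      ultimately have "t1 * ((dist a b / norm w) * \<bar>u \<bullet> w\<bar>) \<le> (dist a b)\<^sup>2 * norm u"
        by (simp add: abs_mult)
      then show ?thesis using False by (simp add: field_simps power2_eq_square)
    qed
  qed
qed

end

text \<open>Infinitesimal form of the statement that the tangent space turns at \<open>m\<close>
  with speed at most \<open>1 / t\<close>. Both pairings are recorded, normal at \<open>m\<close>
  with tangent at \<open>a\<close> and the reverse, because comparing the two orthogonal projections
  takes both.\<close>

definition tangent_variation_at :: "'a::euclidean_space set \<Rightarrow> real \<Rightarrow> 'a \<Rightarrow> bool" where
  "tangent_variation_at M t m \<longleftrightarrow> (\<forall>\<^sub>F a in at m within M.
     (\<forall>u\<in>normal_space M m. \<forall>w\<in>tangent_space M a. t * \<bar>u \<bullet> w\<bar> \<le> dist a m * norm u * norm w) \<and>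
     (\<forall>u\<in>normal_space M a. \<forall>w\<in>tangent_space M m. t * \<bar>u \<bullet> w\<bar> \<le> dist a m * norm u * norm w))"

text \<open>In \<open>tangent_variation_step\<close> one of the two points is taken to be
  \<open>m\<close> itself; the side condition \<open>dist b m \<le> dist a b\<close> then holds in
  either role.\<close>

lemma tangent_variation:
  assumes "smooth_submanifold k M" "0 < t1" "t1 < t2" "outside_tangent_balls M t2" "m \<in> M"
  shows "tangent_variation_at M t1 m"
proof -
  obtain U V S \<phi> \<psi> where c: "submanifold_chart M U V S \<phi> \<psi>" "m \<in> U"
    using smooth_submanifold_chart[OF assms(1,5)] .
  interpret submanifold_chart M U V S \<phi> \<psi> by fact
  show ?thesis
  proof (rule tangent_variation_step[OF assms(2-5) c(2)])
    fix \<eta> :: real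
    assume \<eta>: "0 < \<eta>" "\<And>a b. a \<in> M \<Longrightarrow> b \<in> M \<Longrightarrow> dist a m < \<eta> \<Longrightarrow> dist b m < \<eta> \<Longrightarrow> dist b m \<le> dist a b \<Longrightarrow>
      \<forall>u\<in>normal_space M a. \<forall>w\<in>tangent_space M b. t1 * \<bar>u \<bullet> w\<bar> \<le> dist a b * norm u * norm w"
    show ?thesis
      unfolding tangent_variation_at_def eventually_at
    proof (intro exI conjI ballI impI)
      fix a u w assume a: "a \<in> M" "a \<noteq> m \<and> dist a m < \<eta>"
      show "t1 * \<bar>u \<bullet> w\<bar> \<le> dist a m * norm u * norm w" if "u \<in> normal_space M m" "w \<in> tangent_space M a"
        using \<eta>(2)[OF assms(5) a(1)] that a(2) \<eta>(1) by (simp add: dist_commute)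
      show "t1 * \<bar>u \<bullet> w\<bar> \<le> dist a m * norm u * norm w" if "u \<in> normal_space M a" "w \<in> tangent_space M m"
        using \<eta>(2)[OF a(1) assms(5)] that a(2) \<eta>(1) by simp
    qed (rule \<eta>(1))
  qed
qed

section \<open>Derivative of the nearest point projection along a curve\<close>

lemma tangent_variation_atE:
  assumes "tangent_variation_at M t m"
  obtains \<eta> where "0 < \<eta>"
    "\<And>a u w. a \<in> M \<Longrightarrow> dist a m < \<eta> \<Longrightarrow> u \<in> normal_space M m \<Longrightarrow> w \<in> tangent_space M a \<Longrightarrow>
      t * \<bar>u \<bullet> w\<bar> \<le> dist a m * norm u * norm w"
    "\<And>a u w. a \<in> M \<Longrightarrow> dist a m < \<eta> \<Longrightarrow> u \<in> normal_space M a \<Longrightarrow> w \<in> tangent_space M m \<Longrightarrow>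
      t * \<bar>u \<bullet> w\<bar> \<le> dist a m * norm u * norm w"
proof -
  obtain \<eta> where "0 < \<eta>" and \<eta>: "\<forall>a\<in>M. a \<noteq> m \<and> dist a m < \<eta> \<longrightarrow>
     (\<forall>u\<in>normal_space M m. \<forall>w\<in>tangent_space M a. t * \<bar>u \<bullet> w\<bar> \<le> dist a m * norm u * norm w) \<and>
     (\<forall>u\<in>normal_space M a. \<forall>w\<in>tangent_space M m. t * \<bar>u \<bullet> w\<bar> \<le> dist a m * norm u * norm w)"
    using assms unfolding tangent_variation_at_def eventually_at by auto
  show ?thesis
  proof (rule that[OF \<open>0 < \<eta>\<close>])
    fix a u w assume a: "a \<in> M" "dist a m < \<eta>"
    show "t * \<bar>u \<bullet> w\<bar> \<le> dist a m * norm u * norm w" if "u \<in> normal_space M m" "w \<in> tangent_space M a"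
      using \<eta> a that inner_normal_tangent[of u M m w] by (cases "a = m") auto
    show "t * \<bar>u \<bullet> w\<bar> \<le> dist a m * norm u * norm w" if "u \<in> normal_space M a" "w \<in> tangent_space M m"
      using \<eta> a that inner_normal_tangent[of u M m w] by (cases "a = m") auto
  qed
qed

lemma has_derivative_line:
  fixes g :: "'a::real_normed_vector \<Rightarrow> 'b::real_normed_vector"
  assumes "(g has_derivative g') (at a)"
  shows "((\<lambda>\<xi>::real. g (a + \<xi> *\<^sub>R z)) has_vector_derivative g' z) (at 0)"
proof -
  have "(g has_derivative g') (at (a + 0 *\<^sub>R z))" using assms by simp
  then have "((\<lambda>\<xi>::real. g (a + \<xi> *\<^sub>R z)) has_derivative (\<lambda>h. g' (h *\<^sub>R z))) (at 0)"
    by (rule has_derivative_compose[rotated]) (auto intro!: derivative_eq_intros)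
  then show ?thesis
    by (simp add: has_vector_derivative_def linear_cmul[OF has_derivative_linear[OF assms]])
qed

text \<open>Chain rule for a curve \<open>s\<close> that is only Lipschitz at \<open>x0\<close>: its
  difference quotients are bounded but not known to converge, so quotients are compared instead of
  limits.\<close>

lemma difference_quotient_remainder:
  fixes s :: "real \<Rightarrow> 'a::real_normed_vector" and g :: "'a \<Rightarrow> 'b::real_normed_vector"
  assumes g: "(g has_derivative g') (at (s x0))"
    and s: "\<forall>\<^sub>F x in at x0. norm (s x - s x0) \<le> C * \<bar>x - x0\<bar>"
  shows "((\<lambda>x. (g (s x) - g (s x0)) /\<^sub>R (x - x0) - g' ((s x - s x0) /\<^sub>R (x - x0))) \<longlongrightarrow> 0) (at x0)"
proof (rule tendstoI)
  fix e :: real assume "0 < e"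
  define K where "K = \<bar>C\<bar> + 1"
  have K: "0 < K" "C \<le> K" by (auto simp: K_def)
  define e' where "e' = e / (2 * K)"
  have e': "0 < e'" using \<open>0 < e\<close> K by (simp add: e'_def)
  obtain d where d: "0 < d" "\<And>y. norm (y - s x0) < d \<Longrightarrow> norm (g y - g (s x0) - g' (y - s x0)) \<le> e' * norm (y - s x0)"
    using g e' unfolding has_derivative_at_alt by blast
  have "\<forall>\<^sub>F x in at x0. dist x x0 < d / K" using eventually_at_ball[of "d / K" x0 UNIV] d(1) K
    by (auto simp: dist_commute)
  then show "\<forall>\<^sub>F x in at x0. dist ((g (s x) - g (s x0)) /\<^sub>R (x - x0) - g' ((s x - s x0) /\<^sub>R (x - x0))) 0 < e"
    using s eventually_neq_at_within[of x0 x0 UNIV]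
  proof eventually_elim
    case (elim x)
    have sx: "norm (s x - s x0) \<le> K * \<bar>x - x0\<bar>"
      using elim(2) K(2) by (meson abs_ge_zero mult_right_mono order_trans)
    also have "\<dots> < d" using elim(1) K by (simp add: dist_norm field_simps)
    finally have "norm (g (s x) - g (s x0) - g' (s x - s x0)) \<le> e' * norm (s x - s x0)" by (rule d(2))
    also have "\<dots> \<le> e' * (K * \<bar>x - x0\<bar>)" using sx e' by (intro mult_left_mono) auto
    also have "\<dots> = e / 2 * \<bar>x - x0\<bar>" using K by (simp add: e'_def)
    also have "\<dots> < e * \<bar>x - x0\<bar>" using elim(3) \<open>0 < e\<close> by simp
    finally have "norm (g (s x) - g (s x0) - g' (s x - s x0)) / \<bar>x - x0\<bar> < e"
      using elim(3) by (simp add: pos_divide_less_eq)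
    moreover have "(g (s x) - g (s x0)) /\<^sub>R (x - x0) - g' ((s x - s x0) /\<^sub>R (x - x0)) =
        (g (s x) - g (s x0) - g' (s x - s x0)) /\<^sub>R (x - x0)"
      unfolding linear_cmul[OF has_derivative_linear[OF g]] by (rule scaleR_diff_right[symmetric])
    ultimately show ?case by (simp add: divide_inverse_commute)
  qed
qed

context submanifold_chart
begin

text \<open>The curve \<open>p\<close> of nearest points solves \<open>J (\<phi> (p x)) w \<bullet> (h x - p x) = 0\<close> for all \<open>w \<in> S\<close>. Its
  linearization \<open>B z w = J w \<bullet> h'\<close> is uniquely solvable because \<^const>\<open>tangent_variation_at\<close>
  bounds the second fundamental form \<open>H z w \<bullet> v\<close> by \<open>(norm v / t) * norm (J z) * norm (J w)\<close>, and \<open>p\<close>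
  is already known to be Lipschitz, so no implicit function theorem is needed.\<close>

lemma nearest_point_curve_derivative:
  fixes p h :: "real \<Rightarrow> 'a"
  assumes t: "0 < t" and tv: "tangent_variation_at M t (p x0)" and pU: "p x0 \<in> U"
    and p: "\<And>x. p x \<in> M" "\<And>x. h x - p x \<in> normal_space M (p x)"
    and lip: "\<forall>\<^sub>F x in at x0. norm (p x - p x0) \<le> L * \<bar>x - x0\<bar>"
    and h: "(h has_vector_derivative h') (at x0)" and v: "norm (h x0 - p x0) < t"
  obtains u where "u \<in> tangent_space M (p x0)" "(p has_vector_derivative u) (at x0)"
    "\<forall>w\<in>tangent_space M (p x0). t * \<bar>(h' - u) \<bullet> w\<bar> \<le> norm (h x0 - p x0) * norm u * norm w"
proof -
  define s where "s x = \<phi> (p x)" for x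
  define s0 where "s0 = s x0"
  define v0 where "v0 = h x0 - p x0"
  define z where "z x = (s x - s0) /\<^sub>R (x - x0)" for x
  \<comment> \<open>Differentiating \<open>J (s x) w \<bullet> (h x - p x) = 0\<close> formally at
    \<open>x0\<close> gives
    \<open>H s0 z w \<bullet> v0 + J s0 w \<bullet> (h' - J s0 z) = 0\<close>, that is,
    \<open>B z w = J s0 w \<bullet> h'\<close>.\<close>
  define B where "B z w = J s0 w \<bullet> J s0 z - H s0 z w \<bullet> v0" for z w
  have s0V: "s0 \<in> V" and psi_s0: "\<psi> s0 = p x0" and s0S: "s0 \<in> S"
    using pU p(1) phi_in_V psi_phi phi_in_S by (auto simp: s0_def s_def)
  note linJ = linear_J[OF s0V] and linH1 = linear_H1[OF s0V] and linH2 = linear_H2[OF s0V]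
  have T: "tangent_space M (p x0) = J s0 ` S"
    using tangent_space_eq[OF p(1) pU] by (simp add: s0_def s_def)
  have v0J: "J s0 w \<bullet> v0 = 0" if "w \<in> S" for w
    using inner_normal_tangent[OF p(2)[of x0], of "J s0 w"] that by (simp add: T v0_def inner_commute)
  have x_lim: "((\<lambda>x. L * \<bar>x - x0\<bar>) \<longlongrightarrow> 0) (at x0)"
    by (rule tendsto_eq_intros refl | simp)+
  have p_lim: "(p \<longlongrightarrow> p x0) (at x0)"
    using Lim_null_comparison[OF lip x_lim] by (simp add: LIM_zero_iff)
  then have evU: "\<forall>\<^sub>F x in at x0. p x \<in> U" using open_U pU topological_tendstoD by blast
  obtain C where C: "0 < C" "\<forall>\<^sub>F q in nhds (p x0). norm (\<phi> q - \<phi> (p x0)) \<le> C * norm (q - p x0)"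
    using has_derivative_local_lipschitz[OF has_derivative_phi[OF pU]] .
  have s_lip: "\<forall>\<^sub>F x in at x0. norm (s x - s x0) \<le> (C * L) * \<bar>x - x0\<bar>"
    using eventually_compose_filterlim[OF C(2) p_lim] lip
  proof eventually_elim
    case (elim x)
    have "C * norm (p x - p x0) \<le> C * (L * \<bar>x - x0\<bar>)" using elim(2) C(1) by (intro mult_left_mono) auto
    then show ?case using elim(1) by (simp add: s_def mult.assoc)
  qed
  have "((\<lambda>x. (C * L) * \<bar>x - x0\<bar>) \<longlongrightarrow> 0) (at x0)"
    by (rule tendsto_eq_intros refl | simp)+
  from Lim_null_comparison[OF s_lip this] have s_lim: "(s \<longlongrightarrow> s0) (at x0)"
    by (simp add: LIM_zero_iff s0_def)
  have zS: "\<forall>\<^sub>F x in at x0. z x \<in> S"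
    using evU by eventually_elim
      (use s0S p(1) phi_in_S subspace_S in \<open>auto simp: z_def s_def intro!: subspace_mul subspace_diff\<close>)
  let ?Q = "\<lambda>x. (p x - p x0) /\<^sub>R (x - x0)"
  let ?E1 = "\<lambda>x. ?Q x - J s0 (z x)"
  have E1: "(?E1 \<longlongrightarrow> 0) (at x0)"
  proof -
    have "((\<lambda>x. (\<psi> (s x) - \<psi> (s x0)) /\<^sub>R (x - x0) - J s0 ((s x - s x0) /\<^sub>R (x - x0))) \<longlongrightarrow> 0) (at x0)"
      by (rule difference_quotient_remainder[OF _ s_lip]) (use has_derivative_psi[OF s0V] in \<open>simp add: s0_def\<close>)
    then show ?thesis
      by (rule Lim_transform_eventually)
        (use evU in eventually_elim, simp add: psi_phi s_def z_def s0_def pU)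
  qed
  have B_lim: "((\<lambda>x. B (z x) w) \<longlongrightarrow> J s0 w \<bullet> h') (at x0)" if w: "w \<in> S" for w
  proof -
    let ?E2 = "\<lambda>x. (J (s x) w - J s0 w) /\<^sub>R (x - x0) - H s0 (z x) w"
    \<comment> \<open>The mixed term of the discrete product rule. It tends to 0 because the
      Lipschitz bound keeps \<open>?Q\<close> bounded before its convergence is known.\<close>
    let ?R = "\<lambda>x. (J (s x) w - J s0 w) \<bullet> ?Q x"
    have E2: "(?E2 \<longlongrightarrow> 0) (at x0)"
      using difference_quotient_remainder[OF _ s_lip, of "\<lambda>x. J x w"] has_derivative_J[OF s0V, of w]
      unfolding z_def s0_def by blast
    have "isCont (\<lambda>x. J x w) s0" using has_derivative_continuous[OF has_derivative_J[OF s0V]] .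
    from isCont_tendsto_compose[OF this s_lim] have Jw: "((\<lambda>x. J (s x) w) \<longlongrightarrow> J s0 w) (at x0)" .
    have Dh: "((\<lambda>x. (h x - h x0) /\<^sub>R (x - x0)) \<longlongrightarrow> h') (at x0)"
      using h by (simp add: has_vector_derivative_at_iff_tendsto)
    have R: "(?R \<longlongrightarrow> 0) (at x0)"
    proof (rule Lim_null_comparison)
      show "\<forall>\<^sub>F x in at x0. norm (?R x) \<le> norm (J (s x) w - J s0 w) * \<bar>L\<bar>"
        using lip eventually_neq_at_within[of x0 x0 UNIV]
      proof eventually_elim
        case (elim x)
        have "norm (?Q x) = norm (p x - p x0) / \<bar>x - x0\<bar>" by (simp add: divide_inverse_commute)
        also have "\<dots> \<le> L" using elim by (simp add: pos_divide_le_eq)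
        finally have "norm (?Q x) \<le> \<bar>L\<bar>" by simp
        then show ?case
          using Cauchy_Schwarz_ineq2[of "J (s x) w - J s0 w" "?Q x"]
          by (smt (verit) mult_left_mono norm_ge_zero real_norm_def)
      qed
      show "((\<lambda>x. norm (J (s x) w - J s0 w) * \<bar>L\<bar>) \<longlongrightarrow> 0) (at x0)"
        by (rule tendsto_mult_left_zero) (simp add: tendsto_norm_zero_iff LIM_zero_iff Jw)
    qed
    have "((\<lambda>x. J (s x) w \<bullet> ((h x - h x0) /\<^sub>R (x - x0)) - ?R x - J s0 w \<bullet> ?E1 x + ?E2 x \<bullet> v0) \<longlongrightarrow>
        J s0 w \<bullet> h' - 0 - J s0 w \<bullet> 0 + 0 \<bullet> v0) (at x0)"
      by (intro tendsto_intros Jw Dh R E1 E2)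
    then have "((\<lambda>x. J (s x) w \<bullet> ((h x - h x0) /\<^sub>R (x - x0)) - ?R x - J s0 w \<bullet> ?E1 x + ?E2 x \<bullet> v0) \<longlongrightarrow>
        J s0 w \<bullet> h') (at x0)" by simp
    then show ?thesis
    proof (rule Lim_transform_eventually)
      show "\<forall>\<^sub>F x in at x0. J (s x) w \<bullet> ((h x - h x0) /\<^sub>R (x - x0)) - ?R x - J s0 w \<bullet> ?E1 x + ?E2 x \<bullet> v0 = B (z x) w"
        using evU
      proof eventually_elim
        case (elim x)
        define \<xi> where "\<xi> = inverse (x - x0)"
        define a b j where "a = J (s x) w" and "b = J s0 w" and "j = J s0 (z x)"
        have "a \<in> tangent_space M (p x)"
          using tangent_space_eq[OF p(1) elim] w by (simp add: a_def s_def)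
        then have n: "a \<bullet> (h x - p x) = 0"
          using inner_normal_tangent[OF p(2)] by (simp add: inner_commute)
        have n0: "b \<bullet> v0 = 0" using v0J[OF w] by (simp add: b_def)
        have "a \<bullet> (\<xi> *\<^sub>R (h x - h x0)) - (a - b) \<bullet> (\<xi> *\<^sub>R (p x - p x0)) - b \<bullet> (\<xi> *\<^sub>R (p x - p x0) - j)
            + (\<xi> *\<^sub>R (a - b) - H s0 (z x) w) \<bullet> v0
            = \<xi> * (a \<bullet> (h x - p x)) - \<xi> * (b \<bullet> v0) + b \<bullet> j - H s0 (z x) w \<bullet> v0"
          by (simp add: v0_def inner_diff_left inner_diff_right algebra_simps)
        also have "\<dots> = b \<bullet> j - H s0 (z x) w \<bullet> v0" using n n0 by simp
        finally show ?case by (simp add: B_def a_def b_def j_def \<xi>_def)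
      qed
    qed
  qed
  \<comment> \<open>Move the base point along \<open>s0 + \<xi> *\<^sub>R z\<close>. Since
    \<open>v0\<close> is orthogonal to \<open>J s0 w\<close>, its inner product with
    \<open>J (?c \<xi>) w\<close> is already an increment. Dividing the tangent variation bound by
    \<open>\<bar>\<xi>\<bar>\<close> and letting \<open>\<xi>\<close> tend to 0 bounds the second
    derivative.\<close>
  have H_bound: "t * \<bar>H s0 z w \<bullet> v0\<bar> \<le> norm v0 * norm (J s0 z) * norm (J s0 w)" if zw: "z \<in> S" "w \<in> S" for z w
  proof -
    obtain \<eta> where \<eta>: "0 < \<eta>" "\<And>a u w. a \<in> M \<Longrightarrow> dist a (p x0) < \<eta> \<Longrightarrow> u \<in> normal_space M (p x0) \<Longrightarrow>
        w \<in> tangent_space M a \<Longrightarrow> t * \<bar>u \<bullet> w\<bar> \<le> dist a (p x0) * norm u * norm w"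
      using tangent_variation_atE[OF tv] by metis
    let ?c = "\<lambda>\<xi>::real. s0 + \<xi> *\<^sub>R z"
    have c_lim: "(?c \<longlongrightarrow> s0) (at 0)" by (rule tendsto_eq_intros refl | simp)+
    have Dc: "((\<lambda>\<xi>. \<psi> (?c \<xi>)) has_vector_derivative J s0 z) (at 0)"
      by (rule has_derivative_line[OF has_derivative_psi[OF s0V]])
    have DJ: "((\<lambda>\<xi>. J (?c \<xi>) w) has_vector_derivative H s0 z w) (at 0)"
      by (rule has_derivative_line[OF has_derivative_J[OF s0V]])
    have "isCont (\<lambda>x. J x w) s0" using has_derivative_continuous[OF has_derivative_J[OF s0V]] .
    from isCont_tendsto_compose[OF this c_lim] have Jc: "((\<lambda>\<xi>. J (?c \<xi>) w) \<longlongrightarrow> J s0 w) (at 0)" .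
    have "isCont \<psi> s0" using has_derivative_continuous[OF has_derivative_psi[OF s0V]] .
    from isCont_tendsto_compose[OF this c_lim] have psic: "((\<lambda>\<xi>. \<psi> (?c \<xi>)) \<longlongrightarrow> p x0) (at 0)"
      by (simp add: psi_s0)
    have "((\<lambda>\<xi>. t * \<bar>v0 \<bullet> ((J (?c \<xi>) w - J s0 w) /\<^sub>R \<xi>)\<bar>) \<longlongrightarrow> t * \<bar>v0 \<bullet> H s0 z w\<bar>) (at 0)"
      using DJ unfolding has_vector_derivative_at_iff_tendsto by (intro tendsto_intros) simp
    moreover have "((\<lambda>\<xi>. norm ((\<psi> (?c \<xi>) - p x0) /\<^sub>R \<xi>) * norm v0 * norm (J (?c \<xi>) w)) \<longlongrightarrow>
        norm (J s0 z) * norm v0 * norm (J s0 w)) (at 0)"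
      using Dc unfolding has_vector_derivative_at_iff_tendsto by (intro tendsto_intros Jc) (simp add: psi_s0)
    moreover have "\<forall>\<^sub>F \<xi> in at 0. t * \<bar>v0 \<bullet> ((J (?c \<xi>) w - J s0 w) /\<^sub>R \<xi>)\<bar>
        \<le> norm ((\<psi> (?c \<xi>) - p x0) /\<^sub>R \<xi>) * norm v0 * norm (J (?c \<xi>) w)"
      using topological_tendstoD[OF c_lim open_V s0V] tendstoD[OF psic \<eta>(1)]
    proof eventually_elim
      case (elim \<xi>)
      have cS: "?c \<xi> \<in> S" using s0S zw(1) subspace_S by (simp add: subspace_add subspace_mul)
      have "t * \<bar>v0 \<bullet> J (?c \<xi>) w\<bar> \<le> dist (\<psi> (?c \<xi>)) (p x0) * norm v0 * norm (J (?c \<xi>) w)"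
        by (rule \<eta>(2)[OF psi_in_M[OF elim(1) cS] elim(2)])
          (use p(2) in \<open>auto simp: v0_def intro: J_in_tangent_space[OF elim(1) cS zw(2)]\<close>)
      then have "\<bar>inverse \<xi>\<bar> * (t * \<bar>v0 \<bullet> J (?c \<xi>) w\<bar>)
          \<le> \<bar>inverse \<xi>\<bar> * (dist (\<psi> (?c \<xi>)) (p x0) * norm v0 * norm (J (?c \<xi>) w))"
        by (intro mult_left_mono) auto
      moreover have "v0 \<bullet> (J (?c \<xi>) w - J s0 w) = v0 \<bullet> J (?c \<xi>) w"
        using v0J[OF zw(2)] by (simp add: inner_diff_right inner_commute)
      ultimately show ?case by (simp add: abs_mult dist_norm mult_ac)
    qed
    ultimately have "t * \<bar>v0 \<bullet> H s0 z w\<bar> \<le> norm (J s0 z) * norm v0 * norm (J s0 w)"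
      using tendsto_le[OF at_neq_bot] by blast
    then show ?thesis by (simp add: inner_commute mult.commute)
  qed
  \<comment> \<open>Testing with \<open>w = z\<close> shows that
    \<open>(norm (J s0 z))\<^sup>2\<close> is at most \<open>norm v0 / t\<close> times itself; as
    \<open>norm v0 < t\<close>, it is 0.\<close>
  have B_inj: "z = 0" if z: "z \<in> S" "\<And>w. w \<in> S \<Longrightarrow> B z w = 0" for z
  proof -
    have "(norm (J s0 z))\<^sup>2 = H s0 z z \<bullet> v0" using z(2)[OF z(1)] by (simp add: B_def power2_norm_eq_inner)
    then have "t * (norm (J s0 z))\<^sup>2 \<le> norm v0 * (norm (J s0 z))\<^sup>2"
      using H_bound[OF z(1) z(1)] by (simp add: power2_eq_square mult.assoc) (smt (verit) mult_left_mono t)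
    then have "(t - norm v0) * (norm (J s0 z))\<^sup>2 \<le> 0" by (simp add: algebra_simps)
    then have "J s0 z = 0" using v by (simp add: v0_def mult_le_0_iff)
    then show "z = 0" using J'_J[OF s0V, of z] linear_0[OF linear_J'[OF psi_in_U[OF s0V]]] by simp
  qed
  obtain bs where bs: "bs \<subseteq> S" "independent bs" "span bs = S" "finite bs"
    using orthonormal_basis_subspace[OF subspace_S] independent_imp_finite by metis
  \<comment> \<open>Testing against a basis turns the equations for all \<open>w \<in> S\<close>
    into one linear equation on \<open>S\<close>. Injectivity bounds \<open>Tm\<close> from below,
    so that convergence of \<open>Tm (z x)\<close> implies convergence of
    \<open>z x\<close>.\<close>
  define Tm where "Tm z = (\<Sum>b\<in>bs. B z b *\<^sub>R b)" for z
  have linB1: "linear (\<lambda>z. B z w)" for w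
    by (rule linearI) (simp_all add: B_def linear_add[OF linJ] linear_cmul[OF linJ] linear_add[OF linH1]
        linear_cmul[OF linH1] inner_add_left inner_add_right algebra_simps)
  have linB2: "linear (\<lambda>w. B z w)" for z
    by (rule linearI) (simp_all add: B_def linear_add[OF linJ] linear_cmul[OF linJ] linear_add[OF linH2]
        linear_cmul[OF linH2] inner_add_left inner_add_right algebra_simps)
  have linT: "linear Tm"
    unfolding Tm_def
    by (rule linearI) (simp_all add: linear_add[OF linB1] linear_cmul[OF linB1] scaleR_add_left sum.distrib scaleR_sum_right)
  have T_inj: "z = 0" if "z \<in> S" "Tm z = 0" for z
  proof (rule B_inj[OF that(1)])
    have "B z b = 0" if "b \<in> bs" for b
      using independentD[OF bs(2) bs(4) order_refl] \<open>Tm z = 0\<close> that unfolding Tm_def by blast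
    then show "B z w = 0" if "w \<in> S" for w
      using linear_eq_0_on_span[OF linB2] that bs(3) by blast
  qed
  obtain e where e: "0 < e" "\<And>z. z \<in> S \<Longrightarrow> e * norm z \<le> norm (Tm z)"
    using injective_imp_isometric[OF closed_subspace[OF subspace_S] subspace_S, of Tm] T_inj linT
      linear_conv_bounded_linear by blast
  let ?l = "\<Sum>b\<in>bs. (J s0 b \<bullet> h') *\<^sub>R b"
  have T_lim: "((\<lambda>x. Tm (z x)) \<longlongrightarrow> ?l) (at x0)"
    unfolding Tm_def using bs(1) by (intro tendsto_intros B_lim) auto
  \<comment> \<open>Solvability of the limit equation: all \<open>Tm (z x)\<close> with
    \<open>x\<close> near \<open>x0\<close> lie in the image of \<open>S\<close> under
    \<open>Tm\<close>, a subspace and hence closed.\<close>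
  have "?l \<in> Tm ` S"
  proof (rule Lim_in_closed_set[OF _ _ _ T_lim])
    show "closed (Tm ` S)" by (intro closed_subspace linear_subspace_image linT subspace_S)
    show "\<forall>\<^sub>F x in at x0. Tm (z x) \<in> Tm ` S" using zS by eventually_elim simp
  qed simp
  then obtain \<sigma> where \<sigma>: "\<sigma> \<in> S" "Tm \<sigma> = ?l" by auto
  have z_lim: "(z \<longlongrightarrow> \<sigma>) (at x0)"
  proof -
    have "((\<lambda>x. z x - \<sigma>) \<longlongrightarrow> 0) (at x0)"
    proof (rule Lim_null_comparison)
      show "\<forall>\<^sub>F x in at x0. norm (z x - \<sigma>) \<le> norm (Tm (z x) - ?l) / e"
        using zS
      proof eventually_elim
        case (elim x)
        have "e * norm (z x - \<sigma>) \<le> norm (Tm (z x) - Tm \<sigma>)"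
          using e(2)[of "z x - \<sigma>"] elim \<sigma>(1) subspace_S by (simp add: subspace_diff linear_diff[OF linT])
        then show ?case using e(1) \<sigma>(2) by (simp add: pos_le_divide_eq mult.commute)
      qed
      have "((\<lambda>x. norm (Tm (z x) - ?l) / e) \<longlongrightarrow> norm (?l - ?l) / e) (at x0)"
        using e(1) by (intro tendsto_intros T_lim) simp
      then show "((\<lambda>x. norm (Tm (z x) - ?l) / e) \<longlongrightarrow> 0) (at x0)" by simp
    qed
    then show ?thesis by (simp add: LIM_zero_iff)
  qed
  have J_lim: "((\<lambda>x. J s0 (z x)) \<longlongrightarrow> J s0 \<sigma>) (at x0)"
    by (rule bounded_linear.tendsto[OF linear_conv_bounded_linear[THEN iffD1, OF linJ] z_lim])
  have "((\<lambda>x. J s0 (z x) + ?E1 x) \<longlongrightarrow> J s0 \<sigma> + 0) (at x0)" by (intro tendsto_intros J_lim E1)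
  then have deriv: "(p has_vector_derivative J s0 \<sigma>) (at x0)"
    by (simp add: has_vector_derivative_at_iff_tendsto)
  have B_eq: "B \<sigma> w = J s0 w \<bullet> h'" if "w \<in> S" for w
    using tendsto_unique[OF _ bounded_linear.tendsto[OF linear_conv_bounded_linear[THEN iffD1, OF linB1] z_lim] B_lim[OF that]] by simp
  show ?thesis
  proof (rule that[of "J s0 \<sigma>"])
    show "J s0 \<sigma> \<in> tangent_space M (p x0)" using \<sigma>(1) T by simp
    show "\<forall>w\<in>tangent_space M (p x0). t * \<bar>(h' - J s0 \<sigma>) \<bullet> w\<bar> \<le> norm (h x0 - p x0) * norm (J s0 \<sigma>) * norm w"
    proof
      fix w' assume "w' \<in> tangent_space M (p x0)"
      then obtain w where w: "w \<in> S" "w' = J s0 w" using T by blast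
      have "(h' - J s0 \<sigma>) \<bullet> w' = - (H s0 \<sigma> w \<bullet> v0)"
        using B_eq[OF w(1)] unfolding B_def w(2) by (simp add: inner_diff_left inner_diff_right inner_commute)
      then show "t * \<bar>(h' - J s0 \<sigma>) \<bullet> w'\<bar> \<le> norm (h x0 - p x0) * norm (J s0 \<sigma>) * norm w'"
        using H_bound[OF \<sigma>(1) w(1)] by (simp add: v0_def w(2))
    qed
  qed (rule deriv)
qed

end

section \<open>Orthogonal projections onto linear subspaces\<close>

definition orth_proj :: "'a::euclidean_space set \<Rightarrow> 'a \<Rightarrow> 'a" where
  "orth_proj S x = (SOME y. y \<in> S \<and> (\<forall>w\<in>S. (x - y) \<bullet> w = 0))"

context
  fixes S :: "'a::euclidean_space set"
  assumes S: "subspace S"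
begin

lemma orth_proj: "orth_proj S x \<in> S \<and> (\<forall>w\<in>S. (x - orth_proj S x) \<bullet> w = 0)"
proof -
  obtain y z where "y \<in> span S" "\<And>w. w \<in> span S \<Longrightarrow> orthogonal z w" "x = y + z"
    using orthogonal_subspace_decomp_exists[of S x] by blast
  then have "y \<in> S \<and> (\<forall>w\<in>S. (x - y) \<bullet> w = 0)"
    using span_eq_iff[THEN iffD2, OF S] by (simp add: orthogonal_def)
  then show ?thesis unfolding orth_proj_def by (rule someI)
qed

lemma orth_proj_in: "orth_proj S x \<in> S"
  and orth_proj_orth: "w \<in> S \<Longrightarrow> (x - orth_proj S x) \<bullet> w = 0"
  using orth_proj by blast+

lemma orth_proj_unique:
  assumes "y \<in> S" "\<And>w. w \<in> S \<Longrightarrow> (x - y) \<bullet> w = 0"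
  shows "orth_proj S x = y"
proof -
  let ?d = "orth_proj S x - y"
  have "?d \<in> S" using S assms(1) orth_proj_in by (simp add: subspace_diff)
  then have "(x - y) \<bullet> ?d - (x - orth_proj S x) \<bullet> ?d = 0" using assms(2) orth_proj_orth by simp
  then have "?d \<bullet> ?d = 0" by (simp add: inner_diff_left)
  then show ?thesis by simp
qed

lemma orth_proj_self: "x \<in> S \<Longrightarrow> orth_proj S x = x"
  by (rule orth_proj_unique) auto

lemma orth_proj_diff: "orth_proj S (x - y) = orth_proj S x - orth_proj S y"
proof (rule orth_proj_unique)
  show "orth_proj S x - orth_proj S y \<in> S" using S by (simp add: subspace_diff orth_proj_in)
  show "(x - y - (orth_proj S x - orth_proj S y)) \<bullet> w = 0" if "w \<in> S" for w
    using orth_proj_orth[OF that, of x] orth_proj_orth[OF that, of y] by (simp add: inner_diff_left)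
qed

lemma orth_proj_pythagoras: "(norm x)\<^sup>2 = (norm (orth_proj S x))\<^sup>2 + (norm (x - orth_proj S x))\<^sup>2"
  using orth_proj_orth[OF orth_proj_in, of x x]
  by (simp add: power2_norm_eq_inner inner_diff_left inner_diff_right inner_commute)

lemma norm_orth_proj_le: "norm (orth_proj S x) \<le> norm x"
  using orth_proj_pythagoras[of x] by (simp add: power2_le_imp_le)

lemma orth_proj_inner_self: "orth_proj S x \<bullet> x = (norm (orth_proj S x))\<^sup>2"
  using orth_proj_orth[OF orth_proj_in, of x x]
  by (simp add: power2_norm_eq_inner inner_diff_left inner_commute[of _ x])

lemma orth_proj_inner_compl: "(x - orth_proj S x) \<bullet> x = (norm (x - orth_proj S x))\<^sup>2"
  using orth_proj_orth[OF orth_proj_in, of x x]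
  by (simp add: power2_norm_eq_inner inner_diff_left inner_diff_right inner_commute)

text \<open>Thales: the projection of \<open>x\<close> onto any subspace lies on the sphere that has
  the segment from 0 to \<open>x\<close> as a diameter. Two projections of \<open>x\<close> are
  therefore at most \<open>norm x\<close> apart.\<close>

lemma orth_proj_near_half: "norm (orth_proj S x - (1/2) *\<^sub>R x) = norm x / 2"
proof -
  have "(norm (orth_proj S x - (1/2) *\<^sub>R x))\<^sup>2 = (norm x / 2)\<^sup>2"
    using orth_proj_inner_self[of x]
    by (simp add: power2_norm_eq_inner inner_diff_left inner_diff_right inner_commute power_divide)
  then show ?thesis by (simp add: power2_eq_iff_nonneg)
qed

end

lemma orth_proj_diff_le_norm:
  assumes "subspace A" "subspace B"
  shows "norm (orth_proj A x - orth_proj B x) \<le> norm x"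
  using orth_proj_near_half[OF assms(1), of x] orth_proj_near_half[OF assms(2), of x]
    norm_triangle_ineq4[of "orth_proj A x - (1/2) *\<^sub>R x" "orth_proj B x - (1/2) *\<^sub>R x"] by simp

text \<open>With \<open>y = orth_proj B x\<close> the difference is \<open>p - q\<close>, where
  \<open>p\<close> is the part of \<open>x - y\<close> in \<open>A\<close> and \<open>q\<close> the
  part of \<open>y\<close> orthogonal to \<open>A\<close>. Since \<open>p\<close> is orthogonal to
  \<open>q\<close> and \<open>y\<close> to \<open>x - y\<close>, using Pythagoras twice keeps the
  constant \<open>\<kappa>\<close>, where the triangle inequality would add two bounds.\<close>

lemma orth_proj_variation:
  fixes A B :: "'a::euclidean_space set"
  assumes A: "subspace A" and B: "subspace B" and "0 \<le> \<kappa>"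
    and 1: "\<And>u w. u \<in> A\<^sup>\<bottom> \<Longrightarrow> w \<in> B \<Longrightarrow> \<bar>u \<bullet> w\<bar> \<le> \<kappa> * norm u * norm w"
    and 2: "\<And>u w. u \<in> B\<^sup>\<bottom> \<Longrightarrow> w \<in> A \<Longrightarrow> \<bar>u \<bullet> w\<bar> \<le> \<kappa> * norm u * norm w"
  shows "norm (orth_proj A x - orth_proj B x) \<le> \<kappa> * norm x"
proof -
  define y where "y = orth_proj B x"
  define p where "p = orth_proj A (x - y)"
  define q where "q = y - orth_proj A y"
  have perp: "v - orth_proj T v \<in> T\<^sup>\<bottom>" if "subspace T" for v and T :: "'a set"
    using orth_proj_orth[OF that] by (auto simp: orthogonal_comp_def orthogonal_def inner_commute)
  have y: "y \<in> B" "x - y \<in> B\<^sup>\<bottom>" using orth_proj_in[OF B] perp[OF B] by (auto simp: y_def)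
  have p: "p \<in> A" using orth_proj_in[OF A] by (simp add: p_def)
  have q: "q \<in> A\<^sup>\<bottom>" using perp[OF A] by (simp add: q_def)
  have cancel: "n \<le> c" if "n\<^sup>2 \<le> c * n" "0 \<le> n" "0 \<le> c" for n c :: real
    using that by (cases "n = 0") (auto simp: power2_eq_square)
  have "(norm p)\<^sup>2 \<le> (\<kappa> * norm (x - y)) * norm p"
    using 2[OF y(2) p] orth_proj_inner_self[OF A, of "x - y"] by (simp add: p_def inner_commute)
  then have np: "norm p \<le> \<kappa> * norm (x - y)" by (rule cancel) (use \<open>0 \<le> \<kappa>\<close> in auto)
  have "(norm q)\<^sup>2 \<le> (\<kappa> * norm y) * norm q"
    using 1[OF q y(1)] orth_proj_inner_compl[OF A, of y] by (simp add: q_def mult_ac)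
  then have nq: "norm q \<le> \<kappa> * norm y" by (rule cancel) (use \<open>0 \<le> \<kappa>\<close> in auto)
  have pq: "p \<bullet> q = 0" using p q by (simp add: orthogonal_comp_def orthogonal_def)
  have "(norm (orth_proj A x - orth_proj B x))\<^sup>2 = (norm (p - q))\<^sup>2"
    using orth_proj_diff[OF A, of x y] by (simp add: p_def q_def y_def)
  also have "\<dots> = (norm p)\<^sup>2 + (norm q)\<^sup>2"
    using pq by (simp add: power2_norm_eq_inner inner_diff_left inner_diff_right inner_commute)
  also have "\<dots> \<le> (\<kappa> * norm (x - y))\<^sup>2 + (\<kappa> * norm y)\<^sup>2"
    by (intro add_mono power_mono np nq) auto
  also have "\<dots> = (\<kappa> * norm x)\<^sup>2"
    using orth_proj_pythagoras[OF B, of x] by (simp add: y_def power_mult_distrib algebra_simps)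
  finally show ?thesis by (rule power2_le_imp_le) (use \<open>0 \<le> \<kappa>\<close> in auto)
qed

text \<open>Bisection. The local bound always has \<open>x\<close> as one of its two points, so a
  short interval around \<open>x\<close> is split at \<open>x\<close>. It is applied to projections
  onto moving tangent spaces, for which only local increments are controlled.\<close>

lemma norm_diff_le_of_local:
  fixes g :: "real \<Rightarrow> 'a::real_normed_vector"
  assumes "\<And>x. x \<in> {0..1} \<Longrightarrow> \<exists>\<eta>>0. \<forall>y\<in>{0..1}. \<bar>y - x\<bar> < \<eta> \<longrightarrow> norm (g y - g x) \<le> B * \<bar>y - x\<bar>"
  shows "norm (g 1 - g 0) \<le> B"
proof -
  define P where "P a b \<longleftrightarrow> 0 \<le> a \<and> b \<le> 1 \<longrightarrow> norm (g b - g a) \<le> B * (b - a)" for a b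
  have "P 0 1"
  proof (rule Bolzano)
    show "(0::real) \<le> 1" by simp
    show "P a c" if "P a b" "P b c" "a \<le> b" "b \<le> c" for a b c
    proof -
      have "norm (g c - g a) \<le> norm (g c - g b) + norm (g b - g a)"
        using norm_triangle_ineq[of "g c - g b" "g b - g a"] by simp
      then show ?thesis using that unfolding P_def by (auto simp: algebra_simps)
    qed
    fix x :: real assume x: "0 \<le> x" "x \<le> 1"
    obtain \<eta> where \<eta>: "0 < \<eta>" "\<And>y. y \<in> {0..1} \<Longrightarrow> \<bar>y - x\<bar> < \<eta> \<Longrightarrow> norm (g y - g x) \<le> B * \<bar>y - x\<bar>"
      using assms[of x] x by auto
    have "P a b" if "a \<le> x" "x \<le> b" "b - a < \<eta>" for a b
      unfolding P_def
    proof
      assume ab: "0 \<le> a \<and> b \<le> 1"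
      have "norm (g b - g x) \<le> B * (b - x)" using \<eta>(2)[of b] that ab by simp
      moreover have "norm (g a - g x) \<le> B * (x - a)" using \<eta>(2)[of a] that ab by simp
      moreover have "norm (g b - g a) \<le> norm (g b - g x) + norm (g a - g x)"
        using norm_triangle_ineq4[of "g b - g x" "g a - g x"] by simp
      ultimately show "norm (g b - g a) \<le> B * (b - a)" by (simp add: algebra_simps)
    qed
    then show "\<exists>d>0. \<forall>a b. a \<le> x \<and> x \<le> b \<and> b - a < d \<longrightarrow> P a b" using \<eta>(1) by blast
  qed
  then show ?thesis by (simp add: P_def)
qed

section \<open>Tangent spaces along nearest points and the derivative estimate\<close>

lemma closest_point_normal:
  assumes "closed M" "M \<noteq> {}"
  shows "y - closest_point M y \<in> normal_space M (closest_point M y)"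
  using closest_point_le[OF assms(1)] by (rule nearest_point_normal)

text \<open>For \<open>2 * norm (y - a) < t\<close>, move along the nearest points of the segment from \<open>a\<close> to \<open>y\<close>, a path of
  length at most \<open>2 * norm (y - a)\<close>; otherwise the claim is trivial, because the difference of two
  orthogonal projections has operator norm at most 1.\<close>

lemma orth_proj_tangent_closest_point:
  fixes M :: "'a::euclidean_space set"
  assumes M: "smooth_submanifold k M" "compact M" and t: "0 < t" "outside_tangent_balls M t"
    and tv: "\<And>m. m \<in> M \<Longrightarrow> tangent_variation_at M t m" and a: "a \<in> M"
  shows "norm (orth_proj (tangent_space M (closest_point M y)) w - orth_proj (tangent_space M a) w)
    \<le> 2 * norm (y - a) / t * norm w"
proof -
  let ?\<delta> = "norm (y - a)" and ?T = "tangent_space M"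
  have M': "closed M" "M \<noteq> {}" using M(2) a compact_imp_closed by auto
  have P: "closest_point M x \<in> M" for x using closest_point_exists(1)[OF M'] .
  have sub: "subspace (?T m)" if "m \<in> M" for m by (rule subspace_tangent_space[OF M(1) that])
  show ?thesis
  proof (cases "2 * ?\<delta> < t")
    case False
    have "norm (orth_proj (?T (closest_point M y)) w - orth_proj (?T a) w) \<le> norm w"
      by (intro orth_proj_diff_le_norm sub P a)
    also have "1 \<le> 2 * ?\<delta> / t" using False t(1) by simp
    then have "norm w \<le> 2 * ?\<delta> / t * norm w" using mult_right_mono[of 1 "2 * ?\<delta> / t" "norm w"] by simp
    finally show ?thesis .
  next
    case True
    define q where "q \<tau> = closest_point M (a + \<tau> *\<^sub>R (y - a))" for \<tau>
    have qM: "q \<tau> \<in> M" for \<tau> by (simp add: q_def P)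
    have near: "norm (a + \<tau> *\<^sub>R (y - a) - q \<tau>) \<le> ?\<delta>" if "\<tau> \<in> {0..1}" for \<tau>
    proof -
      have "norm (a + \<tau> *\<^sub>R (y - a) - q \<tau>) \<le> \<tau> * ?\<delta>"
        using closest_point_le[OF M'(1) a, of "a + \<tau> *\<^sub>R (y - a)"] that by (simp add: q_def dist_norm)
      also have "\<dots> \<le> ?\<delta>" using that by (simp add: mult_left_le_one_le)
      finally show ?thesis .
    qed
    \<comment> \<open>Here \<open>t - ?\<delta> \<ge> t / 2\<close>, so the Lipschitz constant
      \<open>t / (t - ?\<delta>)\<close> is at most 2.\<close>
    have lip: "norm (q \<tau>' - q \<tau>) \<le> 2 * ?\<delta> * \<bar>\<tau>' - \<tau>\<bar>" if "\<tau> \<in> {0..1}" "\<tau>' \<in> {0..1}" for \<tau> \<tau>'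
    proof -
      have "(t - ?\<delta>) * norm (q \<tau>' - q \<tau>) \<le> t * norm ((a + \<tau>' *\<^sub>R (y - a)) - (a + \<tau> *\<^sub>R (y - a)))"
        by (rule nearest_points_lipschitz[OF t(2)])
          (use t(1) near that qM closest_point_normal[OF M'] in \<open>auto simp: q_def\<close>)
      also have "(a + \<tau>' *\<^sub>R (y - a)) - (a + \<tau> *\<^sub>R (y - a)) = (\<tau>' - \<tau>) *\<^sub>R (y - a)"
        by (simp add: algebra_simps)
      finally have "(t - ?\<delta>) * norm (q \<tau>' - q \<tau>) \<le> t * (\<bar>\<tau>' - \<tau>\<bar> * ?\<delta>)" by simp
      moreover have "(t / 2) * norm (q \<tau>' - q \<tau>) \<le> (t - ?\<delta>) * norm (q \<tau>' - q \<tau>)"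
        using True by (intro mult_right_mono) auto
      ultimately have "t * norm (q \<tau>' - q \<tau>) \<le> t * (2 * ?\<delta> * \<bar>\<tau>' - \<tau>\<bar>)" by (simp add: algebra_simps)
      then show ?thesis using t(1) by simp
    qed
    let ?g = "\<lambda>\<tau>. orth_proj (?T (q \<tau>)) w"
    have "norm (?g 1 - ?g 0) \<le> 2 * ?\<delta> / t * norm w"
    proof (rule norm_diff_le_of_local)
      fix \<tau> :: real assume \<tau>: "\<tau> \<in> {0..1}"
      obtain \<eta> where \<eta>: "0 < \<eta>"
        "\<And>a u w. a \<in> M \<Longrightarrow> dist a (q \<tau>) < \<eta> \<Longrightarrow> u \<in> normal_space M (q \<tau>) \<Longrightarrow> w \<in> ?T a \<Longrightarrow>
          t * \<bar>u \<bullet> w\<bar> \<le> dist a (q \<tau>) * norm u * norm w"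
        "\<And>a u w. a \<in> M \<Longrightarrow> dist a (q \<tau>) < \<eta> \<Longrightarrow> u \<in> normal_space M a \<Longrightarrow> w \<in> ?T (q \<tau>) \<Longrightarrow>
          t * \<bar>u \<bullet> w\<bar> \<le> dist a (q \<tau>) * norm u * norm w"
        using tangent_variation_atE[OF tv[OF qM[of \<tau>]]] by metis
      show "\<exists>\<eta>>0. \<forall>\<tau>'\<in>{0..1}. \<bar>\<tau>' - \<tau>\<bar> < \<eta> \<longrightarrow> norm (?g \<tau>' - ?g \<tau>) \<le> 2 * ?\<delta> / t * norm w * \<bar>\<tau>' - \<tau>\<bar>"
      proof (intro exI conjI ballI impI)
        show "0 < \<eta> / (2 * ?\<delta> + 1)" using \<eta>(1) by (simp add: add_nonneg_pos)
        fix \<tau>' :: real assume \<tau>': "\<tau>' \<in> {0..1}" "\<bar>\<tau>' - \<tau>\<bar> < \<eta> / (2 * ?\<delta> + 1)"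
        let ?d = "dist (q \<tau>') (q \<tau>)"
        have d: "?d \<le> 2 * ?\<delta> * \<bar>\<tau>' - \<tau>\<bar>" using lip[OF \<tau> \<tau>'(1)] by (simp add: dist_norm)
        also have "\<dots> \<le> (2 * ?\<delta> + 1) * \<bar>\<tau>' - \<tau>\<bar>" by (intro mult_right_mono) auto
        also have "\<dots> < \<eta>"
          using \<tau>'(2) pos_less_divide_eq[of "2 * ?\<delta> + 1"] by (simp add: add_nonneg_pos mult.commute)
        finally have d\<eta>: "?d < \<eta>" .
        have "norm (?g \<tau>' - ?g \<tau>) \<le> (?d / t) * norm w"
        proof (rule orth_proj_variation[OF sub[OF qM] sub[OF qM]])
          show "0 \<le> ?d / t" using t(1) by simp
          show "\<bar>u \<bullet> v\<bar> \<le> ?d / t * norm u * norm v" if "u \<in> (?T (q \<tau>'))\<^sup>\<bottom>" "v \<in> ?T (q \<tau>)" for u v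
            using \<eta>(3)[OF qM d\<eta>, of u v] that t(1) by (simp add: normal_space_def field_simps)
          show "\<bar>u \<bullet> v\<bar> \<le> ?d / t * norm u * norm v" if "u \<in> (?T (q \<tau>))\<^sup>\<bottom>" "v \<in> ?T (q \<tau>')" for u v
            using \<eta>(2)[OF qM d\<eta>, of u v] that t(1) by (simp add: normal_space_def field_simps)
        qed
        also have "\<dots> \<le> (2 * ?\<delta> * \<bar>\<tau>' - \<tau>\<bar> / t) * norm w"
          using d t(1) by (intro mult_right_mono divide_right_mono) auto
        finally show "norm (?g \<tau>' - ?g \<tau>) \<le> 2 * ?\<delta> / t * norm w * \<bar>\<tau>' - \<tau>\<bar>" by (simp add: mult_ac)
      qed
    qed
    moreover have "q 0 = a" using closest_point_self[OF a] by (simp add: q_def)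
    moreover have "q 1 = closest_point M y" by (simp add: q_def)
    ultimately show ?thesis by simp
  qed
qed

lemma closest_point_curve_derivative:
  fixes M :: "'a::euclidean_space set" and f h :: "real \<Rightarrow> 'a"
  assumes M: "smooth_submanifold k M" "compact M" and t: "0 < t" "ereal t < reach M" and \<epsilon>: "\<epsilon> < t"
    and f: "\<And>x. f x \<in> M" "(f has_vector_derivative f') (at x0)"
    and h: "\<And>x. norm (f x - h x) \<le> \<epsilon>" "(h has_vector_derivative h') (at x0)"
  obtains u where "((closest_point M \<circ> h) has_vector_derivative u) (at x0)"
    "norm (u - f') \<le> norm (h' - f') + (2 / t + 1 / (t - \<epsilon>)) * norm (f x0 - h x0) * norm h'"
proof -
  \<comment> \<open>\<open>tangent_variation\<close> yields the speed \<open>1 / t\<close> only from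
    a ball condition with a radius larger than \<open>t\<close>.\<close>
  obtain t2 where t2: "ereal t < ereal t2" "ereal t2 < reach M" using t(2) ereal_dense2 by blast
  then have tt2: "t < t2" by simp
  have obM: "outside_tangent_balls M t" by (rule outside_tangent_balls_reach[OF M(2) t])
  have obM2: "outside_tangent_balls M t2"
    using t(1) tt2 by (intro outside_tangent_balls_reach[OF M(2) _ t2(2)]) auto
  have tv: "tangent_variation_at M t m" if "m \<in> M" for m
    by (rule tangent_variation[OF M(1) t(1) tt2 obM2 that])
  have M': "closed M" "M \<noteq> {}" using M(2) f(1) compact_imp_closed by auto
  define p where "p x = closest_point M (h x)" for x
  define \<delta> where "\<delta> = norm (f x0 - h x0)"
  have p: "p x \<in> M" "h x - p x \<in> normal_space M (p x)" for x
    using closest_point_exists(1)[OF M'] closest_point_normal[OF M'] by (auto simp: p_def)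
  have near: "norm (h x - p x) \<le> norm (f x - h x)" for x
    using closest_point_le[OF M'(1) f(1), of "h x" x] by (simp add: p_def dist_norm norm_minus_commute)
  have near\<epsilon>: "norm (h x - p x) \<le> \<epsilon>" for x using near[of x] h(1)[of x] by linarith
  have \<epsilon>0: "0 \<le> \<epsilon>" using h(1)[of x0] norm_ge_zero order_trans by blast
  have lip: "(t - \<epsilon>) * norm (p x - p y) \<le> t * norm (h x - h y)" for x y
    by (rule nearest_points_lipschitz[OF obM _ p(1) p(1) p(2) p(2) near\<epsilon> near\<epsilon>]) (use t(1) in simp)
  obtain K where K: "0 < K" "\<forall>\<^sub>F x in nhds x0. norm (h x - h x0) \<le> K * norm (x - x0)"
    using has_derivative_local_lipschitz[OF h(2)[unfolded has_vector_derivative_def]] .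
  have lip': "\<forall>\<^sub>F x in at x0. norm (p x - p x0) \<le> (t * K / (t - \<epsilon>)) * \<bar>x - x0\<bar>"
  proof -
    have "\<forall>\<^sub>F x in nhds x0. norm (p x - p x0) \<le> (t * K / (t - \<epsilon>)) * \<bar>x - x0\<bar>"
      using K(2)
    proof eventually_elim
      case (elim x)
      have "(t - \<epsilon>) * norm (p x - p x0) \<le> t * (K * \<bar>x - x0\<bar>)"
        using lip[of x x0] mult_left_mono[OF elim less_imp_le[OF t(1)]] unfolding real_norm_def by linarith
      then show ?case using \<epsilon> by (simp add: field_simps)
    qed
    then show ?thesis by (simp add: eventually_at_filter eventually_mono)
  qed
  obtain U V S \<phi> \<psi> where c: "submanifold_chart M U V S \<phi> \<psi>" "p x0 \<in> U"
    using smooth_submanifold_chart[OF M(1) p(1)] .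
  have "norm (h x0 - p x0) < t" using near\<epsilon>[of x0] \<epsilon> by simp
  then obtain u where u: "u \<in> tangent_space M (p x0)" "(p has_vector_derivative u) (at x0)"
    "\<forall>w\<in>tangent_space M (p x0). t * \<bar>(h' - u) \<bullet> w\<bar> \<le> norm (h x0 - p x0) * norm u * norm w"
    using submanifold_chart.nearest_point_curve_derivative[OF c(1) t(1) tv[OF p(1)] c(2) p lip' h(2)] by blast
  let ?\<Pi> = "orth_proj (tangent_space M (p x0))" and ?\<Pi>f = "orth_proj (tangent_space M (f x0))"
  have sub: "subspace (tangent_space M (p x0))" "subspace (tangent_space M (f x0))"
    using subspace_tangent_space[OF M(1)] p(1) f(1) by auto
  have f': "?\<Pi>f f' = f'"
    by (rule orth_proj_self[OF sub(2) velocity_in_tangent_space[OF M(1) f(2,1)]])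
  \<comment> \<open>Testing the inequality for \<open>u\<close> with
    \<open>w = ?\<Pi> h' - u\<close> gives \<open>t * norm w \<le> ?v * norm u\<close>, where
    \<open>norm u \<le> norm h' + norm w\<close>. Bounding \<open>?v\<close> by
    \<open>\<delta>\<close> in the first product and by \<open>\<epsilon>\<close> in the second lets
    the left side absorb the second, which produces
    \<open>\<delta> / (t - \<epsilon>)\<close>.\<close>
  have 1: "norm (u - ?\<Pi> h') \<le> \<delta> / (t - \<epsilon>) * norm h'"
  proof -
    define w where "w = ?\<Pi> h' - u"
    let ?v = "norm (h x0 - p x0)"
    have v: "?v \<le> \<delta>" "?v \<le> \<epsilon>" using near[of x0] near\<epsilon>[of x0] by (auto simp: \<delta>_def)
    have wT: "w \<in> tangent_space M (p x0)"
      using u(1) sub(1) orth_proj_in[OF sub(1)] by (simp add: w_def subspace_diff)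
    have "(h' - u) \<bullet> w = w \<bullet> w + (h' - ?\<Pi> h') \<bullet> w" by (simp add: w_def inner_diff_left)
    then have "(h' - u) \<bullet> w = (norm w)\<^sup>2"
      using orth_proj_orth[OF sub(1) wT, of h'] by (simp add: power2_norm_eq_inner)
    then have "(t * norm w) * norm w \<le> (?v * norm u) * norm w"
      using u(3) wT by (auto simp: power2_eq_square mult.assoc)
    then have a: "t * norm w \<le> ?v * norm u" by (cases "w = 0") auto
    have "norm u \<le> norm (?\<Pi> h') + norm w" using norm_triangle_ineq4[of "?\<Pi> h'" w] by (simp add: w_def)
    also have "\<dots> \<le> norm h' + norm w" using norm_orth_proj_le[OF sub(1)] by simp
    finally have "?v * norm u \<le> ?v * (norm h' + norm w)" by (intro mult_left_mono) auto
    also have "\<dots> \<le> \<delta> * norm h' + \<epsilon> * norm w"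
      unfolding distrib_left using v by (intro add_mono mult_right_mono) auto
    finally have "(t - \<epsilon>) * norm w \<le> \<delta> * norm h'" using a by (simp add: algebra_simps)
    then have "norm w \<le> \<delta> / (t - \<epsilon>) * norm h'" using \<epsilon> by (simp add: field_simps)
    then show ?thesis by (simp add: w_def norm_minus_commute)
  qed
  have 2: "norm (?\<Pi> h' - ?\<Pi>f h') \<le> 2 * \<delta> / t * norm h'"
    using orth_proj_tangent_closest_point[OF M t(1) obM tv f(1), of "h x0" h' x0]
    by (simp add: p_def \<delta>_def norm_minus_commute)
  have 3: "norm (?\<Pi>f h' - f') \<le> norm (h' - f')"
    using norm_orth_proj_le[OF sub(2), of "h' - f'"] orth_proj_diff[OF sub(2), of h' f'] f' by simp
  have "norm (u - f') \<le> norm (u - ?\<Pi> h') + norm (?\<Pi> h' - ?\<Pi>f h') + norm (?\<Pi>f h' - f')" by norm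
  also have "\<dots> \<le> \<delta> / (t - \<epsilon>) * norm h' + 2 * \<delta> / t * norm h' + norm (h' - f')"
    by (intro add_mono 1 2 3)
  also have "\<dots> = norm (h' - f') + (2 / t + 1 / (t - \<epsilon>)) * norm (f x0 - h x0) * norm h'"
    by (simp add: \<delta>_def algebra_simps)
  finally show ?thesis
    using that[of u] u(2) by (simp add: p_def[abs_def] comp_def)
qed

section \<open>Fourier series\<close>

lemma has_vector_derivative_cis:
  "((\<lambda>x. cis (c * x)) has_vector_derivative (of_real c * \<i>) * cis (c * x)) (at x within A)"
proof -
  have "((\<lambda>z. exp (\<i> * of_real c * z)) has_field_derivative (\<i> * of_real c) * exp (\<i> * of_real c * of_real x)) (at (of_real x))"
    by (auto intro!: derivative_eq_intros)
  from has_vector_derivative_real_field[OF this, of A] show ?thesis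
    by (simp add: cis_conv_exp mult_ac)
qed

lemma cis_2pi_int: "cis (2 * pi * of_int k) = 1"
  using cis_multiple_2pi[of "of_int k"] by simp

text \<open>Scalar coefficients written with \<open>cis\<close>. The components of
  \<open>fourier_coeff\<close> are of this form, so the analysis is done for complex-valued
  functions.\<close>

definition fcoeff :: "(real \<Rightarrow> complex) \<Rightarrow> int \<Rightarrow> complex" where
  "fcoeff g k = integral {0..1} (\<lambda>x. cis (- (2 * pi * of_int k * x)) * g x)"

definition fsum :: "nat \<Rightarrow> (real \<Rightarrow> complex) \<Rightarrow> real \<Rightarrow> complex" where
  "fsum n g x = (\<Sum>k = - int n..int n. cis (2 * pi * of_int k * x) * fcoeff g k)"

lemma fcoeff_has_integral:
  assumes "continuous_on {0..1} g"
  shows "((\<lambda>x. cis (- (2 * pi * of_int k * x)) * g x) has_integral fcoeff g k) {0..1}"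
  unfolding fcoeff_def
  by (intro integrable_integral integrable_continuous_interval continuous_intros assms)

lemma cis_has_integral:
  "((\<lambda>x. cis (2 * pi * of_int k * x)) has_integral (if k = 0 then 1 else 0)) {0..1}"
proof (cases "k = 0")
  case True
  then show ?thesis using has_integral_const_real[of "1::complex" 0 1] by simp
next
  case False
  let ?c = "2 * pi * of_int k :: real"
  have c: "of_real ?c * \<i> \<noteq> 0" using False by simp
  have "((\<lambda>x. cis (?c * x)) has_integral
      (cis (?c * 1) / (of_real ?c * \<i>) - cis (?c * 0) / (of_real ?c * \<i>))) {0..1}"
  proof (rule fundamental_theorem_of_calculus)
    fix x :: real
    have "((\<lambda>x. cis (?c * x) / (of_real ?c * \<i>)) has_vector_derivative
        ((of_real ?c * \<i>) * cis (?c * x)) / (of_real ?c * \<i>)) (at x within {0..1})"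
      by (rule has_vector_derivative_divide[OF has_vector_derivative_cis])
    then show "((\<lambda>x. cis (?c * x) / (of_real ?c * \<i>)) has_vector_derivative cis (?c * x)) (at x within {0..1})"
      using c by (simp only: nonzero_mult_div_cancel_left[OF c])
  qed simp
  then show ?thesis using False cis_2pi_int[of k] by simp
qed

text \<open>The integral of \<open>(cmod (g x - s x))\<^sup>2\<close> is nonnegative, where
  \<open>s\<close> is the partial sum over \<open>K\<close>; the integrals of
  \<open>g x * cnj (s x)\<close> and \<open>s x * cnj (s x)\<close> coincide.\<close>

lemma bessel:
  assumes g: "continuous_on {0..1} g" and K: "finite K"
  shows "(\<Sum>k\<in>K. (cmod (fcoeff g k))\<^sup>2) \<le> integral {0..1} (\<lambda>x. (cmod (g x))\<^sup>2)"
proof -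
  let ?c = "fcoeff g" and ?e = "\<lambda>k x. cis (2 * pi * of_int k * x)"
  define s where "s x = (\<Sum>k\<in>K. ?c k * ?e k x)" for x
  let ?B = "\<Sum>k\<in>K. (cmod (?c k))\<^sup>2"
  have 1: "((\<lambda>x. g x * cnj (s x)) has_integral of_real ?B) {0..1}"
  proof -
    have "((\<lambda>x. \<Sum>k\<in>K. cnj (?c k) * (cis (- (2 * pi * of_int k * x)) * g x)) has_integral
        (\<Sum>k\<in>K. cnj (?c k) * ?c k)) {0..1}"
      by (intro has_integral_sum K has_integral_mult_right fcoeff_has_integral g)
    moreover have "(\<lambda>x. \<Sum>k\<in>K. cnj (?c k) * (cis (- (2 * pi * of_int k * x)) * g x)) = (\<lambda>x. g x * cnj (s x))"
      by (simp add: s_def sum_distrib_left cis_cnj mult_ac)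
    moreover have "(\<Sum>k\<in>K. cnj (?c k) * ?c k) = of_real ?B"
      by (simp add: mult.commute flip: complex_norm_square)
    ultimately show ?thesis by simp
  qed
  have 2: "((\<lambda>x. s x * cnj (s x)) has_integral of_real ?B) {0..1}"
  proof -
    have "((\<lambda>x. \<Sum>k\<in>K. \<Sum>l\<in>K. (?c k * cnj (?c l)) * ?e (k - l) x) has_integral
        (\<Sum>k\<in>K. \<Sum>l\<in>K. (?c k * cnj (?c l)) * (if k - l = 0 then 1 else 0))) {0..1}"
      by (intro has_integral_sum K has_integral_mult_right cis_has_integral)
    moreover have "(\<lambda>x. \<Sum>k\<in>K. \<Sum>l\<in>K. (?c k * cnj (?c l)) * ?e (k - l) x) = (\<lambda>x. s x * cnj (s x))"
    proof
      fix x
      have "?e (k - l) x = ?e k x * cnj (?e l x)" for k l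
        by (simp add: cis_cnj cis_mult algebra_simps)
      then show "(\<Sum>k\<in>K. \<Sum>l\<in>K. (?c k * cnj (?c l)) * ?e (k - l) x) = s x * cnj (s x)"
        by (simp add: s_def sum_product mult_ac)
    qed
    moreover have "(\<Sum>k\<in>K. \<Sum>l\<in>K. (?c k * cnj (?c l)) * (if k - l = 0 then 1 else 0)) = of_real ?B"
    proof -
      have "(\<Sum>l\<in>K. (?c k * cnj (?c l)) * (if k - l = 0 then 1 else 0)) = ?c k * cnj (?c k)" if "k \<in> K" for k
      proof -
        have "(\<Sum>l\<in>K. (?c k * cnj (?c l)) * (if k - l = 0 then 1 else 0)) =
          (\<Sum>l\<in>K. if k = l then ?c k * cnj (?c l) else 0)" by (intro sum.cong) auto
        then show ?thesis using K that by simp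
      qed
      then show ?thesis by (simp flip: complex_norm_square)
    qed
    ultimately show ?thesis by simp
  qed
  have g2: "((\<lambda>x. (cmod (g x))\<^sup>2) has_integral integral {0..1} (\<lambda>x. (cmod (g x))\<^sup>2)) {0..1}"
    by (intro integrable_integral integrable_continuous_interval continuous_intros g)
  have "((\<lambda>x. (cmod (g x))\<^sup>2 - 2 * Re (g x * cnj (s x)) + Re (s x * cnj (s x))) has_integral
      integral {0..1} (\<lambda>x. (cmod (g x))\<^sup>2) - 2 * Re (of_real ?B) + Re (of_real ?B)) {0..1}"
    by (intro has_integral_add has_integral_diff g2 has_integral_mult_right has_integral_Re 1 2)
  moreover have "(cmod (g x))\<^sup>2 - 2 * Re (g x * cnj (s x)) + Re (s x * cnj (s x)) \<ge> 0" for x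
  proof -
    have "(cmod (g x))\<^sup>2 - 2 * Re (g x * cnj (s x)) + Re (s x * cnj (s x)) = (cmod (g x - s x))\<^sup>2"
      unfolding cmod_power2 by (simp add: power2_eq_square algebra_simps)
    then show ?thesis by simp
  qed
  ultimately have "0 \<le> integral {0..1} (\<lambda>x. (cmod (g x))\<^sup>2) - 2 * Re (of_real ?B) + Re (of_real ?B)"
    by (rule has_integral_nonneg)
  then show ?thesis by simp
qed

text \<open>Riemann-Lebesgue as a consequence of Bessel. Arbitrary injective index sequences cover
  both ends of the integers, where the telescoped partial sums end.\<close>

lemma fcoeff_tendsto_0:
  assumes g: "continuous_on {0..1} g" and inj: "inj (i :: nat \<Rightarrow> int)"
  shows "(\<lambda>n. fcoeff g (i n)) \<longlonglongrightarrow> 0"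
proof -
  have "summable (\<lambda>n. (cmod (fcoeff g (i n)))\<^sup>2)"
  proof (rule summableI_nonneg_bounded)
    fix n
    have "(\<Sum>m<n. (cmod (fcoeff g (i m)))\<^sup>2) = (\<Sum>k\<in>i ` {..<n}. (cmod (fcoeff g k))\<^sup>2)"
      by (subst sum.reindex) (use inj in \<open>auto intro: inj_on_subset\<close>)
    also have "\<dots> \<le> integral {0..1} (\<lambda>x. (cmod (g x))\<^sup>2)" by (intro bessel g) simp
    finally show "(\<Sum>m<n. (cmod (fcoeff g (i m)))\<^sup>2) \<le> integral {0..1} (\<lambda>x. (cmod (g x))\<^sup>2)" .
  qed simp
  then have "(\<lambda>n. (cmod (fcoeff g (i n)))\<^sup>2) \<longlonglongrightarrow> 0" by (rule summable_LIMSEQ_zero)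
  then have "(\<lambda>n. sqrt ((cmod (fcoeff g (i n)))\<^sup>2)) \<longlonglongrightarrow> sqrt 0" by (intro tendsto_intros)
  then show ?thesis by (simp add: tendsto_norm_zero_iff)
qed

lemma periodic_int:
  fixes g :: "real \<Rightarrow> 'a"
  assumes "\<And>x. g (x + 1) = g x"
  shows "g (x + of_int k) = g x"
proof (induction k rule: int_induct[where k = 0])
  case (step1 i)
  then show ?case using assms[of "x + of_int i"] by (simp add: add.assoc)
next
  case (step2 i)
  then show ?case using assms[of "x + of_int (i - 1)"] by simp
qed simp

lemma cis_eq_1_imp_int:
  assumes "cis (2 * pi * x) = 1"
  obtains k :: int where "x = of_int k"
proof -
  have "cos (2 * pi * x) = 1" using assms by (metis cis.simps(1) one_complex.simps(1))
  then obtain k :: int where "2 * pi * x = of_int k * 2 * pi" using cos_one_2pi_int by blast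
  then have "x = of_int k" by simp
  then show ?thesis by (rule that)
qed

text \<open>Chernoff's argument: \<open>g t - g y = (cis (2 * pi * (t - y)) - 1) * G t\<close> with a continuous function
  \<open>G\<close>, so the partial sums at \<open>y\<close> telescope into two Fourier coefficients of \<open>G\<close>.\<close>

lemma fsum_tendsto:
  fixes g g' :: "real \<Rightarrow> complex"
  assumes g: "\<And>x. (g has_vector_derivative g' x) (at x)" and per: "\<And>x. g (x + 1) = g x"
  shows "(\<lambda>n. fsum n g y) \<longlonglongrightarrow> g y"
proof -
  let ?e = "\<lambda>t. cis (2 * pi * (t - y))"
  \<comment> \<open>At the removable singularities \<open>G\<close> is the limit of the quotient, as
    the denominator has derivative \<open>2 * pi * \<i>\<close> there. They are the points at
    integer distance from \<open>y\<close>, and the numerator vanishes at all of them by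
    periodicity.\<close>
  define G where "G t = (if ?e t = 1 then g' t / (of_real (2 * pi) * \<i>) else (g t - g y) / (?e t - 1))" for t
  have gcont: "isCont g x" for x using g has_vector_derivative_continuous by blast
  have "continuous_on UNIV ?e" by (intro continuous_intros)
  then have e_cont: "isCont ?e t" for t by (simp add: continuous_on_eq_continuous_at)
  have gy: "g t = g y" if t: "?e t = 1" for t
  proof -
    obtain k :: int where "t - y = of_int k" using cis_eq_1_imp_int[OF t] .
    then have "t = y + of_int k" by simp
    then show ?thesis using periodic_int[of g y k] per by simp
  qed
  have G: "g t = g y + (?e t - 1) * G t" for t
    using gy[of t] by (simp add: G_def)
  have "isCont G t" for t
  proof (cases "?e t = 1")
    case False
    have "\<forall>\<^sub>F s in nhds t. ?e s \<noteq> 1"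
      using tendsto_imp_eventually_ne[of ?e "?e t" "nhds t" 1] e_cont[of t] False
      by (simp add: continuous_within tendsto_nhds_iff)
    then have "\<forall>\<^sub>F s in nhds t. G s = (g s - g y) / (?e s - 1)"
      by eventually_elim (simp add: G_def)
    moreover have "isCont (\<lambda>s. (g s - g y) / (?e s - 1)) t"
      using False by (intro continuous_intros gcont e_cont) simp
    ultimately show ?thesis by (rule isCont_cong[THEN iffD2])
  next
    case True
    let ?w = "of_real (2 * pi) * \<i>"
    have "((\<lambda>s. cis (2 * pi * s) * cis (- (2 * pi * y))) has_vector_derivative
        ((?w * cis (2 * pi * t)) * cis (- (2 * pi * y)))) (at t)"
      by (intro has_vector_derivative_mult_left has_vector_derivative_cis)
    then have "(?e has_vector_derivative ?w * ?e t) (at t)"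
      by (simp add: cis_mult algebra_simps)
    then have e': "((\<lambda>s. (?e s - 1) /\<^sub>R (s - t)) \<longlongrightarrow> ?w) (at t)"
      unfolding has_vector_derivative_at_iff_tendsto True by simp
    have e_ne: "\<forall>\<^sub>F s in at t. (?e s - 1) /\<^sub>R (s - t) \<noteq> 0"
      by (rule tendsto_imp_eventually_ne[OF e']) simp
    have g'': "((\<lambda>s. (g s - g y) /\<^sub>R (s - t)) \<longlongrightarrow> g' t) (at t)"
      using g[of t] gy[OF True] unfolding has_vector_derivative_at_iff_tendsto by simp
    have "((\<lambda>s. ((g s - g y) /\<^sub>R (s - t)) / ((?e s - 1) /\<^sub>R (s - t))) \<longlongrightarrow> g' t / ?w) (at t)"
      by (intro tendsto_divide g'' e') simp
    moreover have "\<forall>\<^sub>F s in at t. ((g s - g y) /\<^sub>R (s - t)) / ((?e s - 1) /\<^sub>R (s - t)) = G s"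
      using e_ne eventually_neq_at_within[of t t UNIV]
    proof eventually_elim
      case (elim s)
      then show ?case by (simp add: G_def scaleR_conv_of_real)
    qed
    ultimately have "(G \<longlongrightarrow> g' t / ?w) (at t)" by (rule Lim_transform_eventually)
    then show ?thesis using True by (simp add: isCont_def G_def)
  qed
  then have Gc: "continuous_on {0..1} G" by (simp add: continuous_at_imp_continuous_on)
  define a where "a k = cis (2 * pi * of_int k * y) * fcoeff G k" for k
  \<comment> \<open>Multiplication by \<open>?e\<close> shifts the frequency by one, hence
    \<open>a (k - 1)\<close>; the constant \<open>g y\<close> contributes at frequency 0
    only.\<close>
  have coeff: "cis (2 * pi * of_int k * y) * fcoeff g k = (if k = 0 then g y else 0) + a (k - 1) - a k" for k
  proof -
    have "((\<lambda>x. g y * cis (2 * pi * of_int (- k) * x) + cis (- (2 * pi * y)) * (cis (- (2 * pi * of_int (k - 1) * x)) * G x)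
        - cis (- (2 * pi * of_int k * x)) * G x) has_integral
        g y * (if - k = 0 then 1 else 0) + cis (- (2 * pi * y)) * fcoeff G (k - 1) - fcoeff G k) {0..1}"
      by (intro has_integral_add has_integral_diff has_integral_mult_right cis_has_integral fcoeff_has_integral Gc)
    moreover have "g y * cis (2 * pi * of_int (- k) * x) + cis (- (2 * pi * y)) * (cis (- (2 * pi * of_int (k - 1) * x)) * G x)
        - cis (- (2 * pi * of_int k * x)) * G x = cis (- (2 * pi * of_int k * x)) * g x" for x
    proof -
      have "cis (- (2 * pi * y)) * cis (- (2 * pi * of_int (k - 1) * x)) = cis (- (2 * pi * of_int k * x)) * ?e x"
        by (simp add: cis_mult algebra_simps)
      then show ?thesis by (subst (2) G) (simp add: algebra_simps)
    qed
    ultimately have fc: "fcoeff g k = g y * (if - k = 0 then 1 else 0) + cis (- (2 * pi * y)) * fcoeff G (k - 1) - fcoeff G k"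
      unfolding fcoeff_def by (simp add: integral_unique)
    have shift: "cis (2 * pi * of_int k * y) * cis (- (2 * pi * y)) = cis (2 * pi * of_int (k - 1) * y)"
      by (simp add: cis_mult algebra_simps)
    have "cis (2 * pi * of_int k * y) * fcoeff g k =
        cis (2 * pi * of_int k * y) * (g y * (if - k = 0 then 1 else 0)) +
        (cis (2 * pi * of_int k * y) * cis (- (2 * pi * y))) * fcoeff G (k - 1) -
        cis (2 * pi * of_int k * y) * fcoeff G k"
      unfolding fc by (simp only: distrib_left right_diff_distrib mult.assoc)
    then show ?thesis unfolding shift a_def by (cases "k = 0") simp_all
  qed
  define b where "b k = cis (2 * pi * of_int k * y) * fcoeff g k" for k
  have tele: "fsum n g y = g y + a (- int n - 1) - a (int n)" for n
  proof (induction n)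
    case 0
    then show ?case using coeff[of 0] by (simp add: fsum_def)
  next
    case (Suc n)
    have "{- int (Suc n)..int (Suc n)} = insert (- int n - 1) (insert (int n + 1) {- int n..int n})" by auto
    then have "fsum (Suc n) g y = b (- int n - 1) + (b (int n + 1) + fsum n g y)"
      unfolding fsum_def b_def[symmetric] by simp
    also have "b (- int n - 1) = a (- int (Suc n) - 1) - a (- int n - 1)"
      using coeff[of "- int n - 1"] by (simp add: b_def algebra_simps)
    also have "b (int n + 1) = a (int n) - a (int (Suc n))"
      using coeff[of "int n + 1"] by (simp add: b_def algebra_simps)
    finally show ?case using Suc by simp
  qed
  have a0: "(\<lambda>n. a (i n)) \<longlonglongrightarrow> 0" if "inj (i :: nat \<Rightarrow> int)" for i
  proof -
    have "(\<lambda>n. cmod (a (i n))) \<longlonglongrightarrow> 0"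
      using tendsto_norm_zero[OF fcoeff_tendsto_0[OF Gc that]] by (simp add: a_def norm_mult)
    then show ?thesis by (simp add: tendsto_norm_zero_iff)
  qed
  have "(\<lambda>n. g y + a (- int n - 1) - a (int n)) \<longlonglongrightarrow> g y + 0 - 0"
    by (intro tendsto_intros a0) (auto simp: inj_def)
  then show ?thesis by (simp add: tele)
qed

section \<open>Coefficients of derivatives and tails of the Fourier series\<close>

lemma fcoeff_derivative:
  fixes g g' :: "real \<Rightarrow> complex"
  assumes g: "\<And>x. (g has_vector_derivative g' x) (at x)" and "continuous_on UNIV g'" and per: "\<And>x. g (x + 1) = g x"
  shows "fcoeff g' k = of_real (2 * pi * of_int k) * \<i> * fcoeff g k"
proof -
  let ?c = "2 * pi * of_int k :: real"
  have "isCont g x" for x using has_vector_derivative_continuous[OF g] .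
  then have gc: "continuous_on {0..1} g" "continuous_on {0..1} g'"
    using continuous_on_subset[OF assms(2)] by (auto simp: continuous_at_imp_continuous_on)
  have "((\<lambda>x. cis (- ?c * x) * g' x + of_real (- ?c) * \<i> * cis (- ?c * x) * g x) has_integral
      cis (- ?c * 1) * g 1 - cis (- ?c * 0) * g 0) {0..1}"
    by (rule fundamental_theorem_of_calculus[OF zero_le_one])
      (rule has_vector_derivative_mult[OF has_vector_derivative_cis has_vector_derivative_at_within[OF g]])
  moreover have "cis (- ?c * 1) * g 1 - cis (- ?c * 0) * g 0 = 0"
    using per[of 0] cis_2pi_int[of "- k"] by simp
  ultimately have "((\<lambda>x. cis (- (?c * x)) * g' x + (of_real (- ?c) * \<i>) * (cis (- (?c * x)) * g x)) has_integral 0) {0..1}"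
    by (simp add: mult.assoc)
  moreover have "((\<lambda>x. cis (- (?c * x)) * g' x + (of_real (- ?c) * \<i>) * (cis (- (?c * x)) * g x)) has_integral
      fcoeff g' k + (of_real (- ?c) * \<i>) * fcoeff g k) {0..1}"
    by (intro has_integral_add has_integral_mult_right fcoeff_has_integral gc)
  ultimately have "fcoeff g' k + (of_real (- ?c) * \<i>) * fcoeff g k = 0"
    using has_integral_unique by blast
  then show ?thesis by (simp add: algebra_simps)
qed

text \<open>Keeps a function together with its derivatives \<open>F 0\<close> to \<open>F q\<close>.
  Passing to the derivative is an index shift that retains the top derivative, so that bounds for
  \<open>f\<close> and for \<open>f'\<close> refer to the same norm.\<close>

definition periodic_derivs :: "(nat \<Rightarrow> real \<Rightarrow> 'a::real_normed_vector) \<Rightarrow> nat \<Rightarrow> bool" where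
  "periodic_derivs F q \<longleftrightarrow> (\<forall>i<q. \<forall>x. (F i has_vector_derivative F (Suc i) x) (at x)) \<and>
     continuous_on UNIV (F q) \<and> (\<forall>i\<le>q. \<forall>x. F i (x + 1) = F i x)"

lemma periodic_derivs_shift: "periodic_derivs F (Suc q) \<Longrightarrow> periodic_derivs (\<lambda>i. F (Suc i)) q"
  by (simp add: periodic_derivs_def)

lemma periodic_derivs_continuous:
  assumes "periodic_derivs F q" "i \<le> q" shows "continuous_on A (F i)"
proof (cases "i = q")
  case True
  then show ?thesis using assms(1) continuous_on_subset by (auto simp: periodic_derivs_def)
next
  case False
  then have "isCont (F i) x" for x
    using assms has_vector_derivative_continuous[of "F i" "F (Suc i) x" x UNIV]
    by (simp add: periodic_derivs_def)
  then show ?thesis by (simp add: continuous_at_imp_continuous_on)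
qed

lemma cmod_fcoeff_deriv:
  assumes "periodic_derivs G q"
  shows "cmod (fcoeff (G q) k) = (2 * pi * \<bar>of_int k\<bar>) ^ q * cmod (fcoeff (G 0) k)"
  using assms
proof (induction q arbitrary: G)
  case (Suc q)
  have "cmod (fcoeff (G (Suc q)) k) = (2 * pi * \<bar>of_int k\<bar>) ^ q * cmod (fcoeff (G 1) k)"
    using Suc.IH[OF periodic_derivs_shift[OF Suc.prems]] by simp
  moreover have "fcoeff (G 1) k = of_real (2 * pi * of_int k) * \<i> * fcoeff (G 0) k"
    using Suc.prems periodic_derivs_continuous[OF Suc.prems, of 1]
    by (intro fcoeff_derivative) (auto simp: periodic_derivs_def)
  then have "cmod (fcoeff (G 1) k) = (2 * pi * \<bar>of_int k\<bar>) * cmod (fcoeff (G 0) k)"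
    by (simp add: norm_mult abs_mult)
  ultimately show ?case by simp
qed simp

text \<open>Cauchy-Schwarz with the weights \<open>1 / \<bar>of_int k\<bar> ^ q\<close> from
  \<open>cmod_fcoeff_deriv\<close>, and Bessel for the top derivative. Frequency 0 is excluded
  because differentiation annihilates it.\<close>

lemma sum_cmod_fcoeff_le:
  assumes G: "periodic_derivs G q" and K: "finite K" "0 \<notin> K"
  shows "(\<Sum>k\<in>K. cmod (fcoeff (G 0) k)) \<le>
    sqrt (\<Sum>k\<in>K. 1 / \<bar>of_int k\<bar> ^ (2 * q)) / (2 * pi) ^ q * sqrt (integral {0..1} (\<lambda>x. (cmod (G q x))\<^sup>2))"
proof -
  let ?a = "\<lambda>k::int. 1 / \<bar>of_int k\<bar> ^ q :: real" and ?b = "\<lambda>k. cmod (fcoeff (G q) k)"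
  have eq: "cmod (fcoeff (G 0) k) = ?a k * ?b k / (2 * pi) ^ q" if "k \<in> K" for k
    using cmod_fcoeff_deriv[OF G, of k] that K(2) by (auto simp: power_mult_distrib)
  have "(\<Sum>k\<in>K. ?a k * ?b k)\<^sup>2 \<le> (\<Sum>k\<in>K. (?a k)\<^sup>2) * (\<Sum>k\<in>K. (?b k)\<^sup>2)" by (rule Cauchy_Schwarz_ineq_sum)
  also have "\<dots> \<le> (\<Sum>k\<in>K. (?a k)\<^sup>2) * integral {0..1} (\<lambda>x. (cmod (G q x))\<^sup>2)"
    by (intro mult_left_mono bessel periodic_derivs_continuous[OF G] K sum_nonneg) auto
  finally have "(\<Sum>k\<in>K. ?a k * ?b k) \<le> sqrt ((\<Sum>k\<in>K. (?a k)\<^sup>2) * integral {0..1} (\<lambda>x. (cmod (G q x))\<^sup>2))"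
    by (rule real_le_rsqrt)
  also have "(\<Sum>k\<in>K. (?a k)\<^sup>2) = (\<Sum>k\<in>K. 1 / \<bar>of_int k\<bar> ^ (2 * q))"
    by (simp add: power_divide flip: power_mult) (simp add: mult.commute)
  finally have "(\<Sum>k\<in>K. ?a k * ?b k) / (2 * pi) ^ q \<le>
      sqrt ((\<Sum>k\<in>K. 1 / \<bar>of_int k\<bar> ^ (2 * q)) * integral {0..1} (\<lambda>x. (cmod (G q x))\<^sup>2)) / (2 * pi) ^ q"
    by (rule divide_right_mono) simp
  moreover have "(\<Sum>k\<in>K. cmod (fcoeff (G 0) k)) = (\<Sum>k\<in>K. ?a k * ?b k) / (2 * pi) ^ q"
    unfolding sum_divide_distrib by (rule sum.cong[OF refl eq])
  ultimately show ?thesis by (simp add: real_sqrt_mult)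
qed

text \<open>Each term is at most \<open>1 / (k - 1) - 1 / k\<close>, and these bounds
  telescope.\<close>

lemma sum_inverse_squares_le:
  assumes "1 \<le> n" "n \<le> N"
  shows "(\<Sum>k\<in>{n<..N}. 1 / (real k)\<^sup>2) \<le> 1 / real n - 1 / real N"
  using assms(2)
proof (induction N rule: dec_induct)
  case (step N)
  have "{n<..Suc N} = insert (Suc N) {n<..N}" using step(1) by auto
  moreover have "1 / (real (Suc N))\<^sup>2 \<le> 1 / real N - 1 / real (Suc N)"
  proof -
    have "1 / (real (Suc N))\<^sup>2 \<le> 1 / (real N * real (Suc N))"
      using step(1) assms(1) by (intro divide_left_mono) (auto simp: power2_eq_square)
    also have "\<dots> = 1 / real N - 1 / real (Suc N)" using step(1) assms(1) by (simp add: field_simps)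
    finally show ?thesis .
  qed
  ultimately show ?case using step by simp
qed simp

text \<open>Extracting \<open>1 / real n ^ (2 * q - 2)\<close> leaves a sum of inverse squares, at
  most \<open>1 / real n\<close>. The positive and the negative frequencies together give the factor
  2.\<close>

lemma sum_inverse_even_powers_le:
  assumes "1 \<le> n" "1 \<le> q"
  shows "(\<Sum>k\<in>{- int N..int N} - {- int n..int n}. 1 / \<bar>of_int k\<bar> ^ (2 * q)) \<le> 2 / real n ^ (2 * q - 1)"
proof (cases "n \<le> N")
  case False
  then have "{- int N..int N} - {- int n..int n} = {}" by auto
  then show ?thesis by (metis divide_nonneg_nonneg of_nat_0_le_iff sum.empty zero_le_numeral zero_le_power)
next
  case True
  let ?f = "\<lambda>k::int. 1 / \<bar>of_int k\<bar> ^ (2 * q) :: real"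
  have split: "{- int N..int N} - {- int n..int n} = int ` {n<..N} \<union> (\<lambda>k. - int k) ` {n<..N}"
  proof (intro equalityI subsetI)
    fix k assume "k \<in> {- int N..int N} - {- int n..int n}"
    then have "nat \<bar>k\<bar> \<in> {n<..N}" "k = int (nat \<bar>k\<bar>) \<or> k = - int (nat \<bar>k\<bar>)" by auto
    then show "k \<in> int ` {n<..N} \<union> (\<lambda>k. - int k) ` {n<..N}" by blast
  qed auto
  have "sum ?f ({- int N..int N} - {- int n..int n}) = sum ?f (int ` {n<..N}) + sum ?f ((\<lambda>k. - int k) ` {n<..N})"
    unfolding split using assms(1) by (intro sum.union_disjoint) auto
  also have "\<dots> = 2 * (\<Sum>k\<in>{n<..N}. 1 / real k ^ (2 * q))"
    by (simp add: sum.reindex inj_on_def)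
  also have "(\<Sum>k\<in>{n<..N}. 1 / real k ^ (2 * q)) \<le> (\<Sum>k\<in>{n<..N}. 1 / real n ^ (2 * q - 2) * (1 / (real k)\<^sup>2))"
  proof (rule sum_mono)
    fix k assume k: "k \<in> {n<..N}"
    have "2 * q = (2 * q - 2) + 2" using assms(2) by simp
    then have "real k ^ (2 * q) = real k ^ (2 * q - 2) * (real k)\<^sup>2" by (metis power_add)
    moreover have "real n ^ (2 * q - 2) \<le> real k ^ (2 * q - 2)" using k by (intro power_mono) auto
    ultimately show "1 / real k ^ (2 * q) \<le> 1 / real n ^ (2 * q - 2) * (1 / (real k)\<^sup>2)"
      using k assms(1) by (simp add: frac_le mult_right_mono)
  qed
  also have "\<dots> \<le> 1 / real n ^ (2 * q - 2) * (1 / real n)"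
    unfolding sum_distrib_left[symmetric]
    using sum_inverse_squares_le[OF assms(1) True] by (intro mult_left_mono) (auto intro: order_trans)
  also have "\<dots> = 1 / real n ^ (2 * q - 1)"
  proof -
    have "2 * q - 1 = Suc (2 * q - 2)" using assms(2) by simp
    then show ?thesis by (simp add: mult.commute)
  qed
  finally show ?thesis by simp
qed

text \<open>The coefficient estimate handles finite blocks only. Its bound is uniform in
  \<open>N\<close>, and pointwise convergence of \<open>fsum N\<close> carries it over to the
  error.\<close>

lemma fsum_error:
  assumes G: "periodic_derivs G q" and "1 \<le> q" "1 \<le> n"
  shows "cmod (G 0 x - fsum n (G 0) x) \<le>
    sqrt (2 / real n ^ (2 * q - 1)) / (2 * pi) ^ q * sqrt (integral {0..1} (\<lambda>x. (cmod (G q x))\<^sup>2))" (is "_ \<le> ?R")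
proof -
  have lim: "(\<lambda>N. fsum N (G 0) x) \<longlonglongrightarrow> G 0 x"
    using assms(1,2) by (intro fsum_tendsto) (auto simp: periodic_derivs_def)
  have "(\<lambda>N. cmod (fsum N (G 0) x - fsum n (G 0) x)) \<longlonglongrightarrow> cmod (G 0 x - fsum n (G 0) x)"
    by (intro tendsto_intros lim)
  moreover have "\<exists>N0. \<forall>N\<ge>N0. cmod (fsum N (G 0) x - fsum n (G 0) x) \<le> ?R"
  proof (intro exI allI impI)
    fix N assume "n \<le> N"
    let ?K = "{- int N..int N} - {- int n..int n}"
    have "fsum N (G 0) x - fsum n (G 0) x = (\<Sum>k\<in>?K. cis (2 * pi * of_int k * x) * fcoeff (G 0) k)"
      unfolding fsum_def using \<open>n \<le> N\<close> by (subst sum_diff) auto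
    also have "cmod \<dots> \<le> (\<Sum>k\<in>?K. cmod (fcoeff (G 0) k))"
      by (rule sum_norm_le) (simp add: norm_mult)
    also have "\<dots> \<le> sqrt (\<Sum>k\<in>?K. 1 / \<bar>of_int k\<bar> ^ (2 * q)) / (2 * pi) ^ q * sqrt (integral {0..1} (\<lambda>x. (cmod (G q x))\<^sup>2))"
      by (rule sum_cmod_fcoeff_le[OF G]) auto
    also have "\<dots> \<le> ?R"
      using sum_inverse_even_powers_le[OF assms(3,2), of N]
      by (intro mult_right_mono divide_right_mono real_sqrt_le_mono) (auto intro!: integral_nonneg integrable_continuous_interval continuous_intros periodic_derivs_continuous[OF G])
    finally show "cmod (fsum N (G 0) x - fsum n (G 0) x) \<le> ?R" .
  qed
  ultimately show ?thesis by (rule LIMSEQ_le_const2)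
qed

text \<open>Coefficient 0 of \<open>G 1\<close> vanishes. Over the nonzero frequencies the weights
  sum to at most 4, namely 2 from the frequencies 1 and -1 and at most 2 from the tails beyond them;
  the root of 4 is below \<open>(2 * pi) ^ q\<close>. Hence the bound is independent of
  \<open>n\<close>.\<close>

lemma fsum_derivative_bound:
  assumes G: "periodic_derivs G (Suc q)" and "1 \<le> q"
  shows "cmod (fsum n (G 1) x) \<le> sqrt (integral {0..1} (\<lambda>x. (cmod (G (Suc q) x))\<^sup>2))" (is "_ \<le> ?R")
proof -
  let ?K = "{- int n..int n} - {0}"
  have "fcoeff (G 1) 0 = 0"
    using G periodic_derivs_continuous[OF G, of 1] fcoeff_derivative[of "G 0" "G 1" 0]
    by (auto simp: periodic_derivs_def)
  then have "fsum n (G 1) x = (\<Sum>k\<in>?K. cis (2 * pi * of_int k * x) * fcoeff (G 1) k)"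
    unfolding fsum_def by (intro sum.mono_neutral_right) auto
  also have "cmod \<dots> \<le> (\<Sum>k\<in>?K. cmod (fcoeff (G 1) k))"
    by (rule sum_norm_le) (simp add: norm_mult)
  also have "\<dots> \<le> sqrt (\<Sum>k\<in>?K. 1 / \<bar>of_int k\<bar> ^ (2 * q)) / (2 * pi) ^ q * ?R"
    using sum_cmod_fcoeff_le[OF periodic_derivs_shift[OF G], of ?K] by simp
  also have "\<dots> \<le> 1 * ?R"
  proof (intro mult_right_mono)
    have "(\<Sum>k\<in>?K. 1 / \<bar>of_int k\<bar> ^ (2 * q)) \<le> (\<Sum>k\<in>{-1, 1} \<union> ({- int n..int n} - {- int 1..int 1}). 1 / \<bar>of_int k\<bar> ^ (2 * q) :: real)"
      by (intro sum_mono2) auto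
    also have "\<dots> = (\<Sum>k\<in>{-1, 1}. 1 / \<bar>of_int k\<bar> ^ (2 * q)) + (\<Sum>k\<in>{- int n..int n} - {- int 1..int 1}. 1 / \<bar>of_int k\<bar> ^ (2 * q) :: real)"
      by (intro sum.union_disjoint) auto
    also have "\<dots> \<le> 2 + 2" using sum_inverse_even_powers_le[of 1 q n] assms(2) by (intro add_mono) auto
    finally have "sqrt (\<Sum>k\<in>?K. 1 / \<bar>of_int k\<bar> ^ (2 * q) :: real) \<le> sqrt 4" by (intro real_sqrt_le_mono) simp
    also have "\<dots> \<le> (2 * pi) ^ 1" using pi_ge_two by simp
    also have "\<dots> \<le> (2 * pi) ^ q" using pi_ge_two assms(2) by (intro power_increasing) auto
    finally show "sqrt (\<Sum>k\<in>?K. 1 / \<bar>of_int k\<bar> ^ (2 * q)) / (2 * pi) ^ q \<le> 1" by simp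
  qed (auto intro!: integral_nonneg integrable_continuous_interval continuous_intros periodic_derivs_continuous[OF G])
  finally show ?thesis by simp
qed

section \<open>Vector-valued Fourier sums by components\<close>

lemma fourier_sum_nth:
  assumes "continuous_on UNIV f"
  shows "complex_of_real (fourier_sum n f t $ j) = fsum n (\<lambda>x. of_real (f x $ j)) t"
proof -
  have e: "exp (2 * pi * \<i> * of_int k * of_real x) = cis (2 * pi * of_int k * x)"
    and e': "exp (- 2 * pi * \<i> * of_int k * of_real x) = cis (- (2 * pi * of_int k * x))" for k x
    by (simp_all add: cis_conv_exp mult_ac)
  have "complex_of_real (fourier_sum n f t $ j) = complex_fourier_sum n f t $ j"
    using complex_vec_fourier_sum[OF assms, of n t] by (simp add: complex_vec_def vec_eq_iff)
  also have "\<dots> = fsum n (\<lambda>x. of_real (f x $ j)) t"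
    unfolding complex_fourier_sum_def fsum_def fcoeff_def
    by (simp only: sum_component vector_smult_component fourier_coeff_nth[OF assms] e e')
  finally show ?thesis .
qed

lemma periodic_derivs_nth:
  fixes F :: "nat \<Rightarrow> real \<Rightarrow> real ^ 'd"
  assumes "periodic_derivs F q"
  shows "periodic_derivs (\<lambda>i x. complex_of_real (F i x $ j)) q"
  using assms unfolding periodic_derivs_def
  by (auto intro!: continuous_intros bounded_linear.has_vector_derivative
      [OF bounded_linear_compose[OF bounded_linear_of_real bounded_linear_vec_nth]])

text \<open>The same \<open>\<kappa>\<close> works for every component; summing squares rebuilds
  both norms without a dimensional factor.\<close>

lemma norm_le_L2_torus_norm:
  fixes g :: "real \<Rightarrow> real ^ 'd"
  assumes g: "continuous_on {0..1} g" and "0 \<le> \<kappa>"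
    and v: "\<And>j. \<bar>v $ j\<bar> \<le> \<kappa> * sqrt (integral {0..1} (\<lambda>x. (g x $ j)\<^sup>2))"
  shows "norm v \<le> \<kappa> * L2_torus_norm g"
proof -
  have norm2: "(norm u)\<^sup>2 = (\<Sum>j\<in>UNIV. (u $ j)\<^sup>2)" for u :: "real ^ 'd"
    unfolding power2_norm_eq_inner inner_vec_def by (simp add: power2_eq_square)
  have int: "(\<lambda>x. (g x $ j)\<^sup>2) integrable_on {0..1}" for j
    by (intro integrable_continuous_interval continuous_intros g)
  have nonneg: "0 \<le> integral {0..1} (\<lambda>x. (g x $ j)\<^sup>2)" for j
    by (intro integral_nonneg int) simp
  have "(norm v)\<^sup>2 \<le> (\<Sum>j\<in>UNIV. \<kappa>\<^sup>2 * integral {0..1} (\<lambda>x. (g x $ j)\<^sup>2))"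
    unfolding norm2
  proof (rule sum_mono)
    fix j
    have "(v $ j)\<^sup>2 \<le> (\<kappa> * sqrt (integral {0..1} (\<lambda>x. (g x $ j)\<^sup>2)))\<^sup>2"
      using power_mono[OF v[of j] abs_ge_zero, of 2] by simp
    then show "(v $ j)\<^sup>2 \<le> \<kappa>\<^sup>2 * integral {0..1} (\<lambda>x. (g x $ j)\<^sup>2)"
      using nonneg by (simp add: power_mult_distrib)
  qed
  also have "\<dots> = \<kappa>\<^sup>2 * integral {0..1} (\<lambda>x. (norm (g x))\<^sup>2)"
    unfolding norm2 by (simp add: integral_sum int flip: sum_distrib_left)
  also have "\<dots> = (\<kappa> * L2_torus_norm g)\<^sup>2"
    using nonneg unfolding L2_torus_norm_def power_mult_distrib norm2
    by (simp add: integral_sum int sum_nonneg)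
  finally show ?thesis
    by (rule power2_le_imp_le) (use \<open>0 \<le> \<kappa>\<close> in \<open>auto simp: L2_torus_norm_def intro!: mult_nonneg_nonneg integral_nonneg integrable_continuous_interval continuous_intros g\<close>)
qed

lemma fourier_sum_error:
  fixes F :: "nat \<Rightarrow> real \<Rightarrow> real ^ 'd"
  assumes F: "periodic_derivs F q" and "1 \<le> q" "1 \<le> n"
  shows "norm (F 0 x - fourier_sum n (F 0) x) \<le>
    sqrt (2 / real n ^ (2 * q - 1)) / (2 * pi) ^ q * L2_torus_norm (F q)"
proof (rule norm_le_L2_torus_norm[OF periodic_derivs_continuous[OF F order_refl]])
  fix j
  have "complex_of_real ((F 0 x - fourier_sum n (F 0) x) $ j) =
      of_real (F 0 x $ j) - fsum n (\<lambda>x. of_real (F 0 x $ j)) x"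
    using fourier_sum_nth[OF periodic_derivs_continuous[OF F, of 0 UNIV], of n x j] by simp
  then have "\<bar>(F 0 x - fourier_sum n (F 0) x) $ j\<bar> = cmod (of_real (F 0 x $ j) - fsum n (\<lambda>x. of_real (F 0 x $ j)) x)"
    by (metis norm_of_real real_norm_def)
  then show "\<bar>(F 0 x - fourier_sum n (F 0) x) $ j\<bar> \<le>
      sqrt (2 / real n ^ (2 * q - 1)) / (2 * pi) ^ q * sqrt (integral {0..1} (\<lambda>x. (F q x $ j)\<^sup>2))"
    using fsum_error[OF periodic_derivs_nth[OF F] assms(2,3), of x j] by simp
qed simp

lemma norm_fourier_sum_derivative_le:
  fixes F :: "nat \<Rightarrow> real \<Rightarrow> real ^ 'd"
  assumes F: "periodic_derivs F (Suc q)" and "1 \<le> q"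
  shows "norm (fourier_sum n (F 1) x) \<le> L2_torus_norm (F (Suc q))"
proof -
  have "norm (fourier_sum n (F 1) x) \<le> 1 * L2_torus_norm (F (Suc q))"
  proof (rule norm_le_L2_torus_norm[OF periodic_derivs_continuous[OF F order_refl]])
    fix j
    have "\<bar>fourier_sum n (F 1) x $ j\<bar> = cmod (fsum n (\<lambda>x. of_real (F 1 x $ j)) x)"
      using fourier_sum_nth[OF periodic_derivs_continuous[OF F, of 1 UNIV], of n x j]
      by (metis One_nat_def Suc_le_mono le0 norm_of_real real_norm_def)
    then show "\<bar>fourier_sum n (F 1) x $ j\<bar> \<le> 1 * sqrt (integral {0..1} (\<lambda>x. (F (Suc q) x $ j)\<^sup>2))"
      using fsum_derivative_bound[OF periodic_derivs_nth[OF F] assms(2), of n j x] by simp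
  qed simp
  then show ?thesis by simp
qed

lemma has_vector_derivative_fsum:
  assumes G: "periodic_derivs G (Suc q)"
  shows "(fsum n (G 0) has_vector_derivative fsum n (G 1) x) (at x)"
proof -
  have c: "fcoeff (G 1) k = of_real (2 * pi * of_int k) * \<i> * fcoeff (G 0) k" for k
    using G periodic_derivs_continuous[OF G, of 1]
    by (intro fcoeff_derivative) (auto simp: periodic_derivs_def)
  have "((\<lambda>x. \<Sum>k = - int n..int n. cis (2 * pi * of_int k * x) * fcoeff (G 0) k) has_vector_derivative
      (\<Sum>k = - int n..int n. ((of_real (2 * pi * of_int k) * \<i>) * cis (2 * pi * of_int k * x)) * fcoeff (G 0) k)) (at x)"
    by (intro has_vector_derivative_sum has_vector_derivative_mult_left has_vector_derivative_cis)
  then show ?thesis unfolding fsum_def[abs_def] c by (simp add: mult_ac)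
qed

lemma has_vector_derivative_fourier_sum:
  fixes F :: "nat \<Rightarrow> real \<Rightarrow> real ^ 'd"
  assumes F: "periodic_derivs F (Suc q)"
  shows "(fourier_sum n (F 0) has_vector_derivative fourier_sum n (F 1) x) (at x)"
  unfolding has_vector_derivative_at_iff_tendsto
proof (rule vec_tendstoI)
  fix j
  have nth: "fourier_sum n (F i) y $ j = Re (fsum n (\<lambda>x. of_real (F i x $ j)) y)" if "i \<le> Suc q" for i y
    using fourier_sum_nth[OF periodic_derivs_continuous[OF F that], of n y j] by (metis Re_complex_of_real)
  have "(fsum n (\<lambda>x. of_real (F 0 x $ j)) has_vector_derivative fsum n (\<lambda>x. of_real (F 1 x $ j)) x) (at x)"
    by (rule has_vector_derivative_fsum[OF periodic_derivs_nth[OF F]])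
  then have "((\<lambda>y. Re (fsum n (\<lambda>x. of_real (F 0 x $ j)) y)) has_vector_derivative Re (fsum n (\<lambda>x. of_real (F 1 x $ j)) x)) (at x)"
    by (rule bounded_linear.has_vector_derivative[OF bounded_linear_Re])
  then have "((\<lambda>y. fourier_sum n (F 0) y $ j) has_vector_derivative fourier_sum n (F 1) x $ j) (at x)"
    by (simp add: nth)
  then show "((\<lambda>y. ((fourier_sum n (F 0) y - fourier_sum n (F 0) x) /\<^sub>R (y - x)) $ j) \<longlongrightarrow> fourier_sum n (F 1) x $ j) (at x)"
    unfolding has_vector_derivative_at_iff_tendsto by simp
qed

text \<open>On the reals the directional derivative with \<open>v = 1\<close> is the ordinary
  derivative, so this instance of the quantifier over directions in \<open>Ck_on\<close> drives the
  induction.\<close>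

lemma Ck_on_iterated_deriv:
  fixes f :: "real \<Rightarrow> 'a::real_normed_vector"
  assumes "Ck_on r f UNIV"
  shows "(\<forall>i<r. \<forall>x. (iterated_deriv i f has_vector_derivative iterated_deriv (Suc i) f x) (at x)) \<and>
    continuous_on UNIV (iterated_deriv r f)"
  using assms
proof (induction r arbitrary: f)
  case 0
  then show ?case by (simp add: iterated_deriv_def)
next
  case (Suc r)
  let ?f' = "\<lambda>x. vector_derivative f (at x)"
  have diff: "f differentiable (at x)" for x
    using Suc.prems by (simp add: differentiable_on_def)
  have shift: "iterated_deriv (Suc i) f = iterated_deriv i ?f'" for i
    unfolding iterated_deriv_def by (subst funpow_Suc_right) simp
  have "Ck_on r (\<lambda>x. frechet_derivative f (at x) 1) UNIV" using Suc.prems by simp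
  then have "Ck_on r ?f' UNIV" by (simp add: frechet_derivative_eq_vector_derivative[OF diff])
  note IH = Suc.IH[OF this]
  have "(iterated_deriv i f has_vector_derivative iterated_deriv (Suc i) f x) (at x)" if "i < Suc r" for i x
  proof (cases i)
    case 0
    then show ?thesis using diff by (simp add: iterated_deriv_def vector_derivative_works)
  next
    case (Suc i')
    then show ?thesis using IH that by (simp add: shift)
  qed
  then show ?case using IH by (simp add: shift)
qed

lemma periodic_derivs_iterated_deriv:
  fixes f :: "real \<Rightarrow> 'a::real_normed_vector"
  assumes "Ck_on r f UNIV" and per: "\<And>x. f (x + 1) = f x"
  shows "periodic_derivs (\<lambda>i. iterated_deriv i f) r"
proof -
  note D = Ck_on_iterated_deriv[OF assms(1)]
  have "iterated_deriv i f (x + 1) = iterated_deriv i f x" if "i \<le> r" for i x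
    using that
  proof (induction i arbitrary: x)
    case 0
    then show ?case using per by (simp add: iterated_deriv_def)
  next
    case (Suc i)
    have "((\<lambda>y. y + 1) has_vector_derivative 1) (at x)" by (auto intro!: derivative_eq_intros)
    moreover have "(iterated_deriv i f has_vector_derivative iterated_deriv (Suc i) f (x + 1)) (at (x + 1))"
      using D Suc.prems by simp
    ultimately have "(iterated_deriv i f \<circ> (\<lambda>y. y + 1) has_vector_derivative 1 *\<^sub>R iterated_deriv (Suc i) f (x + 1)) (at x)"
      by (rule vector_diff_chain_at)
    moreover have "iterated_deriv i f \<circ> (\<lambda>y. y + 1) = iterated_deriv i f" using Suc by (simp add: fun_eq_iff)
    ultimately have "(iterated_deriv i f has_vector_derivative iterated_deriv (Suc i) f (x + 1)) (at x)" by simp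
    moreover have "(iterated_deriv i f has_vector_derivative iterated_deriv (Suc i) f x) (at x)"
      using D Suc.prems by simp
    ultimately show ?case by (rule vector_derivative_unique_at)
  qed
  then show ?thesis using D by (simp add: periodic_derivs_def)
qed

section \<open>Passage to the reach and the final estimates\<close>

lemma sqrt_two_div_power:
  assumes "1 \<le> q" "1 \<le> n"
  shows "sqrt (2 / real n ^ (2 * q - 1)) = sqrt 2 * real n powr (1/2 - real q)"
proof (rule real_sqrt_unique)
  have "(real n powr (1/2 - real q))\<^sup>2 = real n powr (2 * (1/2 - real q))"
    using assms(2) powr_powr[of "real n" "1/2 - real q" 2] by (simp add: mult.commute flip: powr_numeral)
  also have "2 * (1/2 - real q) = - real (2 * q - 1)" using assms(1) by (simp add: of_nat_diff)
  also have "real n powr - real (2 * q - 1) = 1 / real n ^ (2 * q - 1)"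
    using assms(2) by (subst powr_minus_divide, subst powr_realpow) auto
  finally show "(sqrt 2 * real n powr (1/2 - real q))\<^sup>2 = 2 / real n ^ (2 * q - 1)"
    by (simp add: power_mult_distrib)
qed simp

text \<open>For \<open>\<tau> = \<infinity>\<close> the limit of \<open>2 / t + 1 / (t - \<epsilon>)\<close> is 0, in agreement with \<open>x / \<infinity> = 0\<close> in \<^typ>\<open>ereal\<close>.\<close>

lemma reach_limit_bound:
  fixes \<tau> :: ereal and \<epsilon> a b c :: real
  assumes "0 < \<epsilon>" "ereal \<epsilon> < \<tau>"
    and bound: "\<And>t. \<epsilon> < t \<Longrightarrow> ereal t < \<tau> \<Longrightarrow> a \<le> b + (2 / t + 1 / (t - \<epsilon>)) * c"
  shows "0 \<le> real_of_ereal (2 / \<tau> + 1 / (\<tau> - ereal \<epsilon>))"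
    and "a \<le> b + real_of_ereal (2 / \<tau> + 1 / (\<tau> - ereal \<epsilon>)) * c"
proof -
  let ?K = "real_of_ereal (2 / \<tau> + 1 / (\<tau> - ereal \<epsilon>))"
  have "0 \<le> ?K \<and> a \<le> b + ?K * c"
  proof (cases \<tau>)
    case (real T)
    have T: "\<epsilon> < T" using assms(2) real by simp
    have "2 / ereal T = ereal (2 / T)" "1 / ereal (T - \<epsilon>) = ereal (1 / (T - \<epsilon>))"
      unfolding numeral_eq_ereal one_ereal_def using T assms(1)
      by (simp_all add: divide_ereal_def divide_inverse)
    then have K: "?K = 2 / T + 1 / (T - \<epsilon>)" by (simp add: real)
    have "((\<lambda>t. b + (2 / t + 1 / (t - \<epsilon>)) * c) \<longlongrightarrow> b + (2 / T + 1 / (T - \<epsilon>)) * c) (at_left T)"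
      using T assms(1) by (intro tendsto_intros) auto
    moreover have "\<forall>\<^sub>F t in at_left T. a \<le> b + (2 / t + 1 / (t - \<epsilon>)) * c"
      using eventually_at_left_real[OF T] by eventually_elim (intro bound, auto simp: real)
    ultimately have "a \<le> b + (2 / T + 1 / (T - \<epsilon>)) * c"
      by (rule tendsto_lowerbound) simp
    then show ?thesis unfolding K using T assms(1) by simp
  next
    case PInf
    have "((\<lambda>t. b + (2 / t + 1 / (t - \<epsilon>)) * c) \<longlongrightarrow> b + (0 + 0) * c) at_top"
      by (intro tendsto_intros tendsto_divide_0[OF tendsto_const] filterlim_at_top_imp_at_infinity
        filterlim_ident filterlim_tendsto_add_at_top[of "\<lambda>_. - \<epsilon>" "- \<epsilon>", simplified])
    moreover have "\<forall>\<^sub>F t in at_top. a \<le> b + (2 / t + 1 / (t - \<epsilon>)) * c"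
      using eventually_gt_at_top[of \<epsilon>] by eventually_elim (intro bound, auto simp: PInf)
    ultimately have "a \<le> b + (0 + 0) * c" by (rule tendsto_lowerbound) simp
    then show ?thesis by (simp add: PInf)
  next
    case MInf
    then show ?thesis using assms(2) by simp
  qed
  then show "0 \<le> ?K" "a \<le> b + ?K * c" by blast+
qed

theorem theorem3p4:
  fixes M :: "(real ^ 'd) set" and k r n :: nat and f :: "real \<Rightarrow> real ^ 'd"
    and \<tau> :: ereal and \<epsilon> C1 C2 :: real
  assumes "smooth_submanifold k M" "compact M"
    and "\<tau> = reach M" "0 < \<tau>"
    and "2 \<le> r"
    and "\<And>x. f (x + 1) = f x" "Ck_on r f UNIV" "\<And>x. f x \<in> M"
    and "0 < \<epsilon>" "ereal \<epsilon> < \<tau>"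
    and "C1 = sqrt (2 * real CARD('d)) / (2 * pi) ^ r"
    and "1 \<le> n"
    and "real n powr (real r - 1/2) \<ge> C1 * L2_torus_norm (iterated_deriv r f) / \<epsilon>"
    and "C2 = C1 * real_of_ereal (2 / \<tau> + 1 / (\<tau> - ereal \<epsilon>)) * (1 + 2 * pi * C1 * real n powr (3/2 - real r))"
  shows "(\<forall>x. norm (f x - fourier_sum n f x) \<le> \<epsilon>) \<and>
    (\<forall>x. norm (closest_point M (fourier_sum n f x) - f x)
           \<le> 2 * C1 * real n powr (1/2 - real r) * L2_torus_norm (iterated_deriv r f)) \<and>
    (\<forall>x. (closest_point M \<circ> fourier_sum n f) differentiable (at x) \<and>
           norm (vector_derivative (closest_point M \<circ> fourier_sum n f) (at x) - vector_derivative f (at x))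
           \<le> 2 * pi * C1 * real n powr (3/2 - real r) * L2_torus_norm (iterated_deriv r f)
             + C2 * real n powr (1/2 - real r) * (L2_torus_norm (iterated_deriv r f))\<^sup>2)"
proof -
  define A where "A = L2_torus_norm (iterated_deriv r f)"
  define E where "E = C1 * real n powr (1/2 - real r) * A"
  define N where "N = 2 * pi * C1 * real n powr (3/2 - real r) * A"
  define h where "h = fourier_sum n f"
  define h' where "h' = fourier_sum n (iterated_deriv 1 f)"
  define P where "P = closest_point M"
  define K where "K = real_of_ereal (2 / \<tau> + 1 / (\<tau> - ereal \<epsilon>))"
  define X where "X = 2 * pi * C1 * real n powr (3/2 - real r)"
  obtain q where q: "r = Suc q" "1 \<le> q" using assms(5) by (cases r) auto
  have F: "periodic_derivs (\<lambda>i. iterated_deriv i f) (Suc q)"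
    unfolding q(1)[symmetric] by (rule periodic_derivs_iterated_deriv[OF assms(7)]) (rule assms(6))
  have f0: "iterated_deriv 0 f = f" by (simp add: iterated_deriv_def)
  have A: "0 \<le> A"
    unfolding A_def L2_torus_norm_def q
    by (intro real_sqrt_ge_zero integral_nonneg integrable_continuous_interval continuous_intros
        periodic_derivs_continuous[OF F]) auto
  have C1: "0 \<le> C1" by (simp add: assms(11))
  \<comment> \<open>The Fourier estimates carry \<open>sqrt 2\<close>; the dimension under the root
    in \<open>C1\<close> is at least 1.\<close>
  have C1': "sqrt 2 / (2 * pi) ^ r \<le> C1"
    unfolding assms(11) by (intro divide_right_mono real_sqrt_le_mono) (auto simp: Suc_leI)
  have fD: "(f has_vector_derivative iterated_deriv 1 f x) (at x)" for x
    using F by (auto simp: periodic_derivs_def f0)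
  have hD: "(h has_vector_derivative h' x) (at x)" for x
    using has_vector_derivative_fourier_sum[OF F, of n x] by (simp add: f0 h_def h'_def)
  have err: "norm (f x - h x) \<le> E" for x
  proof -
    have "norm (f x - h x) \<le> (sqrt 2 / (2 * pi) ^ r) * (real n powr (1/2 - real r) * A)"
      using fourier_sum_error[OF F _ assms(12), of x] sqrt_two_div_power[of r n] assms(5,12)
      by (simp add: f0 h_def A_def q)
    also have "\<dots> \<le> C1 * (real n powr (1/2 - real r) * A)"
      using A by (intro mult_right_mono C1') auto
    finally show ?thesis by (simp add: E_def mult.assoc)
  qed
  \<comment> \<open>The same error bound for \<open>f'\<close>, with \<open>q = r - 1\<close> and
    the same top derivative: one power of \<open>2 * pi\<close> and one of \<open>n\<close> fewer in
    the denominator turn the bound into \<open>N\<close>.\<close>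
  have err': "norm (h' x - iterated_deriv 1 f x) \<le> N" for x
  proof -
    have "norm (iterated_deriv 1 f x - h' x) \<le> sqrt 2 * real n powr (1/2 - real q) / (2 * pi) ^ q * A"
      using fourier_sum_error[OF periodic_derivs_shift[OF F] q(2) assms(12), of x] sqrt_two_div_power[OF q(2) assms(12)]
      by (simp add: h'_def A_def q)
    also have "\<dots> = 2 * pi * (sqrt 2 / (2 * pi) ^ r) * (real n powr (3/2 - real r) * A)"
      by (simp add: q)
    also have "\<dots> \<le> 2 * pi * C1 * (real n powr (3/2 - real r) * A)"
      using A by (intro mult_right_mono mult_left_mono C1') auto
    finally show ?thesis by (simp add: N_def mult.assoc norm_minus_commute)
  qed
  have h'_le: "norm (h' x) \<le> A" for x
    using norm_fourier_sum_derivative_le[OF F q(2), of n x] by (simp add: h'_def A_def q)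
  have E\<epsilon>: "E \<le> \<epsilon>"
  proof -
    have "C1 * A \<le> \<epsilon> * real n powr (real r - 1/2)"
      using assms(13,9) by (simp add: A_def field_simps)
    then have "(C1 * A) * real n powr (1/2 - real r) \<le> (\<epsilon> * real n powr (real r - 1/2)) * real n powr (1/2 - real r)"
      by (intro mult_right_mono) auto
    also have "\<dots> = \<epsilon>" using assms(12) by (simp add: mult.assoc flip: powr_add)
    finally show ?thesis by (simp add: E_def mult_ac)
  qed
  have err\<epsilon>: "norm (f x - h x) \<le> \<epsilon>" for x using err[of x] E\<epsilon> by linarith
  have proj: "norm (P (h x) - f x) \<le> 2 * E" for x
  proof -
    have "dist (h x) (P (h x)) \<le> dist (h x) (f x)"
      unfolding P_def by (rule closest_point_le[OF compact_imp_closed[OF assms(2)] assms(8)])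
    then show ?thesis
      using err[of x] norm_triangle_ineq4[of "h x - f x" "h x - P (h x)"] by (simp add: dist_norm norm_minus_commute)
  qed
  have step: "\<exists>u. ((P \<circ> h) has_vector_derivative u) (at x) \<and>
      norm (u - iterated_deriv 1 f x) \<le> N + (2 / t + 1 / (t - \<epsilon>)) * (norm (f x - h x) * norm (h' x))"
    if t: "\<epsilon> < t" "ereal t < \<tau>" for t x
  proof -
    have "0 < t" using t(1) assms(9) by simp
    moreover have "ereal t < reach M" using t(2) assms(3) by simp
    ultimately obtain u where "((P \<circ> h) has_vector_derivative u) (at x)"
      "norm (u - iterated_deriv 1 f x) \<le> norm (h' x - iterated_deriv 1 f x) +
        (2 / t + 1 / (t - \<epsilon>)) * norm (f x - h x) * norm (h' x)"
      using closest_point_curve_derivative[OF assms(1,2) _ _ t(1) assms(8) fD err\<epsilon> hD]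
      unfolding P_def by metis
    then show ?thesis using err'[of x] by (intro exI[of _ u]) (simp add: mult.assoc)
  qed
  obtain t0 where t0: "\<epsilon> < t0" "ereal t0 < \<tau>" using ereal_dense2[OF assms(10)] by auto
  have deriv: "(P \<circ> h) differentiable (at x) \<and>
    norm (vector_derivative (P \<circ> h) (at x) - vector_derivative f (at x)) \<le> N + C2 * real n powr (1/2 - real r) * A\<^sup>2" for x
  proof -
    let ?c = "norm (f x - h x) * norm (h' x)"
    have diff: "(P \<circ> h) differentiable (at x)" using step[OF t0] differentiableI_vector by blast
    have f': "vector_derivative f (at x) = iterated_deriv 1 f x" using fD by (rule vector_derivative_at)
    \<comment> \<open>The vector obtained from \<open>step\<close> could depend on \<open>t\<close>.
      Being a derivative it is unique, so the left side stays fixed while \<open>t\<close> tends to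
      the reach.\<close>
    have bound: "norm (vector_derivative (P \<circ> h) (at x) - vector_derivative f (at x)) \<le> N + (2 / t + 1 / (t - \<epsilon>)) * ?c"
      if "\<epsilon> < t" "ereal t < \<tau>" for t
      using step[OF that, of x] vector_derivative_at f' by metis
    have K: "0 \<le> K" and "norm (vector_derivative (P \<circ> h) (at x) - vector_derivative f (at x)) \<le> N + K * ?c"
      using reach_limit_bound[OF assms(9,10) bound] by (auto simp: K_def)
    moreover have "K * ?c \<le> C2 * real n powr (1/2 - real r) * A\<^sup>2"
    proof -
      have "K * ?c \<le> K * (E * A)"
        using K err[of x] h'_le[of x] order_trans[OF norm_ge_zero err[of x]]
        by (intro mult_left_mono mult_mono) auto
      \<comment> \<open>As \<open>X\<close> is nonnegative, the factor \<open>1 + X\<close> of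
        \<open>C2\<close> can be inserted here.\<close>
      also have "K * (E * A) * 1 \<le> K * (E * A) * (1 + X)"
        using K A C1 by (intro mult_left_mono) (auto simp: E_def X_def)
      then have "K * (E * A) \<le> K * (E * A) * (1 + X)" by simp
      also have "\<dots> = C2 * real n powr (1/2 - real r) * A\<^sup>2"
        by (simp add: assms(14) E_def X_def K_def power2_eq_square)
      finally show ?thesis .
    qed
    ultimately show ?thesis using diff by linarith
  qed
  show ?thesis
    using err\<epsilon> proj deriv unfolding A_def E_def N_def h_def P_def by (simp add: mult.assoc)
qed

end
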